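(* Let $K$ be an infinite field and $n\ge 1$ an integer. Then $\delta(n)\ge\lfloor\sqrt{n+1}\rfloor$ and $\gamma(n)\ge n\lfloor\sqrt{n+1}\rfloor$.
   Context: $\mathrm{Mat}_{p,q}$ is the space of $p\times q$ matrices over $K$. The group $G=\mathrm{SL}_n\times \mathrm{SL}_n$ acts on $V=\mathrm{Mat}_{n,n}^m$ by $(A,B)\cdot(X_1,\dots,X_m)=(AX_1B^{-1},\dots,AX_mB^{-1})$, and $R(n,m)=K[V]^G$ is the graded ring of invariant polynomial functions. The null cone $\mathcal N(n,m)\subseteq V$ is the zero set of all non-constant homogeneous invariants in $R(n,m)$. For $T=(T_1,\dots,T_m)\in\mathrm{Mat}_{d,d}^m$, the invariant $f_T\in R(n,m)$ is $f_T(X_1,\dots,X_m)=\det(X_1\otimes T_1+\cdots+X_m\otimes T_m)$, where $\otimes$ is the Kronecker product. $\gamma(n,m)$ is the smallest positive integer $d$ such that the non-constant homogeneous invariants of degree $\le d$ have zero set equal to $\mathcal N(n,m)$. $\delta(n,m)$ is the smallest positive integer $k$ such that for every $X\notin\mathcal N(n,m)$ there exist an integer $d$ with $1\le d\le k$ and $T\in\mathrm{Mat}_{d,d}^m$ with $f_T(X)\ne0$. Finally $\delta(n)=\max_m\delta(n,m)=\delta(n,n^2)$ and $\gamma(n)=\gamma(n,n^2)=n\delta(n)$. *)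

theory Defs
  imports
    Complex_Main
    "HOL-Library.FuncSet"
    "HOL-Library.Extended_Nat"
    "Jordan_Normal_Form.Determinant"
    "Jordan_Normal_Form.Gauss_Jordan_Elimination"
begin

definition mat_tuples :: "nat \<Rightarrow> nat \<Rightarrow> 'a mat list set" where
  "mat_tuples n m = {X. length X = m \<and> set X \<subseteq> carrier_mat n n}"

definition SL :: "nat \<Rightarrow> 'a::field mat set" where
  "SL n = {A \<in> carrier_mat n n. det A = 1}"

(* mat_inverse returns an option; on SL n it is always Some. *)
definition left_right_action :: "'a::field mat \<Rightarrow> 'a mat \<Rightarrow> 'a mat list \<Rightarrow> 'a mat list" where
  "left_right_action A B X = map (\<lambda>Y. A * Y * the (mat_inverse B)) X"

(* (k, i, j) indexes the (i, j) entry of the k-th matrix of a tuple. *)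
definition coords :: "nat \<Rightarrow> nat \<Rightarrow> (nat \<times> nat \<times> nat) set" where
  "coords n m = {..<m} \<times> {..<n} \<times> {..<n}"

definition exponents :: "nat \<Rightarrow> nat \<Rightarrow> nat \<Rightarrow> (nat \<times> nat \<times> nat \<Rightarrow> nat) set" where
  "exponents n m d = {e \<in> coords n m \<rightarrow>\<^sub>E {..d}. (\<Sum>p\<in>coords n m. e p) = d}"

definition monomial_fun ::
    "nat \<Rightarrow> nat \<Rightarrow> (nat \<times> nat \<times> nat \<Rightarrow> nat) \<Rightarrow> 'a::field mat list \<Rightarrow> 'a" where
  "monomial_fun n m e X = (\<Prod>(k, i, j)\<in>coords n m. (X ! k) $$ (i, j) ^ e (k, i, j))"

(* Only the values on mat_tuples n m matter: functions outside that set are unconstrained. *)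
definition homogeneous_poly_fun ::
    "nat \<Rightarrow> nat \<Rightarrow> nat \<Rightarrow> ('a::field mat list \<Rightarrow> 'a) \<Rightarrow> bool" where
  "homogeneous_poly_fun n m d f \<longleftrightarrow>
     (\<exists>c. \<forall>X\<in>mat_tuples n m. f X = (\<Sum>e\<in>exponents n m d. c e * monomial_fun n m e X))"

definition SL_invariant :: "nat \<Rightarrow> nat \<Rightarrow> ('a::field mat list \<Rightarrow> 'a) \<Rightarrow> bool" where
  "SL_invariant n m f \<longleftrightarrow>
     (\<forall>A\<in>SL n. \<forall>B\<in>SL n. \<forall>X\<in>mat_tuples n m. f (left_right_action A B X) = f X)"

definition nonconstant_invariants ::
    "nat \<Rightarrow> nat \<Rightarrow> nat \<Rightarrow> ('a::field mat list \<Rightarrow> 'a) set" where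
  "nonconstant_invariants n m d =
     {f. homogeneous_poly_fun n m d f \<and> SL_invariant n m f
         \<and> \<not> (\<exists>c. \<forall>X\<in>mat_tuples n m. f X = c)}"

definition zero_set ::
    "nat \<Rightarrow> nat \<Rightarrow> ('a::field mat list \<Rightarrow> 'a) set \<Rightarrow> 'a mat list set" where
  "zero_set n m F = {X \<in> mat_tuples n m. \<forall>f\<in>F. f X = 0}"

definition null_cone :: "nat \<Rightarrow> nat \<Rightarrow> 'a::field mat list set" where
  "null_cone n m = zero_set n m (\<Union>d. nonconstant_invariants n m d)"

definition kronecker :: "'a::field mat \<Rightarrow> 'a mat \<Rightarrow> 'a mat" where
  "kronecker A B = mat (dim_row A * dim_row B) (dim_col A * dim_col B)
     (\<lambda>(i, j). A $$ (i div dim_row B, j div dim_col B) * B $$ (i mod dim_row B, j mod dim_col B))"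

definition det_invariant ::
    "nat \<Rightarrow> nat \<Rightarrow> 'a::field mat list \<Rightarrow> 'a mat list \<Rightarrow> 'a" where
  "det_invariant n d T X = det (foldr (+) (map2 kronecker X T) (0\<^sub>m (n * d) (n * d)))"

(* gamma and delta are minima of sets of positive integers. They are taken in enat, where the
   infimum of a nonempty set of naturals is its minimum and the infimum of the empty set is
   infinity. The itself argument names the field K. *)
definition gamma_tuple :: "'a::field itself \<Rightarrow> nat \<Rightarrow> nat \<Rightarrow> enat" where
  "gamma_tuple _ n m = Inf {enat d | d. d \<ge> 1 \<and>
     zero_set n m (\<Union>e\<in>{..d}. nonconstant_invariants n m e) = (null_cone n m :: 'a mat list set)}"

definition delta_tuple :: "'a::field itself \<Rightarrow> nat \<Rightarrow> nat \<Rightarrow> enat" where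
  "delta_tuple _ n m = Inf {enat k | k. k \<ge> 1 \<and>
     (\<forall>X \<in> mat_tuples n m - (null_cone n m :: 'a mat list set).
        \<exists>d. 1 \<le> d \<and> d \<le> k \<and> (\<exists>T\<in>mat_tuples d m. det_invariant n d T X \<noteq> 0))}"

definition gamma :: "'a::field itself \<Rightarrow> nat \<Rightarrow> enat" where
  "gamma K n = gamma_tuple K n (n\<^sup>2)"

definition delta :: "'a::field itself \<Rightarrow> nat \<Rightarrow> enat" where
  "delta K n = (SUP m\<in>{1..}. delta_tuple K n m)"

end

theory Submission
  imports Defs "HOL-Computational_Algebra.Polynomial"
begin

text \<open>
  Put \<open>d = k + 1\<close> with \<open>k\<^sup>2 + 2 k \<le> n\<close>. The witness is a tuple whose pencil, after normalising one
  variable to 1 and eliminating rows, has the Schur complement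
  \<open>([(\<mu>\<^sub>i + x)\<^sup>-\<^sup>1, y\<^sub>j])\<close> with \<open>i < k\<close> and \<open>1 \<le> j \<le> k\<close>. For a diagonal \<open>x\<close> and cyclic shifts
  \<open>y\<^sub>j\<close> of size \<open>d\<close> it is invertible, so the tuple lies outside the null cone.

  Conversely, an invariant of degree below \<open>n d\<close> that does not vanish at the tuple is semi-invariant
  of some weight \<open>e \<le> k\<close> for the full group of row and column operations. One row of the pencil
  has \<open>k + 1\<close> entries, but the invariant has degree \<open>e\<close> in that row; hence its value is
  an alternating sum of values at pencils in which a nonempty set of these entries has been deleted.
  Each deletion isolates one occurrence of \<open>\<mu>\<^sub>0 + x\<close>, so this occurrence can be kept while the others are
  replaced by \<open>t + x\<close>. The resulting polynomial in \<open>t\<close> vanishes to order \<open>e\<close> at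
  \<open>\<mu>\<^sub>1, \<dots>, \<mu>\<^bsub>k-1\<^esub>\<close>, while its growth at infinity bounds its degree by \<open>(k - 2) e\<close>. So it is zero, and
  \<open>t = \<mu>\<^sub>0\<close> gives the claim. Neither the
  description of all invariants by determinants nor any restriction on the characteristic is needed.
\<close>

section \<open>Polynomial functions of one variable\<close>

text \<open>The commutators come from a dimension count. For \<open>x\<close> of size e \<le> k, the
  k inverses \<open>(\<mu>\<^sub>i + x)\<^sup>-\<^sup>1\<close>, where they exist, lie in K[x],
  which has dimension at most e and contains the scalars. Some nontrivial combination of them is
  therefore scalar and commutes with every \<open>y\<^sub>j\<close>, so the Schur complement is
  singular. At size k + 1 a diagonal \<open>x\<close> with distinct entries keeps them independent
  modulo scalars.

  For an arbitrary semi-invariant, linear dependence has to be replaced by counting zeros in a node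
  t. The obstacle is that the direct count is exactly tight: with t in all k + 1 columns
  \<open>Blk j 0\<close> the degree is at most (k - 1) e, which the k - 1 roots of order e just
  reach. Keeping t out of a single one of these columns lowers the bound by e, and this is possible
  only where the column misses row \<open>Top 0\<close>; hence the deletions.

  The square root in the bound is the size of the pencil: k + k (k + 1) = (k + 1)^2 - 1
  rows.\<close>

definition poly_fun :: "('a::comm_semiring_0 \<Rightarrow> 'a) \<Rightarrow> bool" where
  "poly_fun g \<longleftrightarrow> (\<exists>p. \<forall>t. g t = poly p t)"

lemma poly_fun_const: "poly_fun (\<lambda>t. c)"
  unfolding poly_fun_def by (rule exI[of _ "[:c:]"]) simp

lemma poly_fun_id: "poly_fun (\<lambda>t::'a::comm_semiring_1. t)"
  unfolding poly_fun_def by (rule exI[of _ "[:0,1:]"]) simp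

lemma poly_fun_if: "poly_fun f \<Longrightarrow> poly_fun g \<Longrightarrow> poly_fun (\<lambda>t. if b then f t else g t)"
  by (cases b) simp_all

lemma poly_fun_add: "poly_fun f \<Longrightarrow> poly_fun g \<Longrightarrow> poly_fun (\<lambda>t. f t + g t)"
  unfolding poly_fun_def by (metis poly_add)

lemma poly_fun_mult: "poly_fun f \<Longrightarrow> poly_fun g \<Longrightarrow> poly_fun (\<lambda>t. f t * g t)"
  for f :: "'a::comm_semiring_0 \<Rightarrow> 'a"
  unfolding poly_fun_def by (metis poly_mult)

lemma poly_fun_sum: "(\<And>i. i \<in> I \<Longrightarrow> poly_fun (f i)) \<Longrightarrow> poly_fun (\<lambda>t. \<Sum>i\<in>I. f i t)"
  by (induction I rule: infinite_finite_induct) (auto intro: poly_fun_const poly_fun_add)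

lemma poly_fun_prod:
  fixes f :: "'i \<Rightarrow> 'a::comm_semiring_1 \<Rightarrow> 'a"
  shows "(\<And>i. i \<in> I \<Longrightarrow> poly_fun (f i)) \<Longrightarrow> poly_fun (\<lambda>t. \<Prod>i\<in>I. f i t)"
  by (induction I rule: infinite_finite_induct) (auto intro: poly_fun_const poly_fun_mult)

lemma poly_fun_power: "poly_fun f \<Longrightarrow> poly_fun (\<lambda>t. f t ^ m)"
  for f :: "'a::comm_semiring_1 \<Rightarrow> 'a"
  by (induction m) (auto intro: poly_fun_const poly_fun_mult)

lemmas poly_fun_intros = poly_fun_const poly_fun_id poly_fun_if poly_fun_add poly_fun_mult
  poly_fun_sum poly_fun_prod poly_fun_power

section \<open>Polynomial identities and degree bounds over an infinite field\<close>

lemma poly_eqI_infinite: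
  fixes p q :: "'a::idom poly"
  assumes "infinite (UNIV :: 'a set)" "finite S" "\<And>t. t \<notin> S \<Longrightarrow> poly p t = poly q t"
  shows "p = q"
proof (rule ccontr)
  assume "p \<noteq> q"
  hence "finite {t. poly (p - q) t = 0}" by (intro poly_roots_finite) simp
  moreover have "UNIV \<subseteq> {t. poly (p - q) t = 0} \<union> S" using assms(3) by auto
  ultimately show False using assms(1,2) finite_subset by blast
qed

lemma poly_fun_eqI_infinite:
  fixes f g :: "'a::idom \<Rightarrow> 'a"
  assumes "infinite (UNIV :: 'a set)" "poly_fun f" "poly_fun g" "finite S"
    "\<And>t. t \<notin> S \<Longrightarrow> f t = g t"
  shows "f t = g t"
proof -
  obtain p q where p: "\<And>t. f t = poly p t" and q: "\<And>t. g t = poly q t"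
    using assms(2,3) unfolding poly_fun_def by blast
  have "p = q" using poly_eqI_infinite[OF assms(1,4), of p q] assms(5) p q by auto
  thus ?thesis using p q by simp
qed

text \<open>Clearing denominators with \<open>t ^ degree r\<close> turns the right-hand side into
  \<open>t ^ N\<close> times the reflected polynomial, whose degree is at most
  \<open>degree r\<close>; comparing degrees then cancels \<open>degree r\<close>.\<close>

lemma degree_le_of_inverse_growth:
  fixes A r :: "'a::field poly"
  assumes inf: "infinite (UNIV :: 'a set)"
    and eq: "\<And>t. t \<noteq> 0 \<Longrightarrow> poly A t = t ^ N * poly r (inverse t)"
  shows "degree A \<le> N"
proof (cases "A = 0")
  case False
  have "monom 1 (degree r) * A = monom 1 N * reflect_poly r"
  proof (rule poly_eqI_infinite[OF inf, of "{0}"])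
    fix t :: 'a assume "t \<notin> {0}"
    hence t: "t \<noteq> 0" by simp
    have "poly (reflect_poly r) t = t ^ degree r * poly r (inverse t)"
      by (rule poly_reflect_poly_nz[OF t])
    thus "poly (monom 1 (degree r) * A) t = poly (monom 1 N * reflect_poly r) t"
      using eq[OF t] by (simp add: poly_monom mult_ac)
  qed simp
  hence "degree (monom 1 (degree r) * A) = degree (monom 1 N * reflect_poly r)" by simp
  moreover have "degree (monom 1 (degree r) * A) = degree r + degree A"
    using False by (subst degree_mult_eq) (auto simp: degree_monom_eq monom_eq_0_iff)
  moreover have "degree (monom 1 N * reflect_poly r) \<le> N + degree r"
    by (rule order.trans[OF degree_mult_le])
       (auto intro!: add_mono simp: degree_monom_le degree_reflect_poly_le)
  ultimately show ?thesis by simp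
qed simp

text \<open>Roots are counted with multiplicity: the distinct points \<open>m i\<close> contribute
  at least \<open>e\<close> each to \<open>proots q\<close>.\<close>

lemma degree_ge_of_root_powers:
  fixes q :: "'a::field poly"
  assumes "q \<noteq> 0" "finite I" "inj_on m I" "\<And>i. i \<in> I \<Longrightarrow> [:- m i, 1:] ^ e dvd q"
  shows "card I * e \<le> degree q"
proof -
  have "card I * e = (\<Sum>i\<in>I. e)" by simp
  also have "\<dots> \<le> (\<Sum>i\<in>I. count (proots q) (m i))"
    using assms(1,4) by (intro sum_mono) (simp add: order_divides)
  also have "\<dots> = (\<Sum>x\<in>m ` I. count (proots q) x)"
    using assms(3) by (simp add: sum.reindex)
  also have "\<dots> \<le> (\<Sum>x\<in>m ` I \<union> set_mset (proots q). count (proots q) x)"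
    using assms(2) by (intro sum_mono2) auto
  also have "\<dots> = (\<Sum>x\<in>set_mset (proots q). count (proots q) x)"
    using assms(2) by (intro sum.mono_neutral_right) (auto simp: not_in_iff)
  also have "\<dots> = size (proots q)" by (simp add: size_multiset_overloaded_eq)
  also have "\<dots> \<le> degree q" by (rule size_proots_le)
  finally show ?thesis .
qed

section \<open>Semi-invariants of tensors with labelled rows and columns\<close>

text \<open>\<open>\<Phi> r c v\<close> is the coefficient of variable \<open>v\<close> in entry (r,
  c) of a matrix of linear forms. Labels in place of indices let the pencil be addressed by its
  block structure. \<open>alternating_row\<close> encodes degree at most \<open>e\<close> in one row
  as the vanishing of finite differences of higher order, a form that is meaningful in every
  characteristic.\<close>

locale semi_invariant =
  fixes F :: "('r \<Rightarrow> 'c \<Rightarrow> nat \<Rightarrow> 'a::field) \<Rightarrow> 'a"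
    and R :: "'r set" and C :: "'c set" and m e :: nat
  assumes infinite_field: "infinite (UNIV :: 'a set)"
    and finite_rows: "finite R" and finite_cols: "finite C"
    and F_cong: "(\<And>r c v. r \<in> R \<Longrightarrow> c \<in> C \<Longrightarrow> v < m \<Longrightarrow> \<Phi> r c v = \<Phi>' r c v) \<Longrightarrow> F \<Phi> = F \<Phi>'"
    and add_row: "r \<in> R \<Longrightarrow> s \<in> R \<Longrightarrow> r \<noteq> s \<Longrightarrow>
      F (\<lambda>r' c v. \<Phi> r' c v + (if r' = r then a * \<Phi> s c v else 0)) = F \<Phi>"
    and add_col: "c \<in> C \<Longrightarrow> d \<in> C \<Longrightarrow> c \<noteq> d \<Longrightarrow>
      F (\<lambda>r c' v. \<Phi> r c' v + (if c' = c then a * \<Phi> r d v else 0)) = F \<Phi>"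
    and scale_row: "r \<in> R \<Longrightarrow> F (\<lambda>r' c v. (if r' = r then a else 1) * \<Phi> r' c v) = a ^ e * F \<Phi>"
    and scale_col: "c \<in> C \<Longrightarrow> F (\<lambda>r c' v. (if c' = c then a else 1) * \<Phi> r c' v) = a ^ e * F \<Phi>"
    and poly_fun_F: "(\<And>r c v. poly_fun (\<lambda>t. \<Phi>t t r c v)) \<Longrightarrow> poly_fun (\<lambda>t. F (\<Phi>t t))"
    and alternating_row: "\<And>\<chi> :: nat \<Rightarrow> 'c \<Rightarrow> nat \<Rightarrow> 'a. r \<in> R \<Longrightarrow> finite D \<Longrightarrow> e < card D \<Longrightarrow>
      (\<Sum>L\<in>Pow D. (-1) ^ card L *
        F (\<Phi>(r := (\<lambda>c v. b c v + (\<Sum>j\<in>D - L. \<chi> j c v))))) = 0"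
begin

section \<open>Operations on several rows or columns at once\<close>

lemma add_rows:
  assumes "P \<subseteq> R" "g ` P \<subseteq> R - P"
  shows "F (\<lambda>r c v. \<Phi> r c v + (if r \<in> P then a r * \<Phi> (g r) c v else 0)) = F \<Phi>"
  using finite_subset[OF assms(1) finite_rows] assms
proof (induction P)
  case (insert p P)
  let ?\<Psi> = "\<lambda>r c v. \<Phi> r c v + (if r \<in> P then a r * \<Phi> (g r) c v else 0)"
  have "g p \<in> R" "g p \<noteq> p" "g p \<notin> P" "p \<in> R" using insert by auto
  moreover have "p \<notin> P" using insert by simp
  \<comment> \<open>The source row \<open>g p\<close> lies outside the modified set, so it is still
    unchanged when its turn comes.\<close>
  ultimately have "F (\<lambda>r c v. \<Phi> r c v + (if r \<in> insert p P then a r * \<Phi> (g r) c v else 0))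
      = F (\<lambda>r c v. ?\<Psi> r c v + (if r = p then a p * ?\<Psi> (g p) c v else 0))"
    by (intro F_cong) auto
  also have "\<dots> = F ?\<Psi>" by (intro add_row) (use \<open>g p \<noteq> p\<close> \<open>g p \<in> R\<close> \<open>p \<in> R\<close> in auto)
  also have "\<dots> = F \<Phi>" by (rule insert.IH) (use insert.prems in auto)
  finally show ?case .
qed simp

lemma add_cols:
  assumes "P \<subseteq> C" "g ` P \<subseteq> C - P"
  shows "F (\<lambda>r c v. \<Phi> r c v + (if c \<in> P then a c * \<Phi> r (g c) v else 0)) = F \<Phi>"
  using finite_subset[OF assms(1) finite_cols] assms
proof (induction P)
  case (insert p P)
  let ?\<Psi> = "\<lambda>r c v. \<Phi> r c v + (if c \<in> P then a c * \<Phi> r (g c) v else 0)"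
  have "g p \<in> C" "g p \<noteq> p" "g p \<notin> P" "p \<in> C" using insert by auto
  moreover have "p \<notin> P" using insert by simp
  ultimately have "F (\<lambda>r c v. \<Phi> r c v + (if c \<in> insert p P then a c * \<Phi> r (g c) v else 0))
      = F (\<lambda>r c v. ?\<Psi> r c v + (if c = p then a p * ?\<Psi> r (g p) v else 0))"
    by (intro F_cong) auto
  also have "\<dots> = F ?\<Psi>" by (intro add_col) (use \<open>g p \<noteq> p\<close> \<open>g p \<in> C\<close> \<open>p \<in> C\<close> in auto)
  also have "\<dots> = F \<Phi>" by (rule insert.IH) (use insert.prems in auto)
  finally show ?case .
qed simp

lemma scale_rows:
  assumes "P \<subseteq> R"
  shows "F (\<lambda>r c v. (if r \<in> P then a else 1) * \<Phi> r c v) = a ^ (card P * e) * F \<Phi>"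
  using finite_subset[OF assms(1) finite_rows] assms
proof (induction P)
  case (insert p P)
  let ?\<Psi> = "\<lambda>r c v. (if r \<in> P then a else 1) * \<Phi> r c v"
  have "F (\<lambda>r c v. (if r \<in> insert p P then a else 1) * \<Phi> r c v)
      = F (\<lambda>r c v. (if r = p then a else 1) * ?\<Psi> r c v)"
    using insert.hyps(2) by (intro F_cong) auto
  also have "\<dots> = a ^ e * F ?\<Psi>" using insert by (intro scale_row) auto
  also have "F ?\<Psi> = a ^ (card P * e) * F \<Phi>" using insert by auto
  finally show ?case using insert by (simp add: power_add)
qed simp

lemma scale_cols:
  assumes "P \<subseteq> C"
  shows "F (\<lambda>r c v. (if c \<in> P then a else 1) * \<Phi> r c v) = a ^ (card P * e) * F \<Phi>"
  using finite_subset[OF assms(1) finite_cols] assms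
proof (induction P)
  case (insert p P)
  let ?\<Psi> = "\<lambda>r c v. (if c \<in> P then a else 1) * \<Phi> r c v"
  have "F (\<lambda>r c v. (if c \<in> insert p P then a else 1) * \<Phi> r c v)
      = F (\<lambda>r c v. (if c = p then a else 1) * ?\<Psi> r c v)"
    using insert.hyps(2) by (intro F_cong) auto
  also have "\<dots> = a ^ e * F ?\<Psi>" using insert by (intro scale_col) auto
  also have "F ?\<Psi> = a ^ (card P * e) * F \<Phi>" using insert by auto
  finally show ?case using insert by (simp add: power_add)
qed simp

text \<open>The isolated entry is a linear form and cannot serve as a pivot. Instead the torus is
  used: scaling row \<open>r\<close> by t and column \<open>c\<close> by 1/t multiplies exactly the
  other entries of row \<open>r\<close> by t and preserves F. Being polynomial in t, this extends to
  t = 0.\<close>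

lemma clear_row:
  assumes "r \<in> R" "c \<in> C" "\<And>r' v. r' \<in> R \<Longrightarrow> r' \<noteq> r \<Longrightarrow> v < m \<Longrightarrow> \<Phi> r' c v = 0"
  shows "F (\<lambda>r' c' v. if r' = r \<and> c' \<noteq> c then 0 else \<Phi> r' c' v) = F \<Phi>"
proof -
  define \<Psi> where "\<Psi> t = (\<lambda>r' c' v. (if r' = r \<and> c' \<noteq> c then t else 1) * \<Phi> r' c' v)" for t
  have "F (\<Psi> t) = F \<Phi>" if t: "t \<notin> {0}" for t
  proof -
    have "t ^ e * F (\<Psi> t) = F (\<lambda>r' c' v. (if c' = c then t else 1) * \<Psi> t r' c' v)"
      by (rule scale_col[OF assms(2), symmetric])
    also have "\<dots> = F (\<lambda>r' c' v. (if r' = r then t else 1) * \<Phi> r' c' v)"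
      by (intro F_cong) (simp add: \<Psi>_def assms(3))
    also have "\<dots> = t ^ e * F \<Phi>" by (rule scale_row[OF assms(1)])
    finally show ?thesis using t by simp
  qed
  moreover have "poly_fun (\<lambda>t. F (\<Psi> t))"
    unfolding \<Psi>_def by (intro poly_fun_F poly_fun_intros)
  ultimately have "F (\<Psi> 0) = F \<Phi>"
    using poly_fun_eqI_infinite[OF infinite_field _ poly_fun_const, of "\<lambda>t. F (\<Psi> t)" "{0}" "F \<Phi>" 0]
    by simp
  moreover have "F (\<Psi> 0) = F (\<lambda>r' c' v. if r' = r \<and> c' \<noteq> c then 0 else \<Phi> r' c' v)"
    by (intro F_cong) (auto simp: \<Psi>_def)
  ultimately show ?thesis by simp
qed

lemma swap_rows:
  assumes "r \<in> R" "s \<in> R" "r \<noteq> s"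
  shows "F (\<lambda>r'. \<Phi> (if r' = r then s else if r' = s then r else r')) = (-1) ^ e * F \<Phi>"
proof -
  let ?A = "\<lambda>r' c v. \<Phi> r' c v + (if r' = r then 1 * \<Phi> s c v else 0)"
  let ?B = "\<lambda>r' c v. ?A r' c v + (if r' = s then (-1) * ?A r c v else 0)"
  let ?C = "\<lambda>r' c v. ?B r' c v + (if r' = r then 1 * ?B s c v else 0)"
  have "F (\<lambda>r'. \<Phi> (if r' = r then s else if r' = s then r else r'))
      = F (\<lambda>r' c v. (if r' = s then -1 else 1) * ?C r' c v)"
    using assms by (intro F_cong) auto
  also have "\<dots> = (-1) ^ e * F ?C" using assms by (intro scale_row)
  also have "F ?C = F ?B" using assms by (intro add_row) auto
  also have "F ?B = F ?A" using assms by (intro add_row) auto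
  also have "F ?A = F \<Phi>" using assms by (intro add_row) auto
  finally show ?thesis .
qed

lemma swap_cols:
  assumes "r \<in> C" "s \<in> C" "r \<noteq> s"
  shows "F (\<lambda>r' c. \<Phi> r' (if c = r then s else if c = s then r else c)) = (-1) ^ e * F \<Phi>"
proof -
  let ?A = "\<lambda>c r' v. \<Phi> c r' v + (if r' = r then 1 * \<Phi> c s v else 0)"
  let ?B = "\<lambda>c r' v. ?A c r' v + (if r' = s then (-1) * ?A c r v else 0)"
  let ?C = "\<lambda>c r' v. ?B c r' v + (if r' = r then 1 * ?B c s v else 0)"
  have "F (\<lambda>r' c. \<Phi> r' (if c = r then s else if c = s then r else c))
      = F (\<lambda>c r' v. (if r' = s then -1 else 1) * ?C c r' v)"
    using assms by (intro F_cong) auto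
  also have "\<dots> = (-1) ^ e * F ?C" using assms by (intro scale_col)
  also have "F ?C = F ?B" using assms by (intro add_col) auto
  also have "F ?B = F ?A" using assms by (intro add_col) auto
  also have "F ?A = F \<Phi>" using assms by (intro add_col) auto
  finally show ?thesis .
qed

text \<open>Once both rows are cleared, the two entries are alone in their rows and columns, so
  exchanging the rows and then the columns interchanges just these entries. The two signs
  \<open>(-1) ^ e\<close> cancel.\<close>

lemma swap_isolated_entries:
  assumes "r \<in> R" "s \<in> R" "r \<noteq> s" "c \<in> C" "d \<in> C" "c \<noteq> d"
    and c: "\<And>r' v. r' \<in> R \<Longrightarrow> r' \<noteq> r \<Longrightarrow> v < m \<Longrightarrow> \<Phi> r' c v = 0"
    and d: "\<And>r' v. r' \<in> R \<Longrightarrow> r' \<noteq> s \<Longrightarrow> v < m \<Longrightarrow> \<Phi> r' d v = 0"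
  shows "F (\<lambda>r' c' v. if r' = r \<and> c' = c then \<Phi> s d v
                      else if r' = s \<and> c' = d then \<Phi> r c v else \<Phi> r' c' v) = F \<Phi>"
    (is "F ?\<Psi> = _")
proof -
  define clear where "clear \<Phi> = (\<lambda>r' c' v. if r' = s \<and> c' \<noteq> d then 0
      else if r' = r \<and> c' \<noteq> c then 0 else \<Phi> r' c' v)"
    for \<Phi> :: "'r \<Rightarrow> 'c \<Rightarrow> nat \<Rightarrow> 'a"
  have clear: "F (clear \<Phi>') = F \<Phi>'"
    if "\<And>r' v. r' \<in> R \<Longrightarrow> r' \<noteq> r \<Longrightarrow> v < m \<Longrightarrow> \<Phi>' r' c v = 0"
       "\<And>r' v. r' \<in> R \<Longrightarrow> r' \<noteq> s \<Longrightarrow> v < m \<Longrightarrow> \<Phi>' r' d v = 0" for \<Phi>'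
  proof -
    have "F (clear \<Phi>') = F (\<lambda>r' c' v. if r' = r \<and> c' \<noteq> c then 0 else \<Phi>' r' c' v)"
      unfolding clear_def using that(2) by (intro clear_row assms(2,5)) simp
    also have "\<dots> = F \<Phi>'" using that(1) by (intro clear_row assms(1,4)) simp
    finally show ?thesis .
  qed
  let ?swap = "\<lambda>\<Phi> r' c'. \<Phi> (if r' = r then s else if r' = s then r else r')
                              (if c' = c then d else if c' = d then c else c')"
  have neq: "s \<noteq> r" "d \<noteq> c" using assms(3,6) by auto
  have "F ?\<Psi> = F (clear ?\<Psi>)"
    by (intro clear[symmetric]) (use assms(3,6) neq c d in \<open>simp_all split: if_splits\<close>)
  also have "\<dots> = F (?swap (clear \<Phi>))"
    using assms(3,6) neq c d by (intro F_cong) (simp add: clear_def)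
  also have "\<dots> = (-1) ^ e * F (\<lambda>r' c'. clear \<Phi> r' (if c' = c then d else if c' = d then c else c'))"
    by (intro swap_rows assms(1-3))
  also have "\<dots> = (-1) ^ e * ((-1) ^ e * F (clear \<Phi>))"
    by (subst swap_cols[OF assms(4-6)]) simp
  also have "\<dots> = F (clear \<Phi>)" by (simp flip: power_mult_distrib mult.assoc)
  also have "\<dots> = F \<Phi>" by (intro clear c d)
  finally show ?thesis .
qed

end

section \<open>A pencil on which semi-invariants of small weight vanish\<close>

lemma sum_Pow_split:
  assumes "finite A" "t \<in> A"
  shows "sum f (Pow A) = (\<Sum>L\<in>Pow (A - {t}). f L + f (insert t L))"
proof -
  have "Pow A = Pow (A - {t}) \<union> insert t ` Pow (A - {t})"
    using Pow_insert[of t "A - {t}"] assms(2) by (simp add: insert_absorb)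
  moreover have "Pow (A - {t}) \<inter> insert t ` Pow (A - {t}) = {}" by auto
  moreover have "inj_on (insert t) (Pow (A - {t}))" by (rule inj_onI) (auto dest: insert_eq_iff[THEN iffD1, rotated 2])
  ultimately show ?thesis
    using assms(1) by (simp add: sum.union_disjoint sum.reindex sum.distrib)
qed

text \<open>
  The pencil has variables 0, 1 and \<open>j + 1\<close> for \<open>1 \<le> j \<le> k\<close>, read as \<open>y\<^sub>0 = 1\<close>, \<open>x\<close> and \<open>y\<^sub>j\<close>. A row vector in its left kernel
  consists of \<open>v\<^sub>i\<close> (rows \<open>Top i\<close>) and \<open>w\<^bsub>ji\<^esub>\<close> (rows \<open>Low j i\<close>): column \<open>Blk j i\<close> reads
  \<open>v\<^sub>i y\<^sub>j + w\<^bsub>ji\<^esub> (\<mu>\<^sub>i + x) = 0\<close> and column \<open>Hub j\<close> reads \<open>\<Sum>\<^sub>i (w\<^bsub>0i\<^esub> y\<^sub>j - w\<^bsub>ji\<^esub>) = 0\<close>, that is,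
  \<open>\<Sum>\<^sub>i v\<^sub>i [(\<mu>\<^sub>i + x)\<^sup>-\<^sup>1, y\<^sub>j] = 0\<close>. The padding rows and columns only bring the size up to \<open>n\<close>.
\<close>

datatype pencil_row = Top nat | Low nat nat | Row_Pad nat
datatype pencil_col = Blk nat nat | Hub nat | Col_Pad nat

definition pencil_rows :: "nat \<Rightarrow> nat \<Rightarrow> pencil_row set" where
  "pencil_rows k p = Top ` {..<k} \<union> (\<lambda>(j, i). Low j i) ` ({..k} \<times> {..<k}) \<union> Row_Pad ` {..<p}"

definition pencil_cols :: "nat \<Rightarrow> nat \<Rightarrow> pencil_col set" where
  "pencil_cols k p = (\<lambda>(j, i). Blk j i) ` ({..k} \<times> {..<k}) \<union> Hub ` {1..k} \<union> Col_Pad ` {..<p}"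

definition unit_form :: "nat \<Rightarrow> nat \<Rightarrow> 'a::zero_neq_one" where
  "unit_form u v = (if v = u then 1 else 0)"

definition yvar :: "nat \<Rightarrow> nat" where
  "yvar j = (if j = 0 then 0 else j + 1)"

definition binary_form :: "'a \<Rightarrow> 'a \<Rightarrow> nat \<Rightarrow> 'a::zero_neq_one" where
  "binary_form a b v = (if v = 0 then a else if v = 1 then b else 0)"

fun block_form :: "nat \<Rightarrow> nat set \<Rightarrow> pencil_col \<Rightarrow> nat \<Rightarrow> 'a::zero_neq_one" where
  "block_form i S (Blk j i') v = (if i' = i \<and> j \<in> S then unit_form (yvar j) v else 0)"
| "block_form i S (Hub j) v = 0"
| "block_form i S (Col_Pad q) v = 0"

text \<open>Let r be the inverse of the head. Eliminating \<open>block_form 0 S\<close> leaves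
  \<open>y\<^sub>j r\<close> (if j is in S) minus \<open>r y\<^sub>j\<close> (if 0 is in S) in
  column \<open>Hub j\<close>. Replacing r by r - a changes this by the entry given here, up to
  sign; for S = \<open>{..k}\<close> the two parts cancel.\<close>

fun hub_form :: "'a \<Rightarrow> nat set \<Rightarrow> pencil_col \<Rightarrow> nat \<Rightarrow> 'a::field" where
  "hub_form a S (Blk j i) v = 0"
| "hub_form a S (Hub j) v = a * (of_bool (j \<in> S) - of_bool (0 \<in> S)) * unit_form (yvar j) v"
| "hub_form a S (Col_Pad q) v = 0"

text \<open>Only what belongs to node 0 is left variable: \<open>H j\<close> is the entry at
  (\<open>Low j 0\<close>, \<open>Blk j 0\<close>), called a head below, and \<open>\<psi>\<close>
  is the whole row \<open>Top 0\<close>.\<close>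

fun pencil :: "(nat \<Rightarrow> 'a) \<Rightarrow> (nat \<Rightarrow> nat \<Rightarrow> 'a) \<Rightarrow> (pencil_col \<Rightarrow> nat \<Rightarrow> 'a) \<Rightarrow>
    pencil_row \<Rightarrow> pencil_col \<Rightarrow> nat \<Rightarrow> 'a::field" where
  "pencil \<mu> H \<psi> (Top i) c v = (if i = 0 then \<psi> c v else block_form i UNIV c v)"
| "pencil \<mu> H \<psi> (Low j i) (Blk j' i') v =
     (if j' = j \<and> i' = i then if i = 0 then H j v else binary_form (\<mu> i) 1 v else 0)"
| "pencil \<mu> H \<psi> (Low j i) (Hub j') v =
     (if j = 0 then unit_form (yvar j') v else if j' = j then - unit_form 0 v else 0)"
| "pencil \<mu> H \<psi> (Low j i) (Col_Pad q) v = 0"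
| "pencil \<mu> H \<psi> (Row_Pad q) (Col_Pad q') v = (if q' = q then unit_form 0 v else 0)"
| "pencil \<mu> H \<psi> (Row_Pad q) (Blk j i) v = 0"
| "pencil \<mu> H \<psi> (Row_Pad q) (Hub j) v = 0"

section \<open>Moving corrections through an alternating sum\<close>

lemma sum_block_form: "finite S \<Longrightarrow> (\<Sum>j\<in>S. block_form i {j} c v) = block_form i S c v"
  by (cases c) (auto simp: sum.delta cong: if_cong intro!: sum.neutral)

lemma sum_hub_form: "finite S \<Longrightarrow> (\<Sum>j\<in>S. hub_form a {j} c v) = hub_form a S c v"
  by (cases c) (auto simp: sum_subtractf sum_distrib_left[symmetric] sum_distrib_right[symmetric] of_bool_def)

text \<open>
  Each step of the telescope moves one \<open>\<zeta> t\<close>; it costs nothing because \<open>- \<zeta> t\<close> together with the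
  remaining \<open>\<xi> j\<close> makes up \<open>k + 1\<close> summands of one row, to which the alternating sum applies.
\<close>

lemma telescoping:
  fixes Q :: "nat \<Rightarrow> ('c \<Rightarrow> nat \<Rightarrow> 'a::field) \<Rightarrow> 'a"
    and \<xi> \<zeta> :: "nat \<Rightarrow> 'c \<Rightarrow> nat \<Rightarrow> 'a" and k :: nat
  defines "comb J M \<equiv> (\<lambda>c v. (\<Sum>j\<in>{..k} - J. \<xi> j c v) - (\<Sum>j\<in>M. \<zeta> j c v))"
  assumes alternating: "\<And>s b \<chi>. s \<le> k \<Longrightarrow> (\<Sum>L\<in>Pow {..k}. (-1) ^ card L *
      Q s (\<lambda>c v. b c v + (\<Sum>j\<in>{..k} - L. \<chi> j c v))) = 0"
    and consistent: "\<And>s s' J M. s \<in> J \<Longrightarrow> s' \<in> J \<Longrightarrow> J \<subseteq> {..k} \<Longrightarrow> M \<subseteq> {..k} \<Longrightarrow>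
      Q s (comb J M) = Q s' (comb J M)"
  shows "(\<Sum>J\<in>Pow {..k} - {{}}. (-1) ^ card J * Q (Min J) (comb J {..k})) =
         (\<Sum>J\<in>Pow {..k} - {{}}. (-1) ^ card J * Q (Min J) (comb J ({..k} - J)))"
proof -
  \<comment> \<open>Interpolates between the two sides: \<open>M 0 J\<close> is everything,
    \<open>M (Suc k) J\<close> is the complement of J, and passing from t to \<open>Suc t\<close>
    affects only the sets J that contain t.\<close>
  define M where "M t J = {..k} - (J \<inter> {..<t})" for t J
  have fin_M [simp]: "finite (M t J)" for t J by (simp add: M_def)
  define g where "g t J = (if J = {} then 0 else (-1) ^ card J * Q (Min J) (comb J (M t J)))" for t J
  have step: "sum (g t) (Pow {..k}) = sum (g (Suc t)) (Pow {..k})" if t: "t \<le> k" for t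
  proof -
    \<comment> \<open>For t in J the deleted \<open>\<xi> t\<close> leaves a free slot, which
      carries \<open>- \<zeta> t\<close>. For j < t, \<open>\<zeta> j\<close> occurs exactly when j
      is outside J, so it travels with \<open>\<xi> j\<close>; for j > t it always occurs and
      belongs to the constant part.\<close>
    define \<chi> where "\<chi> j = (\<lambda>c v. if j = t then - \<zeta> t c v else \<xi> j c v - (if j < t then \<zeta> j c v else 0))" for j
    define h where "h L = (-1) ^ card L *
      Q t (\<lambda>c v. - (\<Sum>j\<in>{t<..k}. \<zeta> j c v) + (\<Sum>j\<in>{..k} - L. \<chi> j c v))" for L
    have eq: "g t (insert t L) = - h L" "g (Suc t) (insert t L) = h (insert t L)" "g t L = g (Suc t) L"
      if L: "L \<in> Pow ({..k} - {t})" for L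
    proof -
      have fin: "finite L" using L finite_subset by auto
      \<comment> \<open>All sets \<open>insert t L\<close> share the element t. Moving the head from
        their minimum to t lets the single function \<open>Q t\<close> serve the whole alternating
        sum.\<close>
      have *: "g u (insert t L) = (-1) ^ card (insert t L) * Q t (comb (insert t L) (M u (insert t L)))" for u
      proof -
        have "Min (insert t L) \<in> insert t L" using fin by (intro Min_in) auto
        hence "Q (Min (insert t L)) (comb (insert t L) (M u (insert t L))) = Q t (comb (insert t L) (M u (insert t L)))"
          by (rule consistent) (use L t in \<open>auto simp: M_def\<close>)
        thus ?thesis by (simp add: g_def)
      qed
      have sumM: "(\<Sum>j\<in>{..k} - insert t L. \<chi> j c v) =
          (\<Sum>j\<in>{..k} - insert t L. \<xi> j c v) - (\<Sum>j\<in>{..<t} - L. \<zeta> j c v)" for c v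
      proof -
        have "(\<Sum>j\<in>{..k} - insert t L. \<chi> j c v) =
          (\<Sum>j\<in>{..k} - insert t L. \<xi> j c v - (if j < t then \<zeta> j c v else 0))"
          by (intro sum.cong) (auto simp: \<chi>_def)
        also have "\<dots> = (\<Sum>j\<in>{..k} - insert t L. \<xi> j c v) - (\<Sum>j\<in>{..<t} - L. \<zeta> j c v)"
        proof -
          have "(\<Sum>j\<in>{..k} - insert t L. if j < t then \<zeta> j c v else 0) = (\<Sum>j\<in>{..<t} - L. \<zeta> j c v)"
            by (rule sum.mono_neutral_cong_right) (use t in auto)
          thus ?thesis by (simp add: sum_subtractf)
        qed
        finally show ?thesis .
      qed
      have MS: "(\<Sum>j\<in>M (Suc t) (insert t L). \<zeta> j c v) =
          (\<Sum>j\<in>{..<t} - L. \<zeta> j c v) + (\<Sum>j\<in>{t<..k}. \<zeta> j c v)" for c v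
      proof -
        have "M (Suc t) (insert t L) = ({..<t} - L) \<union> {t<..k}"
          using t L by (auto simp: M_def)
        moreover have "({..<t} - L) \<inter> {t<..k} = {}" by auto
        ultimately show ?thesis by (simp add: sum.union_disjoint)
      qed
      have "M t (insert t L) = insert t (M (Suc t) (insert t L))" "t \<notin> M (Suc t) (insert t L)"
        using t L by (auto simp: M_def)
      hence Mt: "(\<Sum>j\<in>M t (insert t L). \<zeta> j c v) = \<zeta> t c v + (\<Sum>j\<in>M (Suc t) (insert t L). \<zeta> j c v)" for c v
        by simp
      have sumL: "(\<Sum>j\<in>{..k} - L. \<chi> j c v) = - \<zeta> t c v + (\<Sum>j\<in>{..k} - insert t L. \<chi> j c v)" for c v
        using sum.remove[of "{..k} - L" t "\<lambda>j. \<chi> j c v"] t L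
        by (auto simp: Diff_insert[symmetric] \<chi>_def)
      have "comb (insert t L) (M t (insert t L)) =
          (\<lambda>c v. - (\<Sum>j\<in>{t<..k}. \<zeta> j c v) + (\<Sum>j\<in>{..k} - L. \<chi> j c v))"
        unfolding comb_def Mt MS sumL sumM by (simp add: algebra_simps)
      moreover have "t \<notin> L" using L by auto
      ultimately show "g t (insert t L) = - h L" using fin by (subst *) (simp add: h_def)
      have "comb (insert t L) (M (Suc t) (insert t L)) =
          (\<lambda>c v. - (\<Sum>j\<in>{t<..k}. \<zeta> j c v) + (\<Sum>j\<in>{..k} - insert t L. \<chi> j c v))"
        unfolding comb_def MS sumM by (simp add: algebra_simps)
      thus "g (Suc t) (insert t L) = h (insert t L)" by (subst *) (simp add: h_def)
      have "M t L = M (Suc t) L" using L by (auto simp: M_def less_Suc_eq)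
      thus "g t L = g (Suc t) L" by (simp add: g_def)
    qed
    have "sum h (Pow {..k}) = 0" unfolding h_def using t by (rule alternating)
    hence "(\<Sum>L\<in>Pow ({..k} - {t}). h L + h (insert t L)) = 0"
      using t by (subst (asm) sum_Pow_split[where t = t]) auto
    moreover have "(\<Sum>L\<in>Pow ({..k} - {t}). g (Suc t) L + g (Suc t) (insert t L)) -
        (\<Sum>L\<in>Pow ({..k} - {t}). g t L + g t (insert t L)) = (\<Sum>L\<in>Pow ({..k} - {t}). h L + h (insert t L))"
      unfolding sum_subtractf[symmetric] using eq by (intro sum.cong refl) simp
    ultimately show ?thesis using t by (simp add: sum_Pow_split[where t = t])
  qed
  have "sum (g 0) (Pow {..k}) = sum (g t) (Pow {..k})" if "t \<le> Suc k" for t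
    using that
  proof (induction t)
    case (Suc t)
    thus ?case using step[of t] by simp
  qed simp
  hence "sum (g 0) (Pow {..k}) = sum (g (Suc k)) (Pow {..k})" by simp
  moreover have "sum (g t) (Pow {..k}) = (\<Sum>J\<in>Pow {..k} - {{}}. (-1) ^ card J * Q (Min J) (comb J (M t J)))" for t
    unfolding g_def by (intro sum.mono_neutral_cong_right) auto
  moreover have "(\<Sum>J\<in>Pow {..k} - {{}}. (-1) ^ card J * Q (Min J) (comb J (M (Suc k) J))) =
      (\<Sum>J\<in>Pow {..k} - {{}}. (-1) ^ card J * Q (Min J) (comb J ({..k} - J)))"
    by (intro sum.cong refl arg_cong2[where f = "(*)"] arg_cong2[where f = comb] arg_cong2[where f = Q])
       (auto simp: M_def)
  moreover have "M 0 J = {..k}" for J by (simp add: M_def)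
  ultimately show ?thesis by simp
qed

section \<open>Semi-invariants of weight between 1 and \<open>k\<close> on the pencil\<close>

locale pencil_invariant = semi_invariant F "pencil_rows k p" "pencil_cols k p" m e
  for F :: "(pencil_row \<Rightarrow> pencil_col \<Rightarrow> nat \<Rightarrow> 'a::field) \<Rightarrow> 'a" and k p m e :: nat +
  fixes \<mu> :: "nat \<Rightarrow> 'a"
  assumes e_pos: "1 \<le> e" and e_le: "e \<le> k" and inj_\<mu>: "inj_on \<mu> {..<k}"
begin

lemma k_pos: "0 < k" using e_pos e_le by simp

text \<open>
  \<open>heads s t\<close> keeps \<open>\<mu>\<^sub>0 + x\<close> in column \<open>Blk s 0\<close> and puts \<open>t + x\<close> in the other columns \<open>Blk j 0\<close>.
\<close>

definition heads :: "nat \<Rightarrow> 'a \<Rightarrow> nat \<Rightarrow> nat \<Rightarrow> 'a" where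
  "heads s t j = binary_form (if j = s then \<mu> 0 else t) 1"

lemma poly_fun_pencil:
  assumes "\<And>j v. poly_fun (\<lambda>t. H t j v)" "\<And>c v. poly_fun (\<lambda>t. \<psi> t c v)"
  shows "poly_fun (\<lambda>t. pencil \<mu> (H t) (\<psi> t) r c v)"
proof (cases r)
  case (Top i)
  thus ?thesis by (auto intro!: poly_fun_if assms poly_fun_const)
next
  case (Low j i)
  thus ?thesis by (cases c) (auto intro!: poly_fun_if assms poly_fun_const)
next
  case (Row_Pad q)
  thus ?thesis by (cases c) (auto intro!: poly_fun_const)
qed

lemma poly_fun_heads: "poly_fun (\<lambda>t. heads s t j v)"
  unfolding heads_def binary_form_def by (intro poly_fun_intros)

text \<open>Both columns miss row \<open>Top 0\<close>, so their heads are isolated entries and can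
  be exchanged. Hence \<open>Min J\<close> below is merely a convenient choice of an element of
  J.\<close>

lemma head_index_irrelevant:
  assumes "s \<le> k" "s' \<le> k" "\<And>v. \<psi> (Blk s 0) v = 0" "\<And>v. \<psi> (Blk s' 0) v = 0"
  shows "F (pencil \<mu> (heads s t) \<psi>) = F (pencil \<mu> (heads s' t) \<psi>)"
proof (cases "s = s'")
  case False
  note rows = pencil_rows_def and cols = pencil_cols_def
  have mem: "Low s 0 \<in> pencil_rows k p" "Low s' 0 \<in> pencil_rows k p"
            "Blk s 0 \<in> pencil_cols k p" "Blk s' 0 \<in> pencil_cols k p"
    using assms(1,2) k_pos by (auto simp: rows cols image_iff)
  let ?\<Phi> = "pencil \<mu> (heads s t) \<psi>"
  have col: "pencil \<mu> (heads s t) \<psi> r (Blk j 0) v = 0"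
    if "r \<noteq> Low j 0" "j = s \<or> j = s'" for r j v
    using that assms(3,4) by (cases r) auto
  have "F (\<lambda>r c v. if r = Low s 0 \<and> c = Blk s 0 then ?\<Phi> (Low s' 0) (Blk s' 0) v
      else if r = Low s' 0 \<and> c = Blk s' 0 then ?\<Phi> (Low s 0) (Blk s 0) v else ?\<Phi> r c v) = F ?\<Phi>"
    by (rule swap_isolated_entries) (use mem False col in auto)
  also have "(\<lambda>r c v. if r = Low s 0 \<and> c = Blk s 0 then ?\<Phi> (Low s' 0) (Blk s' 0) v
      else if r = Low s' 0 \<and> c = Blk s' 0 then ?\<Phi> (Low s 0) (Blk s 0) v else ?\<Phi> r c v)
      = pencil \<mu> (heads s' t) \<psi>"
  proof (intro ext)
    fix r c v
    show "(if r = Low s 0 \<and> c = Blk s 0 then ?\<Phi> (Low s' 0) (Blk s' 0) v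
      else if r = Low s' 0 \<and> c = Blk s' 0 then ?\<Phi> (Low s 0) (Blk s 0) v else ?\<Phi> r c v)
      = pencil \<mu> (heads s' t) \<psi> r c v"
      using False by (cases r; cases c) (auto simp: heads_def)
  qed
  finally show ?thesis by simp
qed simp

text \<open>
  Subtracting row \<open>Top i\<close> from row \<open>Top 0\<close> replaces \<open>(t + x)\<^sup>-\<^sup>1\<close> in the Schur complement by \<open>(t + x)\<^sup>-\<^sup>1 - (\<mu>\<^sub>i + x)\<^sup>-\<^sup>1 =
  (\<mu>\<^sub>i - t) (t + x)\<^sup>-\<^sup>1 (\<mu>\<^sub>i + x)\<^sup>-\<^sup>1\<close>; row and column operations extract the factor \<open>t - \<mu>\<^sub>i\<close>.
\<close>

lemma pencil_at_node:
  assumes i: "1 \<le> i" "i < k" and J: "s \<in> J" "J \<subseteq> {..k}"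
  defines "S \<equiv> {..k} - J"
  shows "\<exists>g. poly_fun g \<and> (\<forall>t. t \<noteq> \<mu> i \<longrightarrow>
    F (pencil \<mu> (heads s t) (\<lambda>c v. block_form 0 S c v - block_form i S c v)) = (t - \<mu> i) ^ e * g t)"
proof -
  define \<Phi> where "\<Phi> t = pencil \<mu> (heads s t) (\<lambda>c v. block_form 0 S c v - block_form i S c v)" for t
  define P where "P = (\<lambda>j. Low j 0) ` S"
  \<comment> \<open>Rows \<open>Low j 0\<close> and \<open>Low j i\<close> agree in all
    \<open>Hub\<close> columns; their difference keeps only \<open>t + x\<close> and
    \<open>- (\<mu> i + x)\<close>.\<close>
  define \<Phi>1 where "\<Phi>1 t = (\<lambda>r c v. \<Phi> t r c v +
    (if r \<in> P then (-1) * \<Phi> t (case r of Low j _ \<Rightarrow> Low j i) c v else 0))" for t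
  define Q where "Q = (\<lambda>j. Blk j i) ` S"
  \<comment> \<open>Adding column \<open>Blk j 0\<close> to \<open>Blk j i\<close> cancels the entry
    in \<open>Top 0\<close> and turns \<open>- (\<mu> i + x)\<close> into the constant
    \<open>t - \<mu> i\<close>.\<close>
  define \<Phi>2 where "\<Phi>2 t = (\<lambda>r c v. \<Phi>1 t r c v +
    (if c \<in> Q then 1 * \<Phi>1 t r (case c of Blk j _ \<Rightarrow> Blk j 0) v else 0))" for t
  define B where "B t r c v = (if r \<in> P then
      (case (r, c) of (Low j _, Blk j' i') \<Rightarrow>
         if j' = j \<and> i' = 0 then binary_form t 1 v else if j' = j \<and> i' = i then unit_form 0 v else 0
       | _ \<Rightarrow> 0)
    else pencil \<mu> (heads s t) (block_form 0 S) r c v)" for t r c v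
  have SJ: "s \<notin> S" "S \<subseteq> {..k}" and finS: "finite S" using J by (auto simp: S_def)
  have P: "P \<subseteq> pencil_rows k p" "card P = card S" "Top 0 \<notin> P"
    using SJ k_pos by (auto simp: P_def pencil_rows_def image_iff card_image inj_on_def)
  have P': "insert (Top 0) P \<subseteq> pencil_rows k p" "card (insert (Top 0) P) = Suc (card S)"
    using P k_pos finS by (auto simp: pencil_rows_def P_def)
  have Q0: "(\<lambda>j. Blk j 0) ` S \<subseteq> pencil_cols k p" "card ((\<lambda>j. Blk j 0) ` S) = card S"
    using SJ k_pos by (auto simp: pencil_cols_def image_iff card_image inj_on_def)
  have eq1: "F (\<Phi>1 t) = F (\<Phi> t)" for t
    unfolding \<Phi>1_def using i SJ by (intro add_rows P(1)) (auto simp: P_def pencil_rows_def image_iff)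
  have eq2: "F (\<Phi>2 t) = F (\<Phi>1 t)" for t
    unfolding \<Phi>2_def using i SJ by (intro add_cols) (auto simp: Q_def pencil_cols_def image_iff)
  \<comment> \<open>Scaling \<open>card S\<close> columns by \<open>t - \<mu> i\<close> makes
    \<open>card S + 1\<close> rows divisible by it, namely the rows \<open>Low j 0\<close> and
    \<open>Top 0\<close>. The surplus row is the source of the factor
    \<open>(t - \<mu> i) ^ e\<close>.\<close>
  have "(\<lambda>r c v. (if c \<in> (\<lambda>j. Blk j 0) ` S then t - \<mu> i else 1) * \<Phi>2 t r c v) =
    (\<lambda>r c v. (if r \<in> insert (Top 0) P then t - \<mu> i else 1) * B t r c v)" for t
  proof (intro ext)
    fix r c v
    show "(if c \<in> (\<lambda>j. Blk j 0) ` S then t - \<mu> i else 1) * \<Phi>2 t r c v =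
      (if r \<in> insert (Top 0) P then t - \<mu> i else 1) * B t r c v"
      using i SJ
      by (cases r; cases c)
         (auto simp: \<Phi>2_def \<Phi>1_def \<Phi>_def B_def P_def Q_def heads_def binary_form_def unit_form_def image_iff)
  qed
  hence scaled: "(t - \<mu> i) ^ (card S * e) * F (\<Phi>2 t) = (t - \<mu> i) ^ (Suc (card S) * e) * F (B t)" for t
    using scale_cols[OF Q0(1), of "t - \<mu> i" "\<Phi>2 t"] scale_rows[OF P'(1), of "t - \<mu> i" "B t"]
    by (simp only: P'(2) Q0(2))
  have "F (\<Phi> t) = (t - \<mu> i) ^ e * F (B t)" if "t \<noteq> \<mu> i" for t
    using scaled[of t] eq1[of t] eq2[of t] that by (simp add: power_add)
  moreover have "poly_fun (\<lambda>t. F (B t))"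
  proof (rule poly_fun_F)
    fix r c v
    show "poly_fun (\<lambda>t. B t r c v)"
      unfolding B_def
      by (intro poly_fun_if poly_fun_pencil poly_fun_heads poly_fun_const; cases r; cases c)
         (auto intro!: poly_fun_if poly_fun_const poly_fun_id simp: binary_form_def)
  qed
  ultimately show ?thesis unfolding \<Phi>_def by blast
qed


text \<open>
  With \<open>u = 1/t\<close> the row \<open>Top 0\<close> involves \<open>(t + x)\<^sup>-\<^sup>1 - u\<close>, which is of order \<open>u\<^sup>2\<close>; subtracting the scalar \<open>u\<close>
  is free since it commutes with every \<open>y\<^sub>j\<close>.
\<close>

lemma pencil_at_infinity:
  assumes J: "s \<in> J" "J \<subseteq> {..k}"
  defines "S \<equiv> {..k} - J"
  shows "\<exists>g. poly_fun g \<and> (\<forall>t. t \<noteq> 0 \<longrightarrow>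
    t ^ (2 * e) * F (pencil \<mu> (heads s t) (\<lambda>c v. block_form 0 S c v - hub_form (inverse t) S c v)) =
    t ^ (k * e) * g (inverse t))"
proof -
  define \<Phi> where "\<Phi> u = pencil \<mu> (heads s (inverse u)) (\<lambda>c v. block_form 0 S c v - hub_form u S c v)" for u
  \<comment> \<open>For j other than s the head times u is
    \<open>u * (inverse u + x) = 1 + u x\<close>. These k column scalings, with the column of s left
    out, produce the exponent \<open>k * e\<close>.\<close>
  define H where "H u j = (if j = s then binary_form (\<mu> 0) 1 else binary_form 1 u)" for u j
  define A where "A u = pencil \<mu> (H u) (\<lambda>c v. block_form 0 S c v - hub_form 1 S c v)" for u
  \<comment> \<open>If 0 is in S, row \<open>Low 0 0\<close> cancels the constant in column
    \<open>Blk 0 0\<close>, leaving \<open>- u x\<close>, and cancels the \<open>0 \<in> S\<close>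
    part of \<open>hub_form\<close>.\<close>
  define A1 where "A1 u = (\<lambda>r c v. A u r c v +
    (if r = Top 0 then (- of_bool (0 \<in> S)) * A u (Low 0 0) c v else 0))" for u
  define S' where "S' = S - {0}"
  \<comment> \<open>Adding column \<open>Blk j 0\<close> to \<open>Hub j\<close> clears row
    \<open>Top 0\<close> there and turns the entry -1 of row \<open>Low j 0\<close> into
    \<open>- 1 + (1 + u x) = u x\<close>.\<close>
  define A2 where "A2 u = (\<lambda>r c v. A1 u r c v +
    (if c \<in> Hub ` S' then 1 * A1 u r (case c of Hub j \<Rightarrow> Blk j 0) v else 0))" for u
  define P where "P = (\<lambda>j. Low j 0) ` S'"
  define B where "B u r c v = (if r \<in> P then
      (case (r, c) of (Low j _, Blk j' i') \<Rightarrow> if j' = j \<and> i' = 0 then binary_form 1 u v else 0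
       | (Low j _, Hub j') \<Rightarrow> if j' = j then unit_form 1 v else 0
       | _ \<Rightarrow> 0)
    else if r = Top 0 then (if c = Blk 0 0 then - of_bool (0 \<in> S) * unit_form 1 v else block_form 0 S' c v)
    else pencil \<mu> (H u) (block_form 0 S) r c v)" for u r c v
  have SJ: "s \<notin> S" "S \<subseteq> {..k}" "s \<le> k" and finS: "finite S" "finite S'"
    using J by (auto simp: S_def S'_def)
  have P': "insert (Top 0) P \<subseteq> pencil_rows k p" "card (insert (Top 0) P) = Suc (card S')"
  proof -
    have "card P = card S'" "Top 0 \<notin> P" "finite P"
      using finS by (auto simp: P_def card_image inj_on_def)
    thus "card (insert (Top 0) P) = Suc (card S')" by simp
    show "insert (Top 0) P \<subseteq> pencil_rows k p"
      using SJ k_pos by (auto simp: P_def S'_def pencil_rows_def image_iff)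
  qed
  have Q: "(\<lambda>j. Blk j 0) ` ({..k} - {s}) \<subseteq> pencil_cols k p"
    "card ((\<lambda>j. Blk j 0) ` ({..k} - {s})) = k"
    using SJ k_pos by (auto simp: pencil_cols_def image_iff card_image inj_on_def)
  have Q': "(\<lambda>j. Blk j 0) ` S' \<subseteq> pencil_cols k p" "card ((\<lambda>j. Blk j 0) ` S') = card S'"
    using SJ k_pos by (auto simp: pencil_cols_def S'_def image_iff card_image inj_on_def)
  have "(\<lambda>r c v. (if c \<in> (\<lambda>j. Blk j 0) ` ({..k} - {s}) then u else 1) * \<Phi> u r c v) r c v =
    (\<lambda>r c v. (if r = Top 0 then u else 1) * A u r c v) r c v"
    if "u \<noteq> 0" "r \<in> pencil_rows k p" "c \<in> pencil_cols k p" for u r c v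
    using SJ that by (cases r; cases c)
      (auto simp: \<Phi>_def A_def H_def heads_def binary_form_def unit_form_def image_iff pencil_rows_def pencil_cols_def)
  hence "F (\<lambda>r c v. (if c \<in> (\<lambda>j. Blk j 0) ` ({..k} - {s}) then u else 1) * \<Phi> u r c v) =
    F (\<lambda>r c v. (if r = Top 0 then u else 1) * A u r c v)" if "u \<noteq> 0" for u
    using that by (intro F_cong) auto
  hence eq1: "u ^ (k * e) * F (\<Phi> u) = u ^ e * F (A u)" if "u \<noteq> 0" for u
    using that scale_cols[OF Q(1), of u "\<Phi> u"] scale_row[of "Top 0" u "A u"] P'(1) by (simp only: Q(2)) auto
  have eq2: "F (A1 u) = F (A u)" for u
    unfolding A1_def using k_pos by (intro add_row) (auto simp: pencil_rows_def image_iff)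
  have eq3: "F (A2 u) = F (A1 u)" for u
    unfolding A2_def using SJ k_pos by (intro add_cols) (auto simp: pencil_cols_def S'_def image_iff)
  \<comment> \<open>Scaling \<open>card S'\<close> columns by u again makes one more row divisible
    by u. Together with the factor u already taken from row \<open>Top 0\<close> in
    \<open>eq1\<close>, this accounts for order 2 in u.\<close>
  have "(\<lambda>r c v. (if c \<in> (\<lambda>j. Blk j 0) ` S' then u else 1) * A2 u r c v) r c v =
    (\<lambda>r c v. (if r \<in> insert (Top 0) P then u else 1) * B u r c v) r c v"
    if "r \<in> pencil_rows k p" "c \<in> pencil_cols k p" for u r c v
    using SJ that by (cases r; cases c)
      (auto simp: A2_def A1_def A_def B_def H_def P_def S'_def yvar_def binary_form_def unit_form_def image_iff
         pencil_rows_def pencil_cols_def)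
  hence "F (\<lambda>r c v. (if c \<in> (\<lambda>j. Blk j 0) ` S' then u else 1) * A2 u r c v) =
    F (\<lambda>r c v. (if r \<in> insert (Top 0) P then u else 1) * B u r c v)" for u
    by (intro F_cong) auto
  hence eq4: "u ^ (card S' * e) * F (A2 u) = u ^ (Suc (card S') * e) * F (B u)" for u
    using scale_cols[OF Q'(1), of u "A2 u"] scale_rows[OF P'(1), of u "B u"]
    by (simp only: P'(2) Q'(2))
  have "u ^ (k * e) * F (\<Phi> u) = u ^ (2 * e) * F (B u)" if "u \<noteq> 0" for u
    using eq1[OF that] eq2[of u] eq3[of u] eq4[of u] that by (simp add: power_add mult_2)
  hence eq5: "inverse t ^ (k * e) * F (\<Phi> (inverse t)) = inverse t ^ (2 * e) * F (B (inverse t))"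
    if "t \<noteq> 0" for t using that by simp
  have "t ^ (2 * e) * F (\<Phi> (inverse t)) = t ^ (k * e) * F (B (inverse t))" if t: "t \<noteq> 0" for t
  proof -
    have cancel: "t ^ N * inverse t ^ N = 1" for N using t by (simp flip: power_mult_distrib)
    have "t ^ (2 * e) * F (\<Phi> (inverse t)) =
        t ^ (2 * e) * (t ^ (k * e) * inverse t ^ (k * e)) * F (\<Phi> (inverse t))"
      by (simp only: cancel mult_1_right)
    also have "\<dots> = t ^ (2 * e) * t ^ (k * e) * (inverse t ^ (k * e) * F (\<Phi> (inverse t)))"
      by (simp only: mult.assoc)
    also have "\<dots> = t ^ (k * e) * ((t ^ (2 * e) * inverse t ^ (2 * e)) * F (B (inverse t)))"
      unfolding eq5[OF t] by (simp only: mult_ac)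
    finally show ?thesis by (simp only: cancel mult_1_left)
  qed
  moreover have "poly_fun (\<lambda>t. F (B t))"
  proof (rule poly_fun_F)
    fix r c v
    have "poly_fun (\<lambda>t. H t j v)" for j v
      by (cases "j = s") (auto simp: H_def binary_form_def intro!: poly_fun_if poly_fun_const poly_fun_id)
    thus "poly_fun (\<lambda>t. B t r c v)"
      unfolding B_def
      by (intro poly_fun_if poly_fun_pencil poly_fun_const; cases r; cases c)
         (auto intro!: poly_fun_if poly_fun_const poly_fun_id simp: binary_form_def)
  qed
  ultimately show ?thesis unfolding \<Phi>_def by (intro exI[of _ "\<lambda>t. F (B t)"]) simp
qed


text \<open>The k + 1 summands outnumber the degree e \<le> k of F in row
  \<open>Top 0\<close>.\<close>

lemma alternating_top:
  "(\<Sum>L\<in>Pow {..k}. (-1) ^ card L *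
      F (pencil \<mu> H (\<lambda>c v. b c v + (\<Sum>j\<in>{..k} - L. \<chi> j c v)))) = 0"
proof -
  have *: "pencil \<mu> H \<psi> = (pencil \<mu> H (\<lambda>_ _. 0))(Top 0 := \<psi>)" for \<psi>
  proof (intro ext)
    fix r c v
    show "pencil \<mu> H \<psi> r c v = ((pencil \<mu> H (\<lambda>_ _. 0))(Top 0 := \<psi>)) r c v"
      by (cases r; cases c) auto
  qed
  show ?thesis
    by (subst *, rule alternating_row) (use k_pos e_le in \<open>auto simp: pencil_rows_def\<close>)
qed

section \<open>Corrections of row \<open>Top 0\<close> and the vanishing of the pencil\<close>

lemma pencil_add_multiple_of_top:
  assumes "1 \<le> i" "i < k"
  shows "F (pencil \<mu> H (\<lambda>c v. \<psi> c v - block_form i {..k} c v)) = F (pencil \<mu> H \<psi>)"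
proof -
  have "F (pencil \<mu> H (\<lambda>c v. \<psi> c v - block_form i {..k} c v)) =
    F (\<lambda>r c v. pencil \<mu> H \<psi> r c v + (if r = Top 0 then (-1) * pencil \<mu> H \<psi> (Top i) c v else 0))"
  proof (rule F_cong)
    fix r c v assume "c \<in> pencil_cols k p"
    thus "pencil \<mu> H (\<lambda>c v. \<psi> c v - block_form i {..k} c v) r c v =
      pencil \<mu> H \<psi> r c v + (if r = Top 0 then (-1) * pencil \<mu> H \<psi> (Top i) c v else 0)"
      using assms by (cases r; cases c) (auto simp: pencil_cols_def)
  qed
  also have "\<dots> = F (pencil \<mu> H \<psi>)"
    using assms by (intro add_row) (auto simp: pencil_rows_def)
  finally show ?thesis .
qed

lemma pencil_add_hub:
  "F (pencil \<mu> H (\<lambda>c v. \<psi> c v - hub_form a {..k} c v)) = F (pencil \<mu> H \<psi>)"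
proof (rule F_cong)
  fix r c v assume "c \<in> pencil_cols k p"
  thus "pencil \<mu> H (\<lambda>c v. \<psi> c v - hub_form a {..k} c v) r c v = pencil \<mu> H \<psi> r c v"
    by (cases r; cases c) (auto simp: pencil_cols_def)
qed

text \<open>Confines a correction to the undeleted indices: over all of \<open>{..k}\<close> it is
  free by the last hypothesis, and telescoping removes the part that belongs to J. A correction
  vanishing on the columns \<open>Blk j' 0\<close> keeps the deleted columns isolated.\<close>

lemma telescoping_pencil:
  assumes "\<And>j j' v. \<zeta> j (Blk j' 0) v = 0"
    and \<zeta>: "\<And>M c v. finite M \<Longrightarrow> (\<Sum>j\<in>M. \<zeta> j c v) = \<eta> M c v"
    and \<eta>: "\<And>H \<psi>. F (pencil \<mu> H (\<lambda>c v. \<psi> c v - \<eta> {..k} c v)) = F (pencil \<mu> H \<psi>)"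
  shows "(\<Sum>J\<in>Pow {..k} - {{}}. (-1) ^ card J * F (pencil \<mu> (heads (Min J) t) (block_form 0 ({..k} - J)))) =
    (\<Sum>J\<in>Pow {..k} - {{}}. (-1) ^ card J *
      F (pencil \<mu> (heads (Min J) t) (\<lambda>c v. block_form 0 ({..k} - J) c v - \<eta> ({..k} - J) c v)))"
proof -
  define Q where "Q s \<psi> = F (pencil \<mu> (heads s t) \<psi>)" for s \<psi>
  have "(\<Sum>J\<in>Pow {..k} - {{}}. (-1) ^ card J *
      Q (Min J) (\<lambda>c v. (\<Sum>j\<in>{..k} - J. block_form 0 {j} c v) - (\<Sum>j\<in>{..k}. \<zeta> j c v))) =
    (\<Sum>J\<in>Pow {..k} - {{}}. (-1) ^ card J *
      Q (Min J) (\<lambda>c v. (\<Sum>j\<in>{..k} - J. block_form 0 {j} c v) - (\<Sum>j\<in>{..k} - J. \<zeta> j c v)))"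
  proof (rule telescoping)
    fix s s' and J M :: "nat set"
    assume J: "s \<in> J" "s' \<in> J" "J \<subseteq> {..k}" "M \<subseteq> {..k}"
    show "Q s (\<lambda>c v. (\<Sum>j\<in>{..k} - J. block_form 0 {j} c v) - (\<Sum>j\<in>M. \<zeta> j c v)) =
      Q s' (\<lambda>c v. (\<Sum>j\<in>{..k} - J. block_form 0 {j} c v) - (\<Sum>j\<in>M. \<zeta> j c v))"
      unfolding Q_def by (rule head_index_irrelevant) (use J assms(1) in \<open>auto simp: sum_block_form\<close>)
  qed (unfold Q_def, rule alternating_top)
  thus ?thesis unfolding Q_def by (simp add: sum_block_form \<zeta> \<eta>)
qed

text \<open>The sum is treated as a whole because the correction that exhibits a root, or the growth
  at infinity, is justified only under the alternating summation. A different correction is used for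
  each node.\<close>

lemma decoupled_sum_eq_0:
  "(\<Sum>J\<in>Pow {..k} - {{}}. (-1) ^ card J *
      F (pencil \<mu> (heads (Min J) t) (block_form 0 ({..k} - J)))) = 0" (is "?p t = 0")
proof -
  let ?Js = "Pow {..k} - {{}} :: nat set set"
  have Min: "Min J \<in> J" "J \<subseteq> {..k}" if "J \<in> ?Js" for J
    using that finite_subset[of J "{..k}"] by auto
  have "poly_fun ?p"
    by (intro poly_fun_intros poly_fun_F poly_fun_pencil poly_fun_heads)
  then obtain q where q: "\<And>t. ?p t = poly q t" unfolding poly_fun_def by blast
  have dvd: "[:- \<mu> i, 1:] ^ e dvd q" if i: "i \<in> {1..<k}" for i
  proof -
    have "\<forall>J\<in>?Js. \<exists>g. poly_fun g \<and> (\<forall>t. t \<noteq> \<mu> i \<longrightarrow>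
        F (pencil \<mu> (heads (Min J) t) (\<lambda>c v. block_form 0 ({..k} - J) c v - block_form i ({..k} - J) c v)) =
        (t - \<mu> i) ^ e * g t)"
      using i Min by (intro ballI pencil_at_node) auto
    then obtain g where g: "\<And>J. J \<in> ?Js \<Longrightarrow> poly_fun (g J)"
      "\<And>J t. J \<in> ?Js \<Longrightarrow> t \<noteq> \<mu> i \<Longrightarrow>
        F (pencil \<mu> (heads (Min J) t) (\<lambda>c v. block_form 0 ({..k} - J) c v - block_form i ({..k} - J) c v)) =
        (t - \<mu> i) ^ e * g J t"
      by (auto dest!: bchoice)
    have "poly_fun (\<lambda>t. \<Sum>J\<in>?Js. (-1) ^ card J * g J t)"
      by (intro poly_fun_sum poly_fun_mult poly_fun_const g)
    then obtain G where G: "\<And>t. (\<Sum>J\<in>?Js. (-1) ^ card J * g J t) = poly G t"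
      unfolding poly_fun_def by blast
    have "q = [:- \<mu> i, 1:] ^ e * G"
    proof (rule poly_eqI_infinite[OF infinite_field, of "{\<mu> i}"])
      fix t assume t: "t \<notin> {\<mu> i}"
      have "poly q t = (\<Sum>J\<in>?Js. (-1) ^ card J *
        F (pencil \<mu> (heads (Min J) t) (\<lambda>c v. block_form 0 ({..k} - J) c v - block_form i ({..k} - J) c v)))"
        unfolding q[symmetric] using i
        by (intro telescoping_pencil[where \<zeta> = "\<lambda>j. block_form i {j}" and \<eta> = "block_form i"])
           (simp_all add: sum_block_form pencil_add_multiple_of_top)
      also have "\<dots> = (\<Sum>J\<in>?Js. (t - \<mu> i) ^ e * ((-1) ^ card J * g J t))"
        using t g by (intro sum.cong) auto
      also have "\<dots> = poly ([:- \<mu> i, 1:] ^ e * G) t"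
        by (simp add: G[symmetric] poly_power sum_distrib_left)
      finally show "poly q t = poly ([:- \<mu> i, 1:] ^ e * G) t" .
    qed simp
    thus ?thesis by simp
  qed
  \<comment> \<open>The factor \<open>t ^ (2 * e)\<close> replaces the bound (k - 2) e, which would
    be negative for k = 1.\<close>
  have deg: "degree (monom 1 (2 * e) * q) \<le> k * e"
  proof -
    have "\<forall>J\<in>?Js. \<exists>g. poly_fun g \<and> (\<forall>t. t \<noteq> 0 \<longrightarrow>
        t ^ (2 * e) * F (pencil \<mu> (heads (Min J) t)
          (\<lambda>c v. block_form 0 ({..k} - J) c v - hub_form (inverse t) ({..k} - J) c v)) =
        t ^ (k * e) * g (inverse t))"
      using Min by (intro ballI pencil_at_infinity) auto
    then obtain g where g: "\<And>J. J \<in> ?Js \<Longrightarrow> poly_fun (g J)"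
      "\<And>J t. J \<in> ?Js \<Longrightarrow> t \<noteq> 0 \<Longrightarrow>
        t ^ (2 * e) * F (pencil \<mu> (heads (Min J) t)
          (\<lambda>c v. block_form 0 ({..k} - J) c v - hub_form (inverse t) ({..k} - J) c v)) =
        t ^ (k * e) * g J (inverse t)"
      by (auto dest!: bchoice)
    have "poly_fun (\<lambda>t. \<Sum>J\<in>?Js. (-1) ^ card J * g J t)"
      by (intro poly_fun_sum poly_fun_mult poly_fun_const g)
    then obtain G where G: "\<And>t. (\<Sum>J\<in>?Js. (-1) ^ card J * g J t) = poly G t"
      unfolding poly_fun_def by blast
    show ?thesis
    proof (rule degree_le_of_inverse_growth[OF infinite_field])
      fix t :: 'a assume t: "t \<noteq> 0"
      have "poly (monom 1 (2 * e) * q) t = t ^ (2 * e) * (\<Sum>J\<in>?Js. (-1) ^ card J *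
        F (pencil \<mu> (heads (Min J) t)
          (\<lambda>c v. block_form 0 ({..k} - J) c v - hub_form (inverse t) ({..k} - J) c v)))"
        unfolding poly_mult q[symmetric] poly_monom mult_1_left
        by (rule arg_cong[OF telescoping_pencil[where \<zeta> = "\<lambda>j. hub_form (inverse t) {j}" and \<eta> = "hub_form (inverse t)"]])
           (simp_all add: sum_hub_form pencil_add_hub)
      also have "\<dots> = (\<Sum>J\<in>?Js. (-1) ^ card J * (t ^ (2 * e) * F (pencil \<mu> (heads (Min J) t)
          (\<lambda>c v. block_form 0 ({..k} - J) c v - hub_form (inverse t) ({..k} - J) c v))))"
        by (simp add: sum_distrib_left mult.left_commute)
      also have "\<dots> = (\<Sum>J\<in>?Js. (-1) ^ card J * (t ^ (k * e) * g J (inverse t)))"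
        by (rule sum.cong[OF refl]) (simp only: g(2)[OF _ t])
      also have "\<dots> = t ^ (k * e) * poly G (inverse t)"
        by (simp add: G[symmetric] sum_distrib_left mult.left_commute)
      finally show "poly (monom 1 (2 * e) * q) t = t ^ (k * e) * poly G (inverse t)" .
    qed
  qed
  have "q = 0"
  proof (rule ccontr)
    assume "q \<noteq> 0"
    hence "card {1..<k} * e \<le> degree q"
      using dvd by (intro degree_ge_of_root_powers) (auto intro: inj_on_subset[OF inj_\<mu>])
    moreover have "degree (monom 1 (2 * e) * q) = 2 * e + degree q"
      using \<open>q \<noteq> 0\<close> by (subst degree_mult_eq) (auto simp: degree_monom_eq monom_eq_0_iff)
    ultimately have "(k - 1) * e + 2 * e \<le> k * e" using deg by simp
    moreover have "(k - 1) * e + 2 * e = k * e + e"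
      using k_pos by (cases k) auto
    ultimately show False using e_pos by simp
  qed
  thus ?thesis by (simp add: q)
qed

text \<open>At t = \<open>\<mu> 0\<close> all heads coincide and the dependence on
  \<open>Min J\<close> disappears, so the decoupled sum becomes the part over nonempty J of the
  finite difference in row \<open>Top 0\<close>. What remains is the term J = {}, the value in
  question.\<close>

theorem pencil_vanishes:
  "F (pencil \<mu> (\<lambda>j. binary_form (\<mu> 0) 1) (block_form 0 {..k})) = 0"
proof -
  define f where "f J = (-1) ^ card J * F (pencil \<mu> (\<lambda>j. binary_form (\<mu> 0) 1) (block_form 0 ({..k} - J)))" for J
  have "(\<Sum>L\<in>Pow {..k}. (-1) ^ card L * F (pencil \<mu> (\<lambda>j. binary_form (\<mu> 0) 1)
      (\<lambda>c v. 0 + (\<Sum>j\<in>{..k} - L. block_form 0 {j} c v)))) = 0"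
    by (rule alternating_top)
  hence "sum f (Pow {..k}) = 0" by (simp add: f_def sum_block_form)
  moreover have "sum f (Pow {..k}) = f {} + sum f (Pow {..k} - {{}})"
    by (rule sum.remove) auto
  moreover have "sum f (Pow {..k} - {{}}) = 0"
  proof -
    have "heads s (\<mu> 0) = (\<lambda>j. binary_form (\<mu> 0) 1)" for s by (intro ext) (simp add: heads_def)
    thus ?thesis using decoupled_sum_eq_0[of "\<mu> 0"] by (simp only: f_def[abs_def])
  qed
  ultimately show ?thesis by (simp add: f_def)
qed

end

section \<open>Invariants of tuples of matrices are semi-invariants\<close>

lemma alternating_sum_one:
  assumes "finite D" "D \<noteq> {}"
  shows "(\<Sum>L\<in>Pow D. (-1) ^ card L) = (0 :: 'a::comm_ring_1)"
proof -
  obtain t where t: "t \<in> D" using assms(2) by auto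
  have "(-1) ^ card L + (-1) ^ card (insert t L) = (0 :: 'a)" if "L \<in> Pow (D - {t})" for L
  proof -
    have "finite L" "t \<notin> L" using that assms(1) finite_subset by auto
    thus ?thesis by simp
  qed
  thus ?thesis using sum_Pow_split[OF assms(1) t, of "\<lambda>L. (-1) ^ card L :: 'a"] by simp
qed

text \<open>Induction on the total degree, splitting off one linear factor. Its constant term lowers
  the degree and keeps D. A summand \<open>\<chi> j p\<close> forces j out of L: degree and
  \<open>card D\<close> both drop by one, and \<open>\<chi> j\<close> is absorbed into
  \<open>b\<close>. No division occurs, so the argument is independent of the
  characteristic.\<close>

lemma alternating_sum_prod_power:
  fixes \<chi> :: "'j \<Rightarrow> 'p \<Rightarrow> 'a::comm_ring_1"
  assumes "finite S" "finite D" "(\<Sum>p\<in>S. \<alpha> p) < card D"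
  shows "(\<Sum>L\<in>Pow D. (-1) ^ card L * (\<Prod>p\<in>S. (b p + (\<Sum>j\<in>D - L. \<chi> j p)) ^ \<alpha> p)) = 0"
  using assms(2,3)
proof (induction "\<Sum>p\<in>S. \<alpha> p" arbitrary: \<alpha> D b)
  case 0
  hence "\<alpha> p = 0" if "p \<in> S" for p using assms(1) that by auto
  hence "(\<Prod>p\<in>S. (b p + (\<Sum>j\<in>D - L. \<chi> j p)) ^ \<alpha> p) = 1" for L by simp
  moreover have "D \<noteq> {}" using 0 by auto
  ultimately show ?case using 0 by (simp add: alternating_sum_one)
next
  case (Suc N)
  hence "(\<Sum>p\<in>S. \<alpha> p) \<noteq> 0" by simp
  then obtain p where p: "p \<in> S" "\<alpha> p > 0"
    by (meson gr0I sum.neutral)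
  define \<beta> where "\<beta> = \<alpha>(p := \<alpha> p - 1)"
  have "(\<Sum>q\<in>S. \<alpha> q) = \<alpha> p + (\<Sum>q\<in>S - {p}. \<alpha> q)" "(\<Sum>q\<in>S. \<beta> q) = \<beta> p + (\<Sum>q\<in>S - {p}. \<beta> q)"
    using assms(1) p by (simp_all add: sum.remove[of S p])
  moreover have "(\<Sum>q\<in>S - {p}. \<alpha> q) = (\<Sum>q\<in>S - {p}. \<beta> q)" by (simp add: \<beta>_def)
  moreover have \<alpha>_p: "\<alpha> p = Suc (\<beta> p)" using p by (simp add: \<beta>_def)
  ultimately have N: "N = (\<Sum>q\<in>S. \<beta> q)" using Suc.hyps(2) by linarith
  let ?\<Pi> = "\<lambda>b D L. \<Prod>q\<in>S. (b q + (\<Sum>j\<in>D - L. \<chi> j q)) ^ \<beta> q"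
  have factor: "(\<Prod>q\<in>S. (b q + (\<Sum>j\<in>D - L. \<chi> j q)) ^ \<alpha> q) =
      b p * ?\<Pi> b D L + (\<Sum>j\<in>D. if j \<in> L then 0 else \<chi> j p * ?\<Pi> b D L)" for L
  proof -
    have "(\<Prod>q\<in>S. (b q + (\<Sum>j\<in>D - L. \<chi> j q)) ^ \<alpha> q) = (b p + (\<Sum>j\<in>D - L. \<chi> j p)) * ?\<Pi> b D L"
    proof -
      have "(\<Prod>q\<in>S - {p}. (b q + (\<Sum>j\<in>D - L. \<chi> j q)) ^ \<alpha> q) =
          (\<Prod>q\<in>S - {p}. (b q + (\<Sum>j\<in>D - L. \<chi> j q)) ^ \<beta> q)"
        by (rule prod.cong) (auto simp: \<beta>_def)
      thus ?thesis
        using assms(1) p(1) \<alpha>_p by (simp add: prod.remove[of S p] mult.assoc)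
    qed
    also have "(\<Sum>j\<in>D - L. \<chi> j p) = (\<Sum>j\<in>D. if j \<in> L then 0 else \<chi> j p)"
      using Suc.prems by (intro sum.mono_neutral_cong_left) auto
    finally show ?thesis
      by (simp add: distrib_right sum_distrib_right if_distrib[of "\<lambda>x. x * _"] cong: if_cong)
  qed
  have small: "(\<Sum>q\<in>S. \<beta> q) < card D - 1" using Suc.prems(2) Suc.hyps(2) N by linarith
  have "(\<Sum>L\<in>Pow D. (-1) ^ card L * (b p * ?\<Pi> b D L)) = b p * (\<Sum>L\<in>Pow D. (-1) ^ card L * ?\<Pi> b D L)"
    by (simp add: sum_distrib_left mult.left_commute)
  also have "\<dots> = 0" using Suc.hyps(1)[OF N, of D b] Suc.prems(1) small by simp
  finally have first: "(\<Sum>L\<in>Pow D. (-1) ^ card L * (b p * ?\<Pi> b D L)) = 0" .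
  have second: "(\<Sum>L\<in>Pow D. (-1) ^ card L * (if j \<in> L then 0 else \<chi> j p * ?\<Pi> b D L)) = 0"
    if j: "j \<in> D" for j
  proof -
    have "(\<Sum>L\<in>Pow D. (-1) ^ card L * (if j \<in> L then 0 else \<chi> j p * ?\<Pi> b D L)) =
        (\<Sum>L\<in>Pow (D - {j}). \<chi> j p * ((-1) ^ card L * ?\<Pi> (\<lambda>q. b q + \<chi> j q) (D - {j}) L))"
    proof (rule sum.mono_neutral_cong_right)
      fix L assume L: "L \<in> Pow (D - {j})"
      have "(\<Sum>i\<in>D - L. \<chi> i q) = \<chi> j q + (\<Sum>i\<in>D - {j} - L. \<chi> i q)" for q
      proof -
        have "D - L - {j} = D - {j} - L" by auto
        thus ?thesis using sum.remove[of "D - L" j "\<lambda>i. \<chi> i q"] j L Suc.prems(1) by auto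
      qed
      thus "(-1) ^ card L * (if j \<in> L then 0 else \<chi> j p * ?\<Pi> b D L) =
          \<chi> j p * ((-1) ^ card L * ?\<Pi> (\<lambda>q. b q + \<chi> j q) (D - {j}) L)"
        using L by (auto simp: add.assoc mult.left_commute)
    qed (use Suc.prems in auto)
    also have "\<dots> = \<chi> j p * (\<Sum>L\<in>Pow (D - {j}). (-1) ^ card L * ?\<Pi> (\<lambda>q. b q + \<chi> j q) (D - {j}) L)"
      by (simp add: sum_distrib_left)
    also have "\<dots> = 0"
      using Suc.hyps(1)[OF N, of "D - {j}" "\<lambda>q. b q + \<chi> j q"] Suc.prems(1) small j by simp
    finally show ?thesis .
  qed
  have "(\<Sum>L\<in>Pow D. (-1) ^ card L * (\<Prod>q\<in>S. (b q + (\<Sum>j\<in>D - L. \<chi> j q)) ^ \<alpha> q)) =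
      (\<Sum>L\<in>Pow D. (-1) ^ card L * (b p * ?\<Pi> b D L)) +
      (\<Sum>L\<in>Pow D. \<Sum>j\<in>D. (-1) ^ card L * (if j \<in> L then 0 else \<chi> j p * ?\<Pi> b D L))"
    by (simp only: factor distrib_left sum.distrib sum_distrib_left)
  also have "\<dots> = 0"
    unfolding first by (subst sum.swap) (simp only: second sum.neutral_const add_0, simp add: second)
  finally show ?case .
qed

section \<open>Coordinates and the action of SL\<close>

definition tensor_tuple :: "nat \<Rightarrow> nat \<Rightarrow> (nat \<Rightarrow> nat \<Rightarrow> nat \<Rightarrow> 'a) \<Rightarrow> 'a mat list" where
  "tensor_tuple n m G = map (\<lambda>l. mat n n (\<lambda>(i, j). G i j l)) [0..<m]"

lemma tensor_tuple_in_mat_tuples: "tensor_tuple n m G \<in> mat_tuples n m"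
  by (auto simp: tensor_tuple_def mat_tuples_def)

lemma finite_coords: "finite (coords n m)"
  by (simp add: coords_def)

lemma finite_exponents: "finite (exponents n m D)"
proof -
  have "finite (coords n m \<rightarrow>\<^sub>E {..D})" by (rule finite_PiE) (auto simp: finite_coords)
  thus ?thesis by (simp add: exponents_def)
qed

lemma det_diagonal:
  "det (mat n n (\<lambda>(i, j). if i = j then w i else 0)) = (\<Prod>i<n. w i :: 'a::field)"
proof -
  have "det (mat n n (\<lambda>(i, j). if i = j then w i else 0)) =
      prod_list (diag_mat (mat n n (\<lambda>(i, j). if i = j then w i else 0)))"
    by (rule det_upper_triangular) auto
  also have "diag_mat (mat n n (\<lambda>(i, j). if i = j then w i else 0)) = map w [0..<n]"
    by (auto simp: diag_mat_def intro: map_cong)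
  also have "prod_list (map w [0..<n]) = (\<Prod>i<n. w i)"
    using prod.distinct_set_conv_list[of "[0..<n]" w] by (simp add: atLeast0LessThan)
  finally show ?thesis .
qed

lemma mat_inverse_SL:
  assumes "B \<in> SL n"
  obtains B' where "mat_inverse B = Some B'" "B' \<in> SL n" "B * B' = 1\<^sub>m n" "B' * B = 1\<^sub>m n"
proof -
  have B: "B \<in> carrier_mat n n" "det B = 1" using assms by (auto simp: SL_def)
  have "B \<in> Units (ring_mat TYPE('a) n ())" using B by (intro det_non_zero_imp_unit) simp_all
  hence "mat_inverse B \<noteq> None" using mat_inverse(1)[OF B(1), where b = "()"] by blast
  then obtain B' where some: "mat_inverse B = Some B'" by auto
  note B' = mat_inverse(2)[OF B(1) some]
  have "det B * det B' = 1" using det_mult[of B n B'] B B' by simp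
  hence "B' \<in> SL n" using B B' by (simp add: SL_def)
  thus thesis using some B' by (intro that) auto
qed

locale homogeneous_invariant =
  fixes n m D :: nat and f :: "'a::field mat list \<Rightarrow> 'a" and c :: "(nat \<times> nat \<times> nat \<Rightarrow> nat) \<Rightarrow> 'a"
  assumes infinite_field: "infinite (UNIV :: 'a set)" and n_pos: "0 < n"
    and expansion: "\<And>X. X \<in> mat_tuples n m \<Longrightarrow>
      f X = (\<Sum>\<alpha>\<in>exponents n m D. c \<alpha> * monomial_fun n m \<alpha> X)"
    and invariant: "SL_invariant n m f"
begin

definition ev :: "(nat \<Rightarrow> nat \<Rightarrow> nat \<Rightarrow> 'a) \<Rightarrow> 'a" where
  "ev G = (\<Sum>\<alpha>\<in>exponents n m D. c \<alpha> * (\<Prod>(l, i, j)\<in>coords n m. G i j l ^ \<alpha> (l, i, j)))"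

lemma f_eq_ev: "f (tensor_tuple n m G) = ev G"
proof -
  have "monomial_fun n m \<alpha> (tensor_tuple n m G) = (\<Prod>(l, i, j)\<in>coords n m. G i j l ^ \<alpha> (l, i, j))" for \<alpha>
    unfolding monomial_fun_def by (intro prod.cong) (auto simp: coords_def tensor_tuple_def)
  thus ?thesis by (simp add: expansion[OF tensor_tuple_in_mat_tuples] ev_def)
qed

lemma ev_cong:
  assumes "\<And>i j l. i < n \<Longrightarrow> j < n \<Longrightarrow> l < m \<Longrightarrow> G i j l = G' i j l"
  shows "ev G = ev G'"
proof -
  have "(\<Prod>(l, i, j)\<in>coords n m. G i j l ^ \<alpha> (l, i, j)) = (\<Prod>(l, i, j)\<in>coords n m. G' i j l ^ \<alpha> (l, i, j))" for \<alpha>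
    using assms by (intro prod.cong) (auto simp: coords_def)
  thus ?thesis by (simp add: ev_def)
qed

text \<open>The action multiplies by the inverse of its second argument. To obtain plain right
  multiplication by B, invariance is applied to the inverse \<open>B'\<close>, whose own inverse is
  B again.\<close>

lemma ev_SL:
  assumes "A \<in> SL n" "B \<in> SL n"
  shows "ev (\<lambda>i j l. \<Sum>h<n. \<Sum>h'<n. A $$ (i, h) * G h h' l * B $$ (h', j)) = ev G"
proof -
  have A: "A \<in> carrier_mat n n" and B: "B \<in> carrier_mat n n"
    using assms by (auto simp: SL_def)
  obtain B' where B': "B' \<in> SL n" "B * B' = 1\<^sub>m n" using mat_inverse_SL[OF assms(2)] by blast
  obtain Z where Z: "mat_inverse B' = Some Z" "Z \<in> SL n" "B' * Z = 1\<^sub>m n"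
    using mat_inverse_SL[OF B'(1)] by blast
  have carrier: "B' \<in> carrier_mat n n" "Z \<in> carrier_mat n n" using B' Z by (auto simp: SL_def)
  have "Z = B * B' * Z" using B' carrier by simp
  also have "\<dots> = B * (B' * Z)" by (rule assoc_mult_mat[OF B carrier])
  also have "\<dots> = B" using B Z by simp
  finally have "mat_inverse B' = Some B" using Z(1) by simp
  moreover have "A * mat n n (\<lambda>(i, j). G i j l) * B =
      mat n n (\<lambda>(i, j). \<Sum>h<n. \<Sum>h'<n. A $$ (i, h) * G h h' l * B $$ (h', j))" (is "?L = ?R") for l
  proof (rule eq_matI)
    fix i j assume "i < dim_row ?R" "j < dim_col ?R"
    hence ij: "i < n" "j < n" by auto
    have "?L $$ (i, j) = (\<Sum>h'<n. (\<Sum>h<n. A $$ (i, h) * G h h' l) * B $$ (h', j))"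
      using A B ij by (simp add: scalar_prod_def atLeast0LessThan)
    also have "\<dots> = (\<Sum>h'<n. \<Sum>h<n. A $$ (i, h) * G h h' l * B $$ (h', j))"
      by (simp only: sum_distrib_right)
    also have "\<dots> = (\<Sum>h<n. \<Sum>h'<n. A $$ (i, h) * G h h' l * B $$ (h', j))"
      by (rule sum.swap)
    finally show "?L $$ (i, j) = ?R $$ (i, j)" using ij by simp
  qed (use A B in auto)
  ultimately have "left_right_action A B' (tensor_tuple n m G) =
      tensor_tuple n m (\<lambda>i j l. \<Sum>h<n. \<Sum>h'<n. A $$ (i, h) * G h h' l * B $$ (h', j))"
    by (simp add: left_right_action_def tensor_tuple_def)
  moreover have "f (left_right_action A B' (tensor_tuple n m G)) = f (tensor_tuple n m G)"
    using invariant assms(1) B'(1) tensor_tuple_in_mat_tuples[of n m G]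
    unfolding SL_invariant_def by blast
  ultimately show ?thesis by (simp only: f_eq_ev)
qed

lemma ev_left:
  assumes "A \<in> SL n"
  shows "ev (\<lambda>i j l. \<Sum>h<n. A $$ (i, h) * G h j l) = ev G"
proof -
  have "1\<^sub>m n \<in> SL n" by (simp add: SL_def)
  have "ev (\<lambda>i j l. \<Sum>h<n. A $$ (i, h) * G h j l) =
      ev (\<lambda>i j l. \<Sum>h<n. \<Sum>h'<n. A $$ (i, h) * G h h' l * 1\<^sub>m n $$ (h', j))"
    by (rule ev_cong) (auto simp: if_distrib[of "\<lambda>x. _ * x"] sum.delta cong: if_cong)
  also have "\<dots> = ev G" by (rule ev_SL) fact+
  finally show ?thesis .
qed

lemma ev_right:
  assumes "B \<in> SL n"
  shows "ev (\<lambda>i j l. \<Sum>h<n. G i h l * B $$ (h, j)) = ev G"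
proof -
  have "1\<^sub>m n \<in> SL n" by (simp add: SL_def)
  have "ev (\<lambda>i j l. \<Sum>h<n. G i h l * B $$ (h, j)) =
      ev (\<lambda>i j l. \<Sum>h<n. \<Sum>h'<n. 1\<^sub>m n $$ (i, h) * G h h' l * B $$ (h', j))"
  proof (rule ev_cong)
    fix i j l assume "i < n"
    have "(\<Sum>h<n. \<Sum>h'<n. 1\<^sub>m n $$ (i, h) * G h h' l * B $$ (h', j)) =
        (\<Sum>h<n. if h = i then \<Sum>h'<n. G i h' l * B $$ (h', j) else 0)"
      using \<open>i < n\<close> by (intro sum.cong) auto
    thus "(\<Sum>h<n. G i h l * B $$ (h, j)) = (\<Sum>h<n. \<Sum>h'<n. 1\<^sub>m n $$ (i, h) * G h h' l * B $$ (h', j))"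
      using \<open>i < n\<close> by simp
  qed
  also have "\<dots> = ev G" by (rule ev_SL) fact+
  finally show ?thesis .
qed

section \<open>Elementary operations on an invariant polynomial\<close>

lemma ev_add_row:
  assumes "r < n" "s < n" "r \<noteq> s"
  shows "ev (\<lambda>i j l. G i j l + (if i = r then a * G s j l else 0)) = ev G"
proof -
  have "addrow_mat n a r s \<in> SL n" using assms by (simp add: SL_def det_addrow_mat)
  have "ev (\<lambda>i j l. G i j l + (if i = r then a * G s j l else 0)) =
      ev (\<lambda>i j l. \<Sum>h<n. addrow_mat n a r s $$ (i, h) * G h j l)"
  proof (rule ev_cong)
    fix i j l assume i: "i < n"
    have "(\<Sum>h<n. addrow_mat n a r s $$ (i, h) * G h j l) =
        (\<Sum>h<n. (if h = i then G i j l else 0) + (if h = s then if i = r then a * G s j l else 0 else 0))"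
      using i assms by (intro sum.cong) (auto simp: distrib_right)
    thus "G i j l + (if i = r then a * G s j l else 0) = (\<Sum>h<n. addrow_mat n a r s $$ (i, h) * G h j l)"
      using i assms by (simp add: sum.distrib)
  qed
  also have "\<dots> = ev G" by (rule ev_left) fact
  finally show ?thesis .
qed

lemma ev_add_col:
  assumes "r < n" "s < n" "r \<noteq> s"
  shows "ev (\<lambda>i j l. G i j l + (if j = r then a * G i s l else 0)) = ev G"
proof -
  have "addrow_mat n a s r \<in> SL n" using assms by (simp add: SL_def det_addrow_mat)
  have "ev (\<lambda>i j l. G i j l + (if j = r then a * G i s l else 0)) =
      ev (\<lambda>i j l. \<Sum>h<n. G i h l * addrow_mat n a s r $$ (h, j))"
  proof (rule ev_cong)
    fix i j l assume j: "j < n"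
    have "(\<Sum>h<n. G i h l * addrow_mat n a s r $$ (h, j)) =
        (\<Sum>h<n. (if h = j then G i j l else 0) + (if h = s then if j = r then a * G i s l else 0 else 0))"
      using j assms by (intro sum.cong) (auto simp: distrib_left)
    thus "G i j l + (if j = r then a * G i s l else 0) = (\<Sum>h<n. G i h l * addrow_mat n a s r $$ (h, j))"
      using j assms by (simp add: sum.distrib)
  qed
  also have "\<dots> = ev G" by (rule ev_right) fact
  finally show ?thesis .
qed

lemma ev_scale_rows:
  assumes "(\<Prod>i<n. w i) = 1"
  shows "ev (\<lambda>i j l. w i * G i j l) = ev G"
proof -
  let ?A = "mat n n (\<lambda>(i, j). if i = j then w i else 0)"
  have "?A \<in> SL n" using assms by (simp add: SL_def det_diagonal)
  have "ev (\<lambda>i j l. w i * G i j l) = ev (\<lambda>i j l. \<Sum>h<n. ?A $$ (i, h) * G h j l)"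
    by (rule ev_cong) (auto simp: if_distrib[of "\<lambda>x. x * _"] sum.delta' cong: if_cong)
  also have "\<dots> = ev G" by (rule ev_left) fact
  finally show ?thesis .
qed

lemma ev_scale_cols:
  assumes "(\<Prod>i<n. w i) = 1"
  shows "ev (\<lambda>i j l. w j * G i j l) = ev G"
proof -
  let ?A = "mat n n (\<lambda>(i, j). if i = j then w i else 0)"
  have "?A \<in> SL n" using assms by (simp add: SL_def det_diagonal)
  have "ev (\<lambda>i j l. w j * G i j l) = ev (\<lambda>i j l. \<Sum>h<n. G i h l * ?A $$ (h, j))"
    by (rule ev_cong) (auto simp: if_distrib[of "\<lambda>x. _ * x"] sum.delta mult.commute cong: if_cong)
  also have "\<dots> = ev G" by (rule ev_right) fact
  finally show ?thesis .
qed

section \<open>Weights in a single row or column\<close>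

lemma ev_scale: "ev (\<lambda>i j l. t * G i j l) = t ^ D * ev G"
proof -
  have "(\<Prod>(l, i, j)\<in>coords n m. (t * G i j l) ^ \<alpha> (l, i, j)) =
      t ^ D * (\<Prod>(l, i, j)\<in>coords n m. G i j l ^ \<alpha> (l, i, j))" if "\<alpha> \<in> exponents n m D" for \<alpha>
  proof -
    have "(\<Prod>(l, i, j)\<in>coords n m. (t * G i j l) ^ \<alpha> (l, i, j)) =
        (\<Prod>p\<in>coords n m. t ^ \<alpha> p) * (\<Prod>(l, i, j)\<in>coords n m. G i j l ^ \<alpha> (l, i, j))"
      by (simp add: prod.distrib[symmetric] power_mult_distrib case_prod_beta)
    also have "(\<Prod>p\<in>coords n m. t ^ \<alpha> p) = t ^ D"
      using that by (simp add: power_sum[symmetric] exponents_def)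
    finally show ?thesis .
  qed
  thus ?thesis by (simp add: ev_def sum_distrib_left mult.left_commute)
qed

lemma poly_fun_ev:
  assumes "\<And>i j l. poly_fun (\<lambda>t. G t i j l)"
  shows "poly_fun (\<lambda>t. ev (G t))"
  unfolding ev_def case_prod_beta by (intro poly_fun_intros assms)


text \<open>The weights \<open>t ^ (n - 1)\<close> on row r and 1/t on the other rows have product 1
  and so come from SL. Multiplying the whole tuple by t, which costs \<open>t ^ D\<close>, leaves
  \<open>t ^ n\<close> on row r alone.\<close>

lemma ev_scale_row_power:
  assumes "r < n" "t \<noteq> 0"
  shows "ev (\<lambda>i j l. (if i = r then t ^ n else 1) * G i j l) = t ^ D * ev G"
proof -
  define w where "w i = (if i = r then t ^ n else 1) * inverse t" for i
  have "(\<Prod>i<n. w i) = (\<Prod>i<n. if i = r then t ^ n else 1) * inverse t ^ n"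
    unfolding w_def prod.distrib by (simp only: prod_constant card_lessThan)
  also have "(\<Prod>i<n. if i = r then t ^ n else 1) = t ^ n"
    using assms(1) by (simp only: prod.delta finite_lessThan lessThan_iff if_True)
  also have "t ^ n * inverse t ^ n = 1"
    using assms(2) by (simp flip: power_mult_distrib)
  finally have w: "(\<Prod>i<n. w i) = 1" .
  have "ev (\<lambda>i j l. (if i = r then t ^ n else 1) * G i j l) = ev (\<lambda>i j l. w i * (t * G i j l))"
    using assms(2) by (intro ev_cong) (simp add: w_def)
  also have "\<dots> = t ^ D * ev G" by (simp only: ev_scale_rows[OF w] ev_scale)
  finally show ?thesis .
qed

lemma ev_scale_col_power:
  assumes "r < n" "t \<noteq> 0"
  shows "ev (\<lambda>i j l. (if j = r then t ^ n else 1) * G i j l) = t ^ D * ev G"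
proof -
  define w where "w i = (if i = r then t ^ n else 1) * inverse t" for i
  have "(\<Prod>i<n. w i) = (\<Prod>i<n. if i = r then t ^ n else 1) * inverse t ^ n"
    unfolding w_def prod.distrib by (simp only: prod_constant card_lessThan)
  also have "(\<Prod>i<n. if i = r then t ^ n else 1) = t ^ n"
    using assms(1) by (simp only: prod.delta finite_lessThan lessThan_iff if_True)
  also have "t ^ n * inverse t ^ n = 1"
    using assms(2) by (simp flip: power_mult_distrib)
  finally have w: "(\<Prod>i<n. w i) = 1" .
  have "ev (\<lambda>i j l. (if j = r then t ^ n else 1) * G i j l) = ev (\<lambda>i j l. w j * (t * G i j l))"
    using assms(2) by (intro ev_cong) (simp add: w_def)
  also have "\<dots> = t ^ D * ev G" by (simp only: ev_scale_cols[OF w] ev_scale)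
  finally show ?thesis .
qed

text \<open>Scaling is understood only for n-th powers, and K may lack n-th roots. Substituting
  \<open>t ^ n\<close> keeps everything an identity of polynomials.\<close>

lemma pcompose_of_power_law:
  fixes q :: "'a poly"
  assumes "\<And>t. t \<noteq> 0 \<Longrightarrow> poly q (t ^ n) = t ^ D * a"
  shows "pcompose q (monom 1 n) = monom a D"
  by (rule poly_eqI_infinite[OF infinite_field, of "{0}"])
     (simp_all add: assms poly_pcompose poly_monom mult.commute)

text \<open>Degrees are compared in the identity expressing that q composed with
  \<open>t ^ n\<close> is the nonzero monomial of degree D.\<close>

lemma dvd_degree_if_nonzero:
  assumes "ev G \<noteq> 0"
  shows "n dvd D"
proof -
  have "poly_fun (\<lambda>t. ev (\<lambda>i j l. (if i = 0 then t else 1) * G i j l))"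
    by (intro poly_fun_ev poly_fun_intros)
  then obtain q where q: "\<And>t. ev (\<lambda>i j l. (if i = 0 then t else 1) * G i j l) = poly q t"
    unfolding poly_fun_def by blast
  have "pcompose q (monom 1 n) = monom (ev G) D"
    using ev_scale_row_power[OF n_pos] by (intro pcompose_of_power_law) (simp flip: q)
  hence "degree q * n = D"
    using degree_pcompose[of q "monom 1 n"] assms by (simp add: degree_monom_eq)
  thus ?thesis by (metis dvd_triv_right)
qed

lemma power_law:
  fixes q :: "'a poly"
  assumes "D = n * e" "\<And>t. t \<noteq> 0 \<Longrightarrow> poly q (t ^ n) = t ^ D * a"
  shows "poly q t = t ^ e * a"
proof -
  have comp: "pcompose q (monom 1 n) = monom a D"
    by (rule pcompose_of_power_law) (rule assms(2))
  \<comment> \<open>Composition with a polynomial of positive degree is injective, so it suffices to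
    compare after substituting \<open>t ^ n\<close>.\<close>
  have "pcompose (q - monom a e) (monom 1 n) = 0"
  proof (rule poly_eqI_infinite[OF infinite_field, of "{}"])
    fix t :: 'a
    have "poly (pcompose q (monom 1 n)) t = poly (monom a D) t"
      by (simp only: comp)
    moreover have "t ^ D = (t ^ n) ^ e" unfolding assms(1) by (rule power_mult)
    ultimately show "poly (pcompose (q - monom a e) (monom 1 n)) t = poly 0 t"
      unfolding poly_pcompose poly_monom poly_diff poly_0 mult_1_left by simp
  qed simp
  hence "q - monom a e = 0"
    by (rule pcompose_eq_0) (use n_pos in \<open>simp add: degree_monom_eq\<close>)
  thus ?thesis by (simp add: poly_monom mult.commute)
qed

lemma ev_scale_row:
  assumes "D = n * e" "r < n"
  shows "ev (\<lambda>i j l. (if i = r then t else 1) * G i j l) = t ^ e * ev G"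
proof -
  have "poly_fun (\<lambda>t. ev (\<lambda>i j l. (if i = r then t else 1) * G i j l))"
    by (intro poly_fun_ev poly_fun_intros)
  then obtain q where q: "\<And>t. ev (\<lambda>i j l. (if i = r then t else 1) * G i j l) = poly q t"
    unfolding poly_fun_def by blast
  show ?thesis unfolding q
    by (rule power_law[OF assms(1)]) (simp add: ev_scale_row_power assms(2) flip: q)
qed

lemma ev_scale_col:
  assumes "D = n * e" "r < n"
  shows "ev (\<lambda>i j l. (if j = r then t else 1) * G i j l) = t ^ e * ev G"
proof -
  have "poly_fun (\<lambda>t. ev (\<lambda>i j l. (if j = r then t else 1) * G i j l))"
    by (intro poly_fun_ev poly_fun_intros)
  then obtain q where q: "\<And>t. ev (\<lambda>i j l. (if j = r then t else 1) * G i j l) = poly q t"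
    unfolding poly_fun_def by blast
  show ?thesis unfolding q
    by (rule power_law[OF assms(1)]) (simp add: ev_scale_col_power assms(2) flip: q)
qed

section \<open>The degree in a single row\<close>

definition row_coords :: "nat \<Rightarrow> (nat \<times> nat \<times> nat) set" where
  "row_coords r = {(l, i, j) \<in> coords n m. i = r}"

text \<open>With row r scaled by t, \<open>ev G\<close> becomes \<open>t ^ e * ev G\<close>. Sorting
  the monomials by their degree in that row and reading off the coefficient of \<open>t ^ e\<close>
  shows that the contributions of all other row degrees cancel.\<close>

lemma ev_eq_row_degree:
  assumes "D = n * e" "r < n"
  shows "ev G = (\<Sum>\<alpha>\<in>{\<alpha> \<in> exponents n m D. (\<Sum>p\<in>row_coords r. \<alpha> p) = e}.
    c \<alpha> * (\<Prod>(l, i, j)\<in>coords n m. G i j l ^ \<alpha> (l, i, j)))"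
proof -
  define T where "T \<alpha> = c \<alpha> * (\<Prod>(l, i, j)\<in>coords n m. G i j l ^ \<alpha> (l, i, j))" for \<alpha>
  define d where "d \<alpha> = (\<Sum>p\<in>row_coords r. \<alpha> p)" for \<alpha> :: "nat \<times> nat \<times> nat \<Rightarrow> nat"
  have scaled: "(\<Prod>(l, i, j)\<in>coords n m. ((if i = r then t else 1) * G i j l) ^ \<alpha> (l, i, j)) =
      t ^ d \<alpha> * (\<Prod>(l, i, j)\<in>coords n m. G i j l ^ \<alpha> (l, i, j))" for t \<alpha>
  proof -
    have "(\<Prod>p\<in>coords n m. (if fst (snd p) = r then t else 1) ^ \<alpha> p) = (\<Prod>p\<in>row_coords r. t ^ \<alpha> p)"
      by (rule prod.mono_neutral_cong_right) (auto simp: finite_coords row_coords_def)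
    also have "\<dots> = t ^ d \<alpha>" by (simp add: power_sum d_def)
    finally show ?thesis
      by (simp add: case_prod_beta power_mult_distrib prod.distrib)
  qed
  have "(\<Sum>\<alpha>\<in>exponents n m D. monom (T \<alpha>) (d \<alpha>)) = monom (ev G) e"
  proof (rule poly_eqI_infinite[OF infinite_field, of "{}"])
    fix t :: 'a
    have "poly (\<Sum>\<alpha>\<in>exponents n m D. monom (T \<alpha>) (d \<alpha>)) t = (\<Sum>\<alpha>\<in>exponents n m D. T \<alpha> * t ^ d \<alpha>)"
      by (simp add: poly_sum poly_monom)
    also have "\<dots> = ev (\<lambda>i j l. (if i = r then t else 1) * G i j l)"
      unfolding ev_def scaled T_def by (intro sum.cong refl) (simp only: mult_ac)
    also have "\<dots> = t ^ e * ev G" by (rule ev_scale_row[OF assms])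
    also have "\<dots> = poly (monom (ev G) e) t" by (simp add: poly_monom mult.commute)
    finally show "poly (\<Sum>\<alpha>\<in>exponents n m D. monom (T \<alpha>) (d \<alpha>)) t = poly (monom (ev G) e) t" .
  qed simp
  hence "coeff (\<Sum>\<alpha>\<in>exponents n m D. monom (T \<alpha>) (d \<alpha>)) e = ev G" by simp
  hence "ev G = (\<Sum>\<alpha>\<in>exponents n m D. if d \<alpha> = e then T \<alpha> else 0)"
    by (simp add: coeff_sum)
  also have "\<dots> = (\<Sum>\<alpha>\<in>{\<alpha> \<in> exponents n m D. d \<alpha> = e}. T \<alpha>)"
    by (rule sum.inter_filter[symmetric, OF finite_exponents])
  finally show ?thesis unfolding T_def d_def .
qed

lemma ev_alternating_row:
  assumes "D = n * e" "r < n" "finite K" "e < card K"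
  shows "(\<Sum>L\<in>Pow K. (-1) ^ card L * ev (G(r := (\<lambda>j l. b j l + (\<Sum>k\<in>K - L. \<chi> k j l))))) = 0"
proof -
  define A where "A = {\<alpha> \<in> exponents n m D. (\<Sum>p\<in>row_coords r. \<alpha> p) = e}"
  define X where "X L p = b (snd (snd p)) (fst p) + (\<Sum>k\<in>K - L. \<chi> k (snd (snd p)) (fst p))"
    for L and p :: "nat \<times> nat \<times> nat"
  define Y where "Y \<alpha> = (\<Prod>p\<in>coords n m - row_coords r.
      G (fst (snd p)) (snd (snd p)) (fst p) ^ \<alpha> p)" for \<alpha>
  have sub: "row_coords r \<subseteq> coords n m" by (auto simp: row_coords_def)
  hence fin: "finite (row_coords r)" using finite_coords finite_subset by blast
  have "(\<Prod>(l, i, j)\<in>coords n m. (G(r := (\<lambda>j l. b j l + (\<Sum>k\<in>K - L. \<chi> k j l)))) i j l ^ \<alpha> (l, i, j)) =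
      Y \<alpha> * (\<Prod>p\<in>row_coords r. X L p ^ \<alpha> p)" for L \<alpha>
  proof -
    have "(\<Prod>(l, i, j)\<in>coords n m. (G(r := (\<lambda>j l. b j l + (\<Sum>k\<in>K - L. \<chi> k j l)))) i j l ^ \<alpha> (l, i, j)) =
      (\<Prod>(l, i, j)\<in>coords n m - row_coords r. (G(r := (\<lambda>j l. b j l + (\<Sum>k\<in>K - L. \<chi> k j l)))) i j l ^ \<alpha> (l, i, j)) *
      (\<Prod>(l, i, j)\<in>row_coords r. (G(r := (\<lambda>j l. b j l + (\<Sum>k\<in>K - L. \<chi> k j l)))) i j l ^ \<alpha> (l, i, j))"
      by (rule prod.subset_diff[OF sub finite_coords])
    also have "(\<Prod>(l, i, j)\<in>row_coords r. (G(r := (\<lambda>j l. b j l + (\<Sum>k\<in>K - L. \<chi> k j l)))) i j l ^ \<alpha> (l, i, j)) =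
      (\<Prod>p\<in>row_coords r. X L p ^ \<alpha> p)"
      by (rule prod.cong) (auto simp: row_coords_def X_def)
    also have "(\<Prod>(l, i, j)\<in>coords n m - row_coords r. (G(r := (\<lambda>j l. b j l + (\<Sum>k\<in>K - L. \<chi> k j l)))) i j l ^ \<alpha> (l, i, j)) = Y \<alpha>"
      unfolding Y_def by (rule prod.cong) (auto simp: row_coords_def split: if_splits)
    finally show ?thesis .
  qed
  hence ev: "ev (G(r := (\<lambda>j l. b j l + (\<Sum>k\<in>K - L. \<chi> k j l)))) =
      (\<Sum>\<alpha>\<in>A. c \<alpha> * (Y \<alpha> * (\<Prod>p\<in>row_coords r. X L p ^ \<alpha> p)))" for L
    by (subst ev_eq_row_degree[OF assms(1,2)]) (simp only: A_def)
  have "(\<Sum>L\<in>Pow K. (-1) ^ card L * ev (G(r := (\<lambda>j l. b j l + (\<Sum>k\<in>K - L. \<chi> k j l))))) =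
      (\<Sum>L\<in>Pow K. \<Sum>\<alpha>\<in>A. c \<alpha> * Y \<alpha> * ((-1) ^ card L * (\<Prod>p\<in>row_coords r. X L p ^ \<alpha> p)))"
    unfolding ev sum_distrib_left by (intro sum.cong refl) (simp only: mult_ac)
  also have "\<dots> = (\<Sum>\<alpha>\<in>A. c \<alpha> * Y \<alpha> * (\<Sum>L\<in>Pow K. (-1) ^ card L * (\<Prod>p\<in>row_coords r. X L p ^ \<alpha> p)))"
    by (subst sum.swap) (simp only: sum_distrib_left)
  also have "\<dots> = 0"
  proof (rule sum.neutral, rule ballI)
    fix \<alpha> assume "\<alpha> \<in> A"
    hence "(\<Sum>L\<in>Pow K. (-1) ^ card L * (\<Prod>p\<in>row_coords r. X L p ^ \<alpha> p)) = 0"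
      unfolding X_def by (intro alternating_sum_prod_power fin assms) (use assms in \<open>simp add: A_def\<close>)
    thus "c \<alpha> * Y \<alpha> * (\<Sum>L\<in>Pow K. (-1) ^ card L * (\<Prod>p\<in>row_coords r. X L p ^ \<alpha> p)) = 0" by simp
  qed
  finally show ?thesis .
qed

lemma semi_invariant_relabelled:
  assumes "D = n * e" and \<rho>: "bij_betw \<rho> {..<n} R" and \<gamma>: "bij_betw \<gamma> {..<n} C"
  shows "semi_invariant (\<lambda>\<Phi>. ev (\<lambda>i j l. \<Phi> (\<rho> i) (\<gamma> j) l)) R C m e"
proof
  have \<rho>_eq: "\<rho> i = \<rho> i' \<longleftrightarrow> i = i'" if "i < n" "i' < n" for i i'
    using \<rho> that by (auto simp: bij_betw_def inj_on_def)
  have \<gamma>_eq: "\<gamma> i = \<gamma> i' \<longleftrightarrow> i = i'" if "i < n" "i' < n" for i i'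
    using \<gamma> that by (auto simp: bij_betw_def inj_on_def)
  have \<rho>_ex: "\<exists>i<n. r = \<rho> i" if "r \<in> R" for r
    using \<rho> that by (auto simp: bij_betw_def)
  have \<gamma>_ex: "\<exists>i<n. r = \<gamma> i" if "r \<in> C" for r
    using \<gamma> that by (auto simp: bij_betw_def)
  have mem: "\<rho> i \<in> R" "\<gamma> i \<in> C" if "i < n" for i
    using \<rho> \<gamma> that by (auto simp: bij_betw_def)
  show "infinite (UNIV :: 'a set)" by (rule infinite_field)
  show "finite R" "finite C" using bij_betw_finite[OF \<rho>] bij_betw_finite[OF \<gamma>] by simp_all
  show "ev (\<lambda>i j. \<Phi> (\<rho> i) (\<gamma> j)) = ev (\<lambda>i j. \<Phi>' (\<rho> i) (\<gamma> j))"
    if "\<And>r c v. r \<in> R \<Longrightarrow> c \<in> C \<Longrightarrow> v < m \<Longrightarrow> \<Phi> r c v = \<Phi>' r c v" for \<Phi> \<Phi>' :: "'b \<Rightarrow> 'c \<Rightarrow> nat \<Rightarrow> 'a"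
    using that mem by (intro ev_cong) auto
  show "ev (\<lambda>i j l. \<Phi> (\<rho> i) (\<gamma> j) l + (if \<rho> i = r then a * \<Phi> s (\<gamma> j) l else 0)) =
      ev (\<lambda>i j. \<Phi> (\<rho> i) (\<gamma> j))" if rs: "r \<in> R" "s \<in> R" "r \<noteq> s" for r s a and \<Phi> :: "'b \<Rightarrow> 'c \<Rightarrow> nat \<Rightarrow> 'a"
  proof -
    obtain r' s' where r': "r' < n" "r = \<rho> r'" and s': "s' < n" "s = \<rho> s'" using \<rho>_ex[OF rs(1)] \<rho>_ex[OF rs(2)] by blast
    have "ev (\<lambda>i j l. \<Phi> (\<rho> i) (\<gamma> j) l + (if \<rho> i = r then a * \<Phi> s (\<gamma> j) l else 0)) =
        ev (\<lambda>i j l. \<Phi> (\<rho> i) (\<gamma> j) l + (if i = r' then a * \<Phi> (\<rho> s') (\<gamma> j) l else 0))"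
      by (rule ev_cong) (simp add: r' s' \<rho>_eq)
    also have "\<dots> = ev (\<lambda>i j. \<Phi> (\<rho> i) (\<gamma> j))"
      by (rule ev_add_row) (use r' s' rs in auto)
    finally show ?thesis .
  qed
  show "ev (\<lambda>i j l. \<Phi> (\<rho> i) (\<gamma> j) l + (if \<gamma> j = r then a * \<Phi> (\<rho> i) s l else 0)) =
      ev (\<lambda>i j. \<Phi> (\<rho> i) (\<gamma> j))" if rs: "r \<in> C" "s \<in> C" "r \<noteq> s" for r s a and \<Phi> :: "'b \<Rightarrow> 'c \<Rightarrow> nat \<Rightarrow> 'a"
  proof -
    obtain r' s' where r': "r' < n" "r = \<gamma> r'" and s': "s' < n" "s = \<gamma> s'" using \<gamma>_ex[OF rs(1)] \<gamma>_ex[OF rs(2)] by blast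
    have "ev (\<lambda>i j l. \<Phi> (\<rho> i) (\<gamma> j) l + (if \<gamma> j = r then a * \<Phi> (\<rho> i) s l else 0)) =
        ev (\<lambda>i j l. \<Phi> (\<rho> i) (\<gamma> j) l + (if j = r' then a * \<Phi> (\<rho> i) (\<gamma> s') l else 0))"
      by (rule ev_cong) (simp add: r' s' \<gamma>_eq)
    also have "\<dots> = ev (\<lambda>i j. \<Phi> (\<rho> i) (\<gamma> j))"
      by (rule ev_add_col) (use r' s' rs in auto)
    finally show ?thesis .
  qed
  show "ev (\<lambda>i j l. (if \<rho> i = r then a else 1) * \<Phi> (\<rho> i) (\<gamma> j) l) = a ^ e * ev (\<lambda>i j. \<Phi> (\<rho> i) (\<gamma> j))"
    if r: "r \<in> R" for r a and \<Phi> :: "'b \<Rightarrow> 'c \<Rightarrow> nat \<Rightarrow> 'a"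
  proof -
    obtain r' where r': "r' < n" "r = \<rho> r'" using \<rho>_ex[OF r] by blast
    have "ev (\<lambda>i j l. (if \<rho> i = r then a else 1) * \<Phi> (\<rho> i) (\<gamma> j) l) =
        ev (\<lambda>i j l. (if i = r' then a else 1) * \<Phi> (\<rho> i) (\<gamma> j) l)"
      by (rule ev_cong) (simp add: r' \<rho>_eq)
    also have "\<dots> = a ^ e * ev (\<lambda>i j. \<Phi> (\<rho> i) (\<gamma> j))"
      by (rule ev_scale_row[OF assms(1) r'(1)])
    finally show ?thesis .
  qed
  show "ev (\<lambda>i j l. (if \<gamma> j = r then a else 1) * \<Phi> (\<rho> i) (\<gamma> j) l) = a ^ e * ev (\<lambda>i j. \<Phi> (\<rho> i) (\<gamma> j))"
    if r: "r \<in> C" for r a and \<Phi> :: "'b \<Rightarrow> 'c \<Rightarrow> nat \<Rightarrow> 'a"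
  proof -
    obtain r' where r': "r' < n" "r = \<gamma> r'" using \<gamma>_ex[OF r] by blast
    have "ev (\<lambda>i j l. (if \<gamma> j = r then a else 1) * \<Phi> (\<rho> i) (\<gamma> j) l) =
        ev (\<lambda>i j l. (if j = r' then a else 1) * \<Phi> (\<rho> i) (\<gamma> j) l)"
      by (rule ev_cong) (simp add: r' \<gamma>_eq)
    also have "\<dots> = a ^ e * ev (\<lambda>i j. \<Phi> (\<rho> i) (\<gamma> j))"
      by (rule ev_scale_col[OF assms(1) r'(1)])
    finally show ?thesis .
  qed
  show "poly_fun (\<lambda>t. ev (\<lambda>i j. \<Phi>t t (\<rho> i) (\<gamma> j)))"
    if "\<And>r c v. poly_fun (\<lambda>t. \<Phi>t t r c v)" for \<Phi>t :: "'a \<Rightarrow> 'b \<Rightarrow> 'c \<Rightarrow> nat \<Rightarrow> 'a"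
    by (intro poly_fun_ev that)
  show "(\<Sum>L\<in>Pow K. (-1) ^ card L *
      ev (\<lambda>i j. (\<Phi>(r := (\<lambda>c v. b c v + (\<Sum>j\<in>K - L. \<chi> j c v)))) (\<rho> i) (\<gamma> j))) = 0"
    if K: "r \<in> R" "finite K" "e < card K" for r K b
      and \<chi> :: "nat \<Rightarrow> 'c \<Rightarrow> nat \<Rightarrow> 'a" and \<Phi> :: "'b \<Rightarrow> 'c \<Rightarrow> nat \<Rightarrow> 'a"
  proof -
    obtain r' where r': "r' < n" "r = \<rho> r'" using \<rho>_ex[OF K(1)] by blast
    have "ev (\<lambda>i j. (\<Phi>(r := (\<lambda>c v. b c v + (\<Sum>j\<in>K - L. \<chi> j c v)))) (\<rho> i) (\<gamma> j)) =
        ev ((\<lambda>i j. \<Phi> (\<rho> i) (\<gamma> j))(r' := (\<lambda>j l. b (\<gamma> j) l + (\<Sum>k\<in>K - L. \<chi> k (\<gamma> j) l))))" for L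
      by (rule ev_cong) (simp add: r' \<rho>_eq)
    thus ?thesis
      using ev_alternating_row[OF assms(1) r'(1) K(2,3), of "\<lambda>i j. \<Phi> (\<rho> i) (\<gamma> j)"
          "\<lambda>j. b (\<gamma> j)" "\<lambda>k j. \<chi> k (\<gamma> j)"] by simp
  qed
qed

end

section \<open>Determinantal invariants\<close>

lemma sum_div_mod:
  fixes g :: "nat \<Rightarrow> nat \<Rightarrow> 'a::comm_monoid_add"
  shows "(\<Sum>h<n * d. g (h div d) (h mod d)) = (\<Sum>h<n. \<Sum>r<d. g h r)"
proof -
  have "(\<Sum>h<n * d. g (h div d) (h mod d)) = (\<Sum>h<n. \<Sum>x\<in>{h * d..<h * d + d}. g (x div d) (x mod d))"
    by (rule sum.nat_group[symmetric])
  also have "\<dots> = (\<Sum>h<n. \<Sum>r<d. g h r)"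
  proof (rule sum.cong[OF refl])
    fix h
    have "(\<Sum>x\<in>{h * d..<h * d + d}. g (x div d) (x mod d)) = (\<Sum>r<d. g ((r + h * d) div d) ((r + h * d) mod d))"
      using sum.shift_bounds_nat_ivl[of "\<lambda>x. g (x div d) (x mod d)" 0 "h * d" d]
      by (simp add: atLeast0LessThan add.commute)
    also have "\<dots> = (\<Sum>r<d. g h r)"
      by (rule sum.cong) simp_all
    finally show "(\<Sum>x\<in>{h * d..<h * d + d}. g (x div d) (x mod d)) = (\<Sum>r<d. g h r)" .
  qed
  finally show ?thesis .
qed

section \<open>Polynomiality of the determinantal invariants\<close>

lemma homogeneous_poly_fun_sum:
  assumes "\<And>i. i \<in> I \<Longrightarrow> homogeneous_poly_fun n m D (f i)"
  shows "homogeneous_poly_fun n m D (\<lambda>X. \<Sum>i\<in>I. a i * f i X)"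
proof -
  have "\<forall>i\<in>I. \<exists>c. \<forall>X\<in>mat_tuples n m. f i X = (\<Sum>e\<in>exponents n m D. c e * monomial_fun n m e X)"
    using assms unfolding homogeneous_poly_fun_def by blast
  from bchoice[OF this] obtain c where c: "\<forall>i\<in>I. \<forall>X\<in>mat_tuples n m.
      f i X = (\<Sum>e\<in>exponents n m D. c i e * monomial_fun n m e X)" ..
  have "(\<Sum>i\<in>I. a i * f i X) = (\<Sum>e\<in>exponents n m D. (\<Sum>i\<in>I. a i * c i e) * monomial_fun n m e X)"
    if X: "X \<in> mat_tuples n m" for X
  proof -
    have "(\<Sum>i\<in>I. a i * f i X) = (\<Sum>i\<in>I. \<Sum>e\<in>exponents n m D. a i * c i e * monomial_fun n m e X)"
      by (rule sum.cong[OF refl]) (simp add: c[rule_format, OF _ X] sum_distrib_left mult.assoc)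
    also have "\<dots> = (\<Sum>e\<in>exponents n m D. \<Sum>i\<in>I. a i * c i e * monomial_fun n m e X)"
      by (rule sum.swap)
    finally show ?thesis by (simp only: sum_distrib_right)
  qed
  thus ?thesis
    unfolding homogeneous_poly_fun_def by (intro exI[of _ "\<lambda>e. \<Sum>i\<in>I. a i * c i e"] ballI)
qed

text \<open>A word lists the factors of a monomial in order; its exponent vector counts how often
  each coordinate occurs. Expanding a product of linear forms produces exactly such words.\<close>

lemma homogeneous_poly_fun_word:
  assumes w: "w \<in> {..<D} \<rightarrow> coords n m"
  shows "homogeneous_poly_fun n m D (\<lambda>X. \<Prod>s<D. case w s of (l, i, j) \<Rightarrow> (X ! l) $$ (i, j))"
proof -
  define e where "e = (\<lambda>p\<in>coords n m. card {s. s < D \<and> w s = p})"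
  have "(\<Sum>p\<in>coords n m. e p) = (\<Sum>p\<in>coords n m. \<Sum>s | s \<in> {..<D} \<and> w s = p. 1)"
    by (rule sum.cong) (simp_all add: e_def)
  also have "\<dots> = (\<Sum>s<D. 1)"
    by (rule sum.group) (use w finite_coords in auto)
  finally have "(\<Sum>p\<in>coords n m. e p) = D" by simp
  moreover have "e \<in> coords n m \<rightarrow>\<^sub>E {..D}"
  proof -
    have "card {s. s < D \<and> w s = p} \<le> card {..<D}" for p by (rule card_mono) auto
    thus ?thesis unfolding e_def by auto
  qed
  ultimately have e: "e \<in> exponents n m D" by (simp add: exponents_def)
  have "(\<Prod>s<D. case w s of (l, i, j) \<Rightarrow> (X ! l) $$ (i, j)) = monomial_fun n m e X" for X :: "'a mat list"
  proof -
    let ?g = "\<lambda>p. case p of (l, i, j) \<Rightarrow> (X ! l) $$ (i, j)"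
    have "(\<Prod>s<D. ?g (w s)) = (\<Prod>p\<in>coords n m. \<Prod>s | s \<in> {..<D} \<and> w s = p. ?g (w s))"
      by (rule prod.group[symmetric]) (use w finite_coords in auto)
    also have "\<dots> = (\<Prod>p\<in>coords n m. ?g p ^ e p)"
      by (rule prod.cong) (simp_all add: e_def)
    finally show ?thesis by (simp add: monomial_fun_def case_prod_beta)
  qed
  moreover have "monomial_fun n m e X =
      (\<Sum>\<alpha>\<in>exponents n m D. (if \<alpha> = e then 1 else 0) * monomial_fun n m \<alpha> X)" for X :: "'a mat list"
  proof -
    have "(\<Sum>\<alpha>\<in>exponents n m D. (if \<alpha> = e then 1 else 0) * monomial_fun n m \<alpha> X) =
        (\<Sum>\<alpha>\<in>exponents n m D. if \<alpha> = e then monomial_fun n m e X else 0)"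
      by (rule sum.cong) auto
    thus ?thesis using e finite_exponents[of n m D] by simp
  qed
  ultimately show ?thesis
    unfolding homogeneous_poly_fun_def by (intro exI[of _ "\<lambda>\<alpha>. if \<alpha> = e then 1 else 0"]) simp
qed

lemma homogeneous_poly_fun_cong:
  assumes "\<And>X. X \<in> mat_tuples n m \<Longrightarrow> f X = g X" "homogeneous_poly_fun n m D g"
  shows "homogeneous_poly_fun n m D f"
  using assms unfolding homogeneous_poly_fun_def by simp

lemma homogeneous_poly_fun_prod_linear:
  "homogeneous_poly_fun n m D
    (\<lambda>X. \<Prod>s<D. \<Sum>p\<in>coords n m. a s p * (case p of (l, i, j) \<Rightarrow> (X ! l) $$ (i, j)))"
proof (rule homogeneous_poly_fun_cong)
  fix X :: "'a mat list"
  let ?g = "\<lambda>p. case p of (l, i, j) \<Rightarrow> (X ! l) $$ (i, j)"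
  have "(\<Prod>s<D. \<Sum>p\<in>coords n m. a s p * ?g p) =
      (\<Sum>w\<in>PiE {..<D} (\<lambda>_. coords n m). \<Prod>s<D. a s (w s) * ?g (w s))"
    by (rule prod_sum_PiE) (simp_all add: finite_coords)
  thus "(\<Prod>s<D. \<Sum>p\<in>coords n m. a s p * ?g p) =
      (\<Sum>w\<in>PiE {..<D} (\<lambda>_. coords n m). (\<Prod>s<D. a s (w s)) * (\<Prod>s<D. ?g (w s)))"
    by (simp only: prod.distrib)
next
  show "homogeneous_poly_fun n m D (\<lambda>X. \<Sum>w\<in>PiE {..<D} (\<lambda>_. coords n m). (\<Prod>s<D. a s (w s)) *
      (\<Prod>s<D. case w s of (l, i, j) \<Rightarrow> (X ! l) $$ (i, j)))"
    by (intro homogeneous_poly_fun_sum homogeneous_poly_fun_word) (auto simp: PiE_def)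
qed

definition blowup :: "nat \<Rightarrow> nat \<Rightarrow> 'a::field mat list \<Rightarrow> 'a mat list \<Rightarrow> 'a mat" where
  "blowup n d T X = foldr (+) (map2 kronecker X T) (0\<^sub>m (n * d) (n * d))"

lemma foldr_add_mat:
  assumes "set Ms \<subseteq> carrier_mat p p"
  shows "foldr (+) Ms (0\<^sub>m p p) \<in> carrier_mat p p \<and>
    (\<forall>a<p. \<forall>b<p. foldr (+) Ms (0\<^sub>m p p) $$ (a, b) = (\<Sum>l<length Ms. (Ms ! l) $$ (a, b)))"
  using assms
proof (induction Ms)
  case (Cons M Ms)
  hence "foldr (+) Ms (0\<^sub>m p p) \<in> carrier_mat p p" "M \<in> carrier_mat p p" by auto
  thus ?case using Cons by (auto simp: sum.lessThan_Suc_shift simp del: sum.lessThan_Suc)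
qed simp

lemma blowup_carrier_index:
  assumes X: "X \<in> mat_tuples n m" and T: "T \<in> mat_tuples d m"
  shows "blowup n d T X \<in> carrier_mat (n * d) (n * d)"
    and "a < n * d \<Longrightarrow> b < n * d \<Longrightarrow> blowup n d T X $$ (a, b) =
      (\<Sum>l<m. (X ! l) $$ (a div d, b div d) * (T ! l) $$ (a mod d, b mod d))"
proof -
  have XT: "length X = m" "length T = m" "set X \<subseteq> carrier_mat n n" "set T \<subseteq> carrier_mat d d"
    using X T by (auto simp: mat_tuples_def)
  have nth: "X ! l \<in> carrier_mat n n" "T ! l \<in> carrier_mat d d" if "l < m" for l
    using XT that nth_mem[of l X] nth_mem[of l T] by auto
  have "set (map2 kronecker X T) \<subseteq> carrier_mat (n * d) (n * d)"
  proof
    fix M assume "M \<in> set (map2 kronecker X T)"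
    then obtain A B where "A \<in> set X" "B \<in> set T" "M = kronecker A B"
      by (auto dest: set_zip_leftD set_zip_rightD)
    moreover have "A \<in> carrier_mat n n" "B \<in> carrier_mat d d" using calculation XT by auto
    ultimately show "M \<in> carrier_mat (n * d) (n * d)"
      by (auto simp: kronecker_def)
  qed
  note * = foldr_add_mat[OF this]
  show "blowup n d T X \<in> carrier_mat (n * d) (n * d)" using * by (simp add: blowup_def)
  show "blowup n d T X $$ (a, b) = (\<Sum>l<m. (X ! l) $$ (a div d, b div d) * (T ! l) $$ (a mod d, b mod d))"
    if ab: "a < n * d" "b < n * d"
  proof -
    have "blowup n d T X $$ (a, b) = (\<Sum>l<length (map2 kronecker X T). (map2 kronecker X T ! l) $$ (a, b))"
      using * ab by (simp add: blowup_def)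
    also have "\<dots> = (\<Sum>l<m. (X ! l) $$ (a div d, b div d) * (T ! l) $$ (a mod d, b mod d))"
    proof (rule sum.cong)
      show "{..<length (map2 kronecker X T)} = {..<m}" using XT by simp
      fix l assume "l \<in> {..<m}"
      hence l: "l < m" by simp
      have "map2 kronecker X T ! l = kronecker (X ! l) (T ! l)" using XT l by simp
      thus "(map2 kronecker X T ! l) $$ (a, b) = (X ! l) $$ (a div d, b div d) * (T ! l) $$ (a mod d, b mod d)"
        using nth[OF l] ab by (auto simp: kronecker_def)
    qed
    finally show ?thesis .
  qed
qed

lemma det_invariant_eq_det_blowup: "det_invariant n d T X = det (blowup n d T X)"
  by (simp add: det_invariant_def blowup_def)

text \<open>Leibniz expansion: every entry of the blow-up is a linear form in the coordinates of X,
  so each permutation contributes a product of \<open>n * d\<close> linear forms.\<close>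

lemma homogeneous_poly_fun_det_invariant:
  assumes T: "T \<in> mat_tuples d m"
  shows "homogeneous_poly_fun n m (n * d) (det_invariant n d T)"
proof (rule homogeneous_poly_fun_cong)
  fix X :: "'a mat list" assume X: "X \<in> mat_tuples n m"
  define a where "a \<pi> s = (\<lambda>(l, i, j). if i = s div d \<and> j = \<pi> s div d then (T ! l) $$ (s mod d, \<pi> s mod d) else 0)"
    for \<pi> :: "nat \<Rightarrow> nat" and s
  have "blowup n d T X $$ (s, \<pi> s) = (\<Sum>p\<in>coords n m. a \<pi> s p * (case p of (l, i, j) \<Rightarrow> (X ! l) $$ (i, j)))"
    if s: "s < n * d" and \<pi>: "\<pi> s < n * d" for \<pi> s
  proof -
    have div: "s div d < n" "\<pi> s div d < n"
      using s \<pi> by (auto simp: less_mult_imp_div_less)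
    have "(\<Sum>p\<in>coords n m. a \<pi> s p * (case p of (l, i, j) \<Rightarrow> (X ! l) $$ (i, j))) =
        (\<Sum>p\<in>(\<lambda>l. (l, s div d, \<pi> s div d)) ` {..<m}. a \<pi> s p * (case p of (l, i, j) \<Rightarrow> (X ! l) $$ (i, j)))"
      by (rule sum.mono_neutral_right) (use div finite_coords in \<open>auto simp: coords_def a_def\<close>)
    also have "\<dots> = (\<Sum>l<m. (T ! l) $$ (s mod d, \<pi> s mod d) * (X ! l) $$ (s div d, \<pi> s div d))"
      by (subst sum.reindex) (auto simp: inj_on_def a_def)
    also have "\<dots> = blowup n d T X $$ (s, \<pi> s)"
      unfolding blowup_carrier_index(2)[OF X T s \<pi>] by (simp only: mult.commute)
    finally show ?thesis by simp
  qed
  hence entry: "(\<Prod>s<n * d. blowup n d T X $$ (s, \<pi> s)) =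
      (\<Prod>s<n * d. \<Sum>p\<in>coords n m. a \<pi> s p * (case p of (l, i, j) \<Rightarrow> (X ! l) $$ (i, j)))"
    if "\<pi> permutes {0..<n * d}" for \<pi>
    using permutes_in_image[OF that] by (intro prod.cong) auto
  have "det_invariant n d T X = (\<Sum>\<pi> | \<pi> permutes {0..<n * d}. of_int (sign \<pi>) *
      (\<Prod>s<n * d. blowup n d T X $$ (s, \<pi> s)))"
    unfolding det_invariant_eq_det_blowup det_def'[OF blowup_carrier_index(1)[OF X T]]
    by (simp only: atLeast0LessThan)
  also have "\<dots> = (\<Sum>\<pi> | \<pi> permutes {0..<n * d}. of_int (sign \<pi>) *
      (\<Prod>s<n * d. \<Sum>p\<in>coords n m. a \<pi> s p * (case p of (l, i, j) \<Rightarrow> (X ! l) $$ (i, j))))"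
    by (rule sum.cong) (simp_all only: entry mem_Collect_eq)
  finally show "det_invariant n d T X = (\<Sum>\<pi> | \<pi> permutes {0..<n * d}. of_int (sign \<pi>) *
      (\<Prod>s<n * d. \<Sum>p\<in>coords n m. (\<lambda>(l, i, j). if i = s div d \<and> j = \<pi> s div d
        then (T ! l) $$ (s mod d, \<pi> s mod d) else 0) p * (case p of (l, i, j) \<Rightarrow> (X ! l) $$ (i, j))))"
    unfolding a_def .
next
  show "homogeneous_poly_fun n m (n * d) (\<lambda>X. \<Sum>\<pi> | \<pi> permutes {0..<n * d}. of_int (sign \<pi>) *
      (\<Prod>s<n * d. \<Sum>p\<in>coords n m. (\<lambda>(l, i, j). if i = s div d \<and> j = \<pi> s div d
        then (T ! l) $$ (s mod d, \<pi> s mod d) else 0) p * (case p of (l, i, j) \<Rightarrow> (X ! l) $$ (i, j))))"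
    by (intro homogeneous_poly_fun_sum homogeneous_poly_fun_prod_linear)
qed

section \<open>Invariance of the determinantal invariants\<close>

lemma det_permute_both:
  fixes A :: "'a::field mat"
  assumes A: "A \<in> carrier_mat p p" and \<sigma>: "\<sigma> permutes {0..<p}"
  shows "det (mat p p (\<lambda>(i, j). A $$ (\<sigma> i, \<sigma> j))) = det A"
proof -
  have \<sigma>_less: "\<sigma> i < p" if "i < p" for i using permutes_in_image[OF \<sigma>, of i] that by simp
  let ?B = "mat p p (\<lambda>(i, j). A $$ (i, \<sigma> j))"
  let ?C = "mat p p (\<lambda>(i, j). transpose_mat A $$ (\<sigma> i, j))"
  have "mat p p (\<lambda>(i, j). A $$ (\<sigma> i, \<sigma> j)) = mat p p (\<lambda>(i, j). ?B $$ (\<sigma> i, j))"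
    by (rule eq_matI) (simp_all add: \<sigma>_less)
  hence "det (mat p p (\<lambda>(i, j). A $$ (\<sigma> i, \<sigma> j))) = of_int (sign \<sigma>) * det ?B"
    using det_permute_rows[of ?B p \<sigma>] \<sigma> by simp
  also have "det ?B = det (transpose_mat ?B)" by (rule det_transpose[symmetric, where n = p]) simp
  also have "transpose_mat ?B = ?C"
    using A by (intro eq_matI) (simp_all add: \<sigma>_less)
  also have "det ?C = of_int (sign \<sigma>) * det (transpose_mat A)"
    using A \<sigma> by (intro det_permute_rows) simp_all
  also have "det (transpose_mat A) = det A" by (rule det_transpose[OF A])
  also have "of_int (sign \<sigma>) * (of_int (sign \<sigma>) * det A) = det A"
    by (simp add: mult.assoc[symmetric] flip: of_int_mult)
  finally show ?thesis .
qed

lemma det_block_diagonal: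
  fixes A :: "'a::field mat"
  assumes A: "A \<in> carrier_mat n n" and n: "0 < n"
  shows "det (mat (d * n) (d * n) (\<lambda>(i, j). if i div n = j div n then A $$ (i mod n, j mod n) else 0)) = det A ^ d"
proof (induction d)
  case (Suc d)
  let ?D = "\<lambda>d. mat (d * n) (d * n) (\<lambda>(i, j). if i div n = j div n then A $$ (i mod n, j mod n) else 0)"
  have "?D (Suc d) = four_block_mat A (0\<^sub>m n (d * n)) (0\<^sub>m (d * n) n) (?D d)" (is "_ = ?F")
  proof (rule eq_matI)
    fix i j assume "i < dim_row ?F" "j < dim_col ?F"
    hence ij: "i < n + d * n" "j < n + d * n" using A by auto
    have dv: "x div n = Suc ((x - n) div n)" "x mod n = (x - n) mod n" if "n \<le> x" for x
      using that n by (simp_all add: le_div_geq le_mod_geq)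
    show "?D (Suc d) $$ (i, j) = ?F $$ (i, j)"
      using ij A by (cases "i < n"; cases "j < n") (auto simp: dv)
  qed (use A in auto)
  hence "det (?D (Suc d)) = det A * det (?D d)"
    using A by (simp only:) (rule det_four_block_mat_lower_left_zero, auto)
  thus ?case using Suc.IH by simp
qed simp

text \<open>Interchanging the two digits of an index turns the Kronecker product with
  \<open>1\<^sub>m d\<close> into d diagonal copies of A. \<open>\<sigma>\<close> is this
  interchange, applied to rows and columns alike so that its sign cancels.\<close>

lemma det_kronecker_one:
  fixes A :: "'a::field mat"
  assumes A: "A \<in> carrier_mat n n" and n: "0 < n" and d: "0 < d"
  shows "det (kronecker A (1\<^sub>m d)) = det A ^ d"
proof -
  define \<sigma> where "\<sigma> i = (if i < n * d then i mod d * n + i div d else i)" for i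
  let ?D = "mat (n * d) (n * d) (\<lambda>(i, j). if i div n = j div n then A $$ (i mod n, j mod n) else 0)"
  have less: "i div d < n" "i mod d < d" if "i < n * d" for i
    using that d by (auto simp: less_mult_imp_div_less)
  have \<sigma>_div_mod: "\<sigma> i div n = i mod d" "\<sigma> i mod n = i div d" if "i < n * d" for i
    using less(1)[OF that] that by (simp_all add: \<sigma>_def)
  have \<sigma>_less: "\<sigma> i < n * d" if "i < n * d" for i
  proof -
    have "\<sigma> i < i mod d * n + n" using less(1)[OF that] that by (simp add: \<sigma>_def)
    also have "\<dots> = Suc (i mod d) * n" by simp
    also have "\<dots> \<le> d * n" using less(2)[OF that] by (intro mult_le_mono1) simp
    finally show ?thesis by (simp add: mult.commute)
  qed
  have "inj_on \<sigma> {0..<n * d}"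
  proof (rule inj_onI)
    fix i j assume "i \<in> {0..<n * d}" "j \<in> {0..<n * d}" "\<sigma> i = \<sigma> j"
    hence "i mod d = j mod d" "i div d = j div d" using \<sigma>_div_mod[of i] \<sigma>_div_mod[of j] by simp_all
    thus "i = j" by (metis div_mult_mod_eq)
  qed
  moreover have "\<sigma> ` {0..<n * d} \<subseteq> {0..<n * d}" using \<sigma>_less by auto
  ultimately have "bij_betw \<sigma> {0..<n * d} {0..<n * d}"
    by (simp add: bij_betw_def endo_inj_surj)
  hence \<sigma>: "\<sigma> permutes {0..<n * d}"
    by (rule bij_imp_permutes) (simp add: \<sigma>_def)
  have "kronecker A (1\<^sub>m d) = mat (n * d) (n * d) (\<lambda>(i, j). ?D $$ (\<sigma> i, \<sigma> j))"
    using A by (intro eq_matI) (auto simp: kronecker_def \<sigma>_less \<sigma>_div_mod less)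
  hence "det (kronecker A (1\<^sub>m d)) = det ?D"
    using det_permute_both[of ?D "n * d" \<sigma>] \<sigma> by simp
  also have "\<dots> = det A ^ d" using det_block_diagonal[OF A n, of d] by (simp only: mult.commute)
  finally show ?thesis .
qed

lemma blowup_mult_left:
  assumes X: "X \<in> mat_tuples n m" and T: "T \<in> mat_tuples d m" and A: "A \<in> carrier_mat n n" and d: "0 < d"
  shows "blowup n d T (map ((*) A) X) = kronecker A (1\<^sub>m d) * blowup n d T X"
proof -
  have X': "map ((*) A) X \<in> mat_tuples n m" using X A by (auto simp: mat_tuples_def)
  have nth: "X ! l \<in> carrier_mat n n" if "l < m" for l
    using X that nth_mem[of l X] by (auto simp: mat_tuples_def)
  note carrier = blowup_carrier_index(1)[OF X T] blowup_carrier_index(1)[OF X' T]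
  have K: "kronecker A (1\<^sub>m d) \<in> carrier_mat (n * d) (n * d)" using A by (auto simp: kronecker_def)
  show ?thesis
  proof (rule eq_matI)
    fix a b assume "a < dim_row (kronecker A (1\<^sub>m d) * blowup n d T X)"
      "b < dim_col (kronecker A (1\<^sub>m d) * blowup n d T X)"
    hence ab: "a < n * d" "b < n * d" using carrier K by auto
    hence dv: "a div d < n" "b div d < n" "a mod d < d" using d by (auto simp: less_mult_imp_div_less)
    have "(kronecker A (1\<^sub>m d) * blowup n d T X) $$ (a, b) =
        (\<Sum>h<n * d. kronecker A (1\<^sub>m d) $$ (a, h) * blowup n d T X $$ (h, b))"
      using carrier K ab by (simp add: scalar_prod_def atLeast0LessThan)
    also have "\<dots> = (\<Sum>h<n * d. (\<lambda>i p. if p = a mod d then A $$ (a div d, i) *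
        (\<Sum>l<m. (X ! l) $$ (i, b div d) * (T ! l) $$ (p, b mod d)) else 0) (h div d) (h mod d))"
      using A ab d by (intro sum.cong) (auto simp: kronecker_def blowup_carrier_index(2)[OF X T])
    also have "\<dots> = (\<Sum>i<n. \<Sum>p<d. if p = a mod d then A $$ (a div d, i) *
        (\<Sum>l<m. (X ! l) $$ (i, b div d) * (T ! l) $$ (p, b mod d)) else 0)"
      by (rule sum_div_mod)
    also have "\<dots> = (\<Sum>i<n. \<Sum>l<m. A $$ (a div d, i) * (X ! l) $$ (i, b div d) * (T ! l) $$ (a mod d, b mod d))"
      using dv by (simp add: sum_distrib_left mult.assoc)
    also have "\<dots> = (\<Sum>l<m. \<Sum>i<n. A $$ (a div d, i) * (X ! l) $$ (i, b div d) * (T ! l) $$ (a mod d, b mod d))"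
      by (rule sum.swap)
    also have "\<dots> = (\<Sum>l<m. (map ((*) A) X ! l) $$ (a div d, b div d) * (T ! l) $$ (a mod d, b mod d))"
    proof (rule sum.cong[OF refl])
      fix l assume "l \<in> {..<m}"
      hence l: "l < m" by simp
      have "(map ((*) A) X ! l) $$ (a div d, b div d) = (\<Sum>i<n. A $$ (a div d, i) * (X ! l) $$ (i, b div d))"
        using A nth[OF l] l X dv by (simp add: mat_tuples_def scalar_prod_def atLeast0LessThan)
      thus "(\<Sum>i<n. A $$ (a div d, i) * (X ! l) $$ (i, b div d) * (T ! l) $$ (a mod d, b mod d)) =
          (map ((*) A) X ! l) $$ (a div d, b div d) * (T ! l) $$ (a mod d, b mod d)"
        by (simp only: sum_distrib_right)
    qed
    also have "\<dots> = blowup n d T (map ((*) A) X) $$ (a, b)"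
      by (rule blowup_carrier_index(2)[OF X' T ab, symmetric])
    finally show "blowup n d T (map ((*) A) X) $$ (a, b) = (kronecker A (1\<^sub>m d) * blowup n d T X) $$ (a, b)" ..
  qed (use carrier K in auto)
qed

lemma blowup_mult_right:
  assumes X: "X \<in> mat_tuples n m" and T: "T \<in> mat_tuples d m" and A: "A \<in> carrier_mat n n" and d: "0 < d"
  shows "blowup n d T (map (\<lambda>Y. Y * A) X) = blowup n d T X * kronecker A (1\<^sub>m d)"
proof -
  have X': "map (\<lambda>Y. Y * A) X \<in> mat_tuples n m" using X A by (auto simp: mat_tuples_def)
  have nth: "X ! l \<in> carrier_mat n n" if "l < m" for l
    using X that nth_mem[of l X] by (auto simp: mat_tuples_def)
  note carrier = blowup_carrier_index(1)[OF X T] blowup_carrier_index(1)[OF X' T]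
  have K: "kronecker A (1\<^sub>m d) \<in> carrier_mat (n * d) (n * d)" using A by (auto simp: kronecker_def)
  show ?thesis
  proof (rule eq_matI)
    fix a b assume "a < dim_row (blowup n d T X * kronecker A (1\<^sub>m d))"
      "b < dim_col (blowup n d T X * kronecker A (1\<^sub>m d))"
    hence ab: "a < n * d" "b < n * d" using carrier K by auto
    hence dv: "a div d < n" "b div d < n" "b mod d < d" using d by (auto simp: less_mult_imp_div_less)
    have "(blowup n d T X * kronecker A (1\<^sub>m d)) $$ (a, b) =
        (\<Sum>h<n * d. blowup n d T X $$ (a, h) * kronecker A (1\<^sub>m d) $$ (h, b))"
      using carrier K ab by (simp add: scalar_prod_def atLeast0LessThan)
    also have "\<dots> = (\<Sum>h<n * d. (\<lambda>i p. if p = b mod d then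
        (\<Sum>l<m. (X ! l) $$ (a div d, i) * (T ! l) $$ (a mod d, p)) * A $$ (i, b div d) else 0) (h div d) (h mod d))"
      using A ab d by (intro sum.cong) (auto simp: kronecker_def blowup_carrier_index(2)[OF X T])
    also have "\<dots> = (\<Sum>i<n. \<Sum>p<d. if p = b mod d then
        (\<Sum>l<m. (X ! l) $$ (a div d, i) * (T ! l) $$ (a mod d, p)) * A $$ (i, b div d) else 0)"
      by (rule sum_div_mod)
    also have "\<dots> = (\<Sum>i<n. \<Sum>l<m. (X ! l) $$ (a div d, i) * A $$ (i, b div d) * (T ! l) $$ (a mod d, b mod d))"
      using dv by (simp add: sum_distrib_left mult_ac)
    also have "\<dots> = (\<Sum>l<m. \<Sum>i<n. (X ! l) $$ (a div d, i) * A $$ (i, b div d) * (T ! l) $$ (a mod d, b mod d))"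
      by (rule sum.swap)
    also have "\<dots> = (\<Sum>l<m. (map (\<lambda>Y. Y * A) X ! l) $$ (a div d, b div d) * (T ! l) $$ (a mod d, b mod d))"
    proof (rule sum.cong[OF refl])
      fix l assume "l \<in> {..<m}"
      hence l: "l < m" by simp
      have "(map (\<lambda>Y. Y * A) X ! l) $$ (a div d, b div d) = (\<Sum>i<n. (X ! l) $$ (a div d, i) * A $$ (i, b div d))"
        using A nth[OF l] l X dv by (simp add: mat_tuples_def scalar_prod_def atLeast0LessThan)
      thus "(\<Sum>i<n. (X ! l) $$ (a div d, i) * A $$ (i, b div d) * (T ! l) $$ (a mod d, b mod d)) =
          (map (\<lambda>Y. Y * A) X ! l) $$ (a div d, b div d) * (T ! l) $$ (a mod d, b mod d)"
        by (simp only: sum_distrib_right)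
    qed
    also have "\<dots> = blowup n d T (map (\<lambda>Y. Y * A) X) $$ (a, b)"
      by (rule blowup_carrier_index(2)[OF X' T ab, symmetric])
    finally show "blowup n d T (map (\<lambda>Y. Y * A) X) $$ (a, b) = (blowup n d T X * kronecker A (1\<^sub>m d)) $$ (a, b)" ..
  qed (use carrier K in auto)
qed

lemma SL_invariant_det_invariant:
  assumes T: "T \<in> mat_tuples d m" and n: "0 < n" and d: "0 < d"
  shows "SL_invariant n m (det_invariant n d T)"
  unfolding SL_invariant_def
proof (intro ballI)
  fix A B :: "'a mat" and X :: "'a mat list"
  assume A: "A \<in> SL n" and "B \<in> SL n" and X: "X \<in> mat_tuples n m"
  obtain B' where B': "mat_inverse B = Some B'" "B' \<in> SL n"
    using mat_inverse_SL[OF \<open>B \<in> SL n\<close>] by blast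
  have carrier: "A \<in> carrier_mat n n" "B' \<in> carrier_mat n n" "det A = 1" "det B' = 1"
    using A B' by (auto simp: SL_def)
  have AX: "map ((*) A) X \<in> mat_tuples n m" using X carrier by (auto simp: mat_tuples_def)
  have K: "kronecker A (1\<^sub>m d) \<in> carrier_mat (n * d) (n * d)" "kronecker B' (1\<^sub>m d) \<in> carrier_mat (n * d) (n * d)"
    using carrier by (auto simp: kronecker_def)
  have "left_right_action A B X = map (\<lambda>Y. Y * B') (map ((*) A) X)"
    by (simp add: left_right_action_def B')
  hence "blowup n d T (left_right_action A B X) =
      kronecker A (1\<^sub>m d) * blowup n d T X * kronecker B' (1\<^sub>m d)"
    by (simp only: blowup_mult_right[OF AX T carrier(2) d] blowup_mult_left[OF X T carrier(1) d])
  moreover have "det (kronecker A (1\<^sub>m d) * blowup n d T X * kronecker B' (1\<^sub>m d)) =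
      det (kronecker A (1\<^sub>m d)) * det (blowup n d T X) * det (kronecker B' (1\<^sub>m d))"
    using det_mult[OF mult_carrier_mat[OF K(1) blowup_carrier_index(1)[OF X T]] K(2)]
      det_mult[OF K(1) blowup_carrier_index(1)[OF X T]] by simp
  moreover have "det (kronecker A (1\<^sub>m d)) = 1" "det (kronecker B' (1\<^sub>m d)) = 1"
    using det_kronecker_one[OF carrier(1) n d] det_kronecker_one[OF carrier(2) n d] carrier(3,4)
    by simp_all
  ultimately show "det_invariant n d T (left_right_action A B X) = det_invariant n d T X"
    by (simp add: det_invariant_eq_det_blowup)
qed

section \<open>The pencil lies outside the null cone\<close>

text \<open>The functions 1 / (\<open>\<mu> i\<close> - t) and the constant 1 are independent on the
  k + 1 points \<open>\<nu> q\<close>: over the common denominator, the relation becomes a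
  polynomial of degree at most k with k + 1 zeros, hence 0. At t = \<open>\<mu> i\<close> only the
  i-th product survives.\<close>

lemma cauchy_system_trivial:
  fixes \<mu> \<nu> x :: "nat \<Rightarrow> 'a::field"
  assumes \<mu>: "inj_on \<mu> {..<k}" and \<nu>: "inj_on \<nu> {..k}"
    and ne: "\<And>i q. i < k \<Longrightarrow> q \<le> k \<Longrightarrow> \<mu> i \<noteq> \<nu> q"
    and eq: "\<And>q. q \<le> k \<Longrightarrow> (\<Sum>i<k. x i / (\<mu> i - \<nu> q)) = K"
    and i: "i < k"
  shows "x i = 0"
proof -
  define P where "P = (\<Sum>i<k. [:x i:] * (\<Prod>j\<in>{..<k} - {i}. [:\<mu> j, -1:]))"
  define Q where "Q = [:K:] * (\<Prod>j<k. [:\<mu> j, -1:])"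
  have deg_prod: "degree (\<Prod>j\<in>S. [:\<mu> j, -1:]) \<le> card S" if "finite S" for S
    using degree_prod_sum_le[OF that, of "\<lambda>j. [:\<mu> j, -1:]"] by simp
  have degP: "degree P \<le> k"
    unfolding P_def
  proof (rule degree_sum_le)
    fix i assume "i \<in> {..<k}"
    have "degree ([:x i:] * (\<Prod>j\<in>{..<k} - {i}. [:\<mu> j, -1:])) \<le>
        degree [:x i:] + degree (\<Prod>j\<in>{..<k} - {i}. [:\<mu> j, -1:])"
      by (rule degree_mult_le)
    also have "\<dots> \<le> k" using deg_prod[of "{..<k} - {i}"] card_Diff1_le[of "{..<k}" i] by simp
    finally show "degree ([:x i:] * (\<Prod>j\<in>{..<k} - {i}. [:\<mu> j, -1:])) \<le> k" .
  qed simp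
  have degQ: "degree Q \<le> k"
    unfolding Q_def using degree_mult_le[of "[:K:]" "\<Prod>j<k. [:\<mu> j, -1:]"] deg_prod[of "{..<k}"] by simp
  have "P = Q"
  proof (rule poly_eqI_degree)
    fix t assume "t \<in> \<nu> ` {..k}"
    then obtain q where q: "q \<le> k" "t = \<nu> q" by auto
    have nz: "\<mu> j - t \<noteq> 0" if "j < k" for j using ne[OF that q(1)] q(2) by simp
    have "poly P t = (\<Sum>i<k. x i * (\<Prod>j\<in>{..<k} - {i}. \<mu> j - t))"
      by (simp add: P_def poly_sum poly_prod)
    also have "\<dots> = (\<Sum>i<k. x i / (\<mu> i - t) * (\<Prod>j<k. \<mu> j - t))"
    proof (rule sum.cong[OF refl])
      fix i assume "i \<in> {..<k}"
      hence "(\<Prod>j<k. \<mu> j - t) = (\<mu> i - t) * (\<Prod>j\<in>{..<k} - {i}. \<mu> j - t)"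
        by (intro prod.remove) auto
      thus "x i * (\<Prod>j\<in>{..<k} - {i}. \<mu> j - t) = x i / (\<mu> i - t) * (\<Prod>j<k. \<mu> j - t)"
        using nz[of i] \<open>i \<in> {..<k}\<close> by simp
    qed
    also have "\<dots> = (\<Sum>i<k. x i / (\<mu> i - t)) * (\<Prod>j<k. \<mu> j - t)"
      by (simp only: sum_distrib_right)
    also have "\<dots> = K * (\<Prod>j<k. \<mu> j - t)"
      unfolding q(2) eq[OF q(1)] ..
    also have "\<dots> = poly Q t" by (simp add: Q_def poly_prod)
    finally show "poly P t = poly Q t" .
  qed (use degP degQ card_image[OF \<nu>] in simp_all)
  hence "poly P (\<mu> i) = poly Q (\<mu> i)" by simp
  moreover have "poly Q (\<mu> i) = 0" using i by (auto simp: Q_def poly_prod)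
  moreover have "poly P (\<mu> i) = x i * (\<Prod>j\<in>{..<k} - {i}. \<mu> j - \<mu> i)"
  proof -
    have "poly P (\<mu> i) = (\<Sum>h<k. x h * (\<Prod>j\<in>{..<k} - {h}. \<mu> j - \<mu> i))"
      by (simp add: P_def poly_sum poly_prod)
    also have "\<dots> = (\<Sum>h<k. if h = i then x i * (\<Prod>j\<in>{..<k} - {i}. \<mu> j - \<mu> i) else 0)"
    proof (rule sum.cong[OF refl])
      fix h assume "h \<in> {..<k}"
      have "(\<Prod>j\<in>{..<k} - {h}. \<mu> j - \<mu> i) = 0" if "h \<noteq> i"
        using that i by (intro prod_zero) auto
      thus "x h * (\<Prod>j\<in>{..<k} - {h}. \<mu> j - \<mu> i) =
          (if h = i then x i * (\<Prod>j\<in>{..<k} - {i}. \<mu> j - \<mu> i) else 0)" by simp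
    qed
    finally show ?thesis using i by simp
  qed
  moreover have "(\<Prod>j\<in>{..<k} - {i}. \<mu> j - \<mu> i) \<noteq> 0"
    using \<mu> i by (auto simp: inj_on_def)
  ultimately show ?thesis by simp
qed

text \<open>Variable 1 is \<open>x = diag (- \<nu>)\<close>, so \<open>\<mu> i + x\<close> becomes
  diagonal with entries \<open>\<mu> i - \<nu> s\<close>; variable j + 1 is the cyclic shift by j.
  At l = 0 truncated subtraction gives shift 0, the identity, as required by
  \<open>y\<^sub>0 = 1\<close>.\<close>

definition test_entry :: "nat \<Rightarrow> (nat \<Rightarrow> 'a) \<Rightarrow> nat \<Rightarrow> nat \<Rightarrow> nat \<Rightarrow> 'a::field" where
  "test_entry k \<nu> l r s = (if l = 1 then if r = s then - \<nu> s else 0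
     else if r = (s + (l - 1)) mod Suc k then 1 else 0)"

lemma test_entry_yvar: "test_entry k \<nu> (yvar j) r s = (if r = (s + j) mod Suc k then 1 else 0)"
  by (simp add: test_entry_def yvar_def)

lemma sum_unit_form: "u < m \<Longrightarrow> (\<Sum>l<m. unit_form u l * (g l :: 'a::field)) = g u"
  by (simp add: unit_form_def if_distrib[of "\<lambda>x. x * _"] cong: if_cong)

lemma sum_binary_form:
  assumes "1 < m"
  shows "(\<Sum>l<m. binary_form a b l * (g l :: 'a::field)) = a * g 0 + b * g 1"
proof -
  have "(\<Sum>l<m. binary_form a b l * g l) = (\<Sum>l\<in>{0, 1}. binary_form a b l * g l)"
    by (rule sum.mono_neutral_right) (use assms in \<open>auto simp: binary_form_def\<close>)
  thus ?thesis by (simp add: binary_form_def)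
qed

text \<open>The \<open>Blk\<close> columns express the \<open>Low\<close> part of a kernel vector
  through its \<open>Top\<close> part. Substituted into the \<open>Hub\<close> columns, this says
  that the combination of resolvents commutes with all shifts. Since the cyclic shifts are
  transitive, each coordinate of the \<open>Top\<close> part solves a Cauchy system.\<close>

lemma pencil_left_kernel_trivial:
  fixes \<mu> \<nu> :: "nat \<Rightarrow> 'a::field"
  assumes \<mu>: "inj_on \<mu> {..<k}" and \<nu>: "inj_on \<nu> {..k}"
    and ne: "\<And>i q. i < k \<Longrightarrow> q \<le> k \<Longrightarrow> \<mu> i \<noteq> \<nu> q" and m: "yvar k < m"
    and kernel: "\<And>c s. c \<in> pencil_cols k p \<Longrightarrow> s \<le> k \<Longrightarrow>
      (\<Sum>r\<in>pencil_rows k p. \<Sum>q\<le>k. Z r q *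
        (\<Sum>l<m. pencil \<mu> (\<lambda>j. binary_form (\<mu> 0) 1) (block_form 0 {..k}) r c l * test_entry k \<nu> l q s)) = 0"
    and "r \<in> pencil_rows k p" "q \<le> k"
  shows "Z r q = 0"
proof -
  define \<Phi> where "\<Phi> = pencil \<mu> (\<lambda>j. binary_form (\<mu> 0) 1) (block_form 0 {..k})"
  define A where "A r c s = (\<Sum>q\<le>k. Z r q * (\<Sum>l<m. \<Phi> r c l * test_entry k \<nu> l q s))" for r c s
  have kernel': "(\<Sum>r\<in>pencil_rows k p. A r c s) = 0" if "c \<in> pencil_cols k p" "s \<le> k" for c s
    using kernel[OF that] by (simp add: A_def \<Phi>_def)
  have fin: "finite (pencil_rows k p)" by (simp add: pencil_rows_def)
  have m': "yvar j < m" if "j \<le> k" for j using m that by (auto simp: yvar_def split: if_splits)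
  have A0: "A r c s = 0" if "\<And>l. \<Phi> r c l = 0" for r c s
    by (simp add: A_def that)
  have shift: "(\<Sum>q\<le>k. Z r q * (if q = (s + j) mod Suc k then 1 else 0)) = Z r ((s + j) mod Suc k)" for r s j
    by (simp add: if_distrib[of "\<lambda>x. _ * x"] less_Suc_eq_le[symmetric] cong: if_cong)
  have Ay: "A r c s = a * Z r ((s + j) mod Suc k)" if "\<And>l. \<Phi> r c l = a * unit_form (yvar j) l" "j \<le> k" for r c s j a
  proof -
    have "(\<Sum>l<m. \<Phi> r c l * test_entry k \<nu> l q s) = a * (if q = (s + j) mod Suc k then 1 else 0)" for q
      using sum_unit_form[OF m'[OF that(2)], of "\<lambda>l. test_entry k \<nu> l q s"]
      by (simp only: that(1) mult.assoc sum_distrib_left[symmetric] test_entry_yvar)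
    hence "A r c s = (\<Sum>q\<le>k. a * (Z r q * (if q = (s + j) mod Suc k then 1 else 0)))"
      unfolding A_def by (simp only: mult.left_commute)
    thus ?thesis by (simp only: sum_distrib_left[symmetric] shift)
  qed
  have low: "Z (Low j i) s * (\<mu> i - \<nu> s) = - Z (Top i) ((s + j) mod Suc k)"
    if "j \<le> k" "i < k" "s \<le> k" for i j s
  proof -
    have "1 < m" using m that by (auto simp: yvar_def split: if_splits)
    have "(\<Sum>r\<in>pencil_rows k p. A r (Blk j i) s) = (\<Sum>r\<in>{Top i, Low j i}. A r (Blk j i) s)"
    proof (rule sum.mono_neutral_right)
      show "\<forall>r\<in>pencil_rows k p - {Top i, Low j i}. A r (Blk j i) s = 0"
      proof
        fix r assume "r \<in> pencil_rows k p - {Top i, Low j i}"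
        thus "A r (Blk j i) s = 0" by (intro A0, cases r) (auto simp: \<Phi>_def)
      qed
    qed (use fin that in \<open>auto simp: pencil_rows_def\<close>)
    also have "\<dots> = A (Top i) (Blk j i) s + A (Low j i) (Blk j i) s" by simp
    also have "A (Top i) (Blk j i) s = 1 * Z (Top i) ((s + j) mod Suc k)"
      by (rule Ay) (use that in \<open>auto simp: \<Phi>_def\<close>)
    also have "A (Low j i) (Blk j i) s = Z (Low j i) s * (\<mu> i - \<nu> s)"
    proof -
      have \<Phi>_low: "\<Phi> (Low j i) (Blk j i) l = binary_form (\<mu> i) 1 l" for l by (simp add: \<Phi>_def)
      have "A (Low j i) (Blk j i) s = (\<Sum>q\<le>k. Z (Low j i) q * (if q = s then \<mu> i - \<nu> s else 0))"
        unfolding A_def \<Phi>_low sum_binary_form[OF \<open>1 < m\<close>]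
        by (rule sum.cong[OF refl]) (use that in \<open>auto simp: test_entry_def\<close>)
      thus ?thesis using that by (simp add: if_distrib[of "\<lambda>x. _ * x"] cong: if_cong)
    qed
    finally show ?thesis using kernel'[of "Blk j i" s] that
      by (auto simp: pencil_cols_def image_iff add_eq_0_iff)
  qed
  have hub: "(\<Sum>i<k. Z (Low j i) s) = (\<Sum>i<k. Z (Low 0 i) ((s + j) mod Suc k))"
    if "1 \<le> j" "j \<le> k" "s \<le> k" for j s
  proof -
    have "(\<Sum>r\<in>pencil_rows k p. A r (Hub j) s) = (\<Sum>r\<in>Low 0 ` {..<k} \<union> Low j ` {..<k}. A r (Hub j) s)"
    proof (rule sum.mono_neutral_right)
      show "\<forall>r\<in>pencil_rows k p - (Low 0 ` {..<k} \<union> Low j ` {..<k}). A r (Hub j) s = 0"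
      proof
        fix r assume r: "r \<in> pencil_rows k p - (Low 0 ` {..<k} \<union> Low j ` {..<k})"
        show "A r (Hub j) s = 0"
          by (rule A0, use r in \<open>cases r\<close>) (auto simp: \<Phi>_def pencil_rows_def)
      qed
    qed (use fin that in \<open>auto simp: pencil_rows_def image_iff\<close>)
    also have "\<dots> = (\<Sum>r\<in>Low 0 ` {..<k}. A r (Hub j) s) + (\<Sum>r\<in>Low j ` {..<k}. A r (Hub j) s)"
      by (rule sum.union_disjoint) (use that in auto)
    also have "\<dots> = (\<Sum>i<k. A (Low 0 i) (Hub j) s) + (\<Sum>i<k. A (Low j i) (Hub j) s)"
      by (simp add: sum.reindex inj_on_def)
    also have "(\<Sum>i<k. A (Low 0 i) (Hub j) s) = (\<Sum>i<k. Z (Low 0 i) ((s + j) mod Suc k))"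
    proof (rule sum.cong[OF refl])
      fix i
      have "A (Low 0 i) (Hub j) s = 1 * Z (Low 0 i) ((s + j) mod Suc k)"
        by (rule Ay) (use that in \<open>auto simp: \<Phi>_def\<close>)
      thus "A (Low 0 i) (Hub j) s = Z (Low 0 i) ((s + j) mod Suc k)" by simp
    qed
    also have "(\<Sum>i<k. A (Low j i) (Hub j) s) = (\<Sum>i<k. - Z (Low j i) s)"
    proof (rule sum.cong[OF refl])
      fix i
      have "A (Low j i) (Hub j) s = -1 * Z (Low j i) ((s + 0) mod Suc k)"
        by (rule Ay) (use that in \<open>auto simp: \<Phi>_def yvar_def\<close>)
      thus "A (Low j i) (Hub j) s = - Z (Low j i) s" using that by simp
    qed
    finally show ?thesis using kernel'[of "Hub j" s] that by (simp add: pencil_cols_def sum_negf)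
  qed
  have low': "Z (Low j i) s = - Z (Top i) ((s + j) mod Suc k) / (\<mu> i - \<nu> s)"
    if "j \<le> k" "i < k" "s \<le> k" for i j s
    using low[OF that] ne[OF that(2,3)] by (simp add: field_simps)
  have top: "Z (Top i) q = 0" if i: "i < k" and q: "q \<le> k" for i q
  proof (rule cauchy_system_trivial[OF \<mu> \<nu> ne _ i, of "\<lambda>i. Z (Top i) q" "\<Sum>i<k. Z (Top i) q / (\<mu> i - \<nu> q)"])
    fix s assume s: "s \<le> k"
    show "(\<Sum>i<k. Z (Top i) q / (\<mu> i - \<nu> s)) = (\<Sum>i<k. Z (Top i) q / (\<mu> i - \<nu> q))"
    proof (cases "s = q")
      case False
      \<comment> \<open>The shift carrying s to q modulo k + 1. It is nonzero because s and q
        differ, so column \<open>Hub j\<close> exists.\<close>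
      define j where "j = (if s \<le> q then q - s else q + Suc k - s)"
      have j: "1 \<le> j" "j \<le> k" "s + j = q \<or> s + j = q + Suc k"
        using s q False by (auto simp: j_def)
      have mod: "(s + j) mod Suc k = q"
        using j(3) q mod_add_self2[of q "Suc k"] by (auto simp del: mod_add_self2)
      have "(\<Sum>i<k. - Z (Top i) q / (\<mu> i - \<nu> s)) = (\<Sum>i<k. Z (Low j i) s)"
        by (rule sum.cong[OF refl]) (use low'[OF j(2) _ s] mod in simp)
      also have "\<dots> = (\<Sum>i<k. Z (Low 0 i) q)"
        using hub[OF j(1,2) s] mod by simp
      also have "\<dots> = (\<Sum>i<k. - Z (Top i) q / (\<mu> i - \<nu> q))"
        by (rule sum.cong[OF refl]) (use low'[of 0 _ q] q in simp)
      finally have "(\<Sum>i<k. - Z (Top i) q / (\<mu> i - \<nu> s)) = (\<Sum>i<k. - Z (Top i) q / (\<mu> i - \<nu> q))" .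
      thus ?thesis by (simp add: sum_negf)
    qed simp
  qed
  have pad: "Z (Row_Pad i) s = 0" if "i < p" "s \<le> k" for i s
  proof -
    have "(\<Sum>r\<in>pencil_rows k p. A r (Col_Pad i) s) = (\<Sum>r\<in>{Row_Pad i}. A r (Col_Pad i) s)"
    proof (rule sum.mono_neutral_right)
      show "\<forall>r\<in>pencil_rows k p - {Row_Pad i}. A r (Col_Pad i) s = 0"
      proof
        fix r assume "r \<in> pencil_rows k p - {Row_Pad i}"
        thus "A r (Col_Pad i) s = 0" by (intro A0, cases r) (auto simp: \<Phi>_def)
      qed
    qed (use fin that in \<open>auto simp: pencil_rows_def\<close>)
    moreover have "A (Row_Pad i) (Col_Pad i) s = 1 * Z (Row_Pad i) ((s + 0) mod Suc k)"
      by (rule Ay) (auto simp: \<Phi>_def yvar_def)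
    ultimately show ?thesis using kernel'[of "Col_Pad i" s] that by (simp add: pencil_cols_def)
  qed
  show ?thesis
    using assms(6,7) top pad low' by (auto simp: pencil_rows_def less_Suc_eq_le[symmetric])
qed

section \<open>The pencil as a tuple of matrices\<close>

definition pencil_tuple :: "nat \<Rightarrow> nat \<Rightarrow> nat \<Rightarrow> (nat \<Rightarrow> 'a) \<Rightarrow>
    (nat \<Rightarrow> pencil_row) \<Rightarrow> (nat \<Rightarrow> pencil_col) \<Rightarrow> 'a::field mat list" where
  "pencil_tuple n m k \<mu> \<rho> \<gamma> = tensor_tuple n m
     (\<lambda>i j. pencil \<mu> (\<lambda>j. binary_form (\<mu> 0) 1) (block_form 0 {..k}) (\<rho> i) (\<gamma> j))"

text \<open>A nonzero value forces n to divide D, and the bounds on D then place the weight e = D /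
  n between 1 and k, where the pencil is known to vanish.\<close>

lemma invariant_vanishes_at_pencil_tuple:
  assumes "homogeneous_invariant n m D f c" and D: "0 < D" "D < n * Suc k"
    and \<mu>: "inj_on \<mu> {..<k}"
    and \<rho>: "bij_betw \<rho> {..<n} (pencil_rows k p)" and \<gamma>: "bij_betw \<gamma> {..<n} (pencil_cols k p)"
  shows "f (pencil_tuple n m k \<mu> \<rho> \<gamma>) = 0"
proof (rule ccontr)
  interpret homogeneous_invariant n m D f c by fact
  let ?F = "\<lambda>\<Phi>. ev (\<lambda>i j l. \<Phi> (\<rho> i) (\<gamma> j) l)"
  assume "f (pencil_tuple n m k \<mu> \<rho> \<gamma>) \<noteq> 0"
  hence nz: "?F (pencil \<mu> (\<lambda>j. binary_form (\<mu> 0) 1) (block_form 0 {..k})) \<noteq> 0"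
    by (simp add: pencil_tuple_def f_eq_ev)
  obtain e where e: "D = n * e" using dvd_degree_if_nonzero[OF nz] by (elim dvdE)
  have "1 \<le> e" "e < Suc k" using D by (simp_all add: e del: mult_Suc_right)
  hence "pencil_invariant ?F k p m e \<mu>"
    by (intro pencil_invariant.intro pencil_invariant_axioms.intro
          semi_invariant_relabelled[OF e \<rho> \<gamma>] \<mu>) simp_all
  thus False using nz pencil_invariant.pencil_vanishes by blast
qed

lemma card_pencil_rows: "card (pencil_rows k p) = k * k + 2 * k + p"
proof -
  have "card (pencil_rows k p) = card (Top ` {..<k}) + card ((\<lambda>(j, i). Low j i) ` ({..k} \<times> {..<k})) + card (Row_Pad ` {..<p})"
    unfolding pencil_rows_def by (subst card_Un_disjoint; auto)+
  also have "\<dots> = k + Suc k * k + p"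
    by (subst (1 2 3) card_image) (auto simp: inj_on_def)
  finally show ?thesis by simp
qed

lemma card_pencil_cols: "card (pencil_cols k p) = k * k + 2 * k + p"
proof -
  have "card (pencil_cols k p) = card ((\<lambda>(j, i). Blk j i) ` ({..k} \<times> {..<k})) + card (Hub ` {1..k}) + card (Col_Pad ` {..<p})"
    unfolding pencil_cols_def by (subst card_Un_disjoint; auto)+
  also have "\<dots> = Suc k * k + k + p"
    by (subst (1 2 3) card_image) (auto simp: inj_on_def)
  finally show ?thesis by simp
qed

lemma det_invariant_pencil_tuple_nonzero:
  assumes \<mu>: "inj_on \<mu> {..<k}" and \<nu>: "inj_on \<nu> {..k}"
    and ne: "\<And>i q. i < k \<Longrightarrow> q \<le> k \<Longrightarrow> \<mu> i \<noteq> \<nu> q" and m: "yvar k < m"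
    and \<rho>: "bij_betw \<rho> {..<n} (pencil_rows k p)" and \<gamma>: "bij_betw \<gamma> {..<n} (pencil_cols k p)"
  defines "T \<equiv> tensor_tuple (Suc k) m (\<lambda>q s l. test_entry k \<nu> l q s)"
  shows "det_invariant n (Suc k) T (pencil_tuple n m k \<mu> \<rho> \<gamma>) \<noteq> 0"
proof
  let ?d = "Suc k"
  define \<Phi> where "\<Phi> = pencil \<mu> (\<lambda>j. binary_form (\<mu> 0) 1) (block_form 0 {..k})"
  define N where "N = blowup n ?d T (pencil_tuple n m k \<mu> \<rho> \<gamma>)"
  have X: "pencil_tuple n m k \<mu> \<rho> \<gamma> \<in> mat_tuples n m" and T: "T \<in> mat_tuples ?d m"
    by (simp_all add: pencil_tuple_def T_def tensor_tuple_in_mat_tuples)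
  have N: "N \<in> carrier_mat (n * ?d) (n * ?d)" unfolding N_def by (rule blowup_carrier_index(1)[OF X T])
  have N_index: "N $$ (a, b) = (\<Sum>l<m. \<Phi> (\<rho> (a div ?d)) (\<gamma> (b div ?d)) l * test_entry k \<nu> l (a mod ?d) (b mod ?d))"
    if ab: "a < n * ?d" "b < n * ?d" for a b
  proof -
    have "a div ?d < n" "b div ?d < n" "a mod ?d < ?d" "b mod ?d < ?d"
      using ab by (auto simp: less_mult_imp_div_less simp del: mult_Suc_right)
    thus ?thesis unfolding N_def blowup_carrier_index(2)[OF X T ab]
      by (intro sum.cong refl) (simp add: pencil_tuple_def T_def tensor_tuple_def \<Phi>_def)
  qed
  assume "det_invariant n ?d T (pencil_tuple n m k \<mu> \<rho> \<gamma>) = 0"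
  \<comment> \<open>Transposing produces a left kernel vector, to match the elimination by
    rows.\<close>
  hence "det (transpose_mat N) = 0"
    using det_transpose[OF N] by (simp add: det_invariant_eq_det_blowup N_def)
  then obtain z where z: "z \<in> carrier_vec (n * ?d)" "z \<noteq> 0\<^sub>v (n * ?d)"
    "transpose_mat N *\<^sub>v z = 0\<^sub>v (n * ?d)"
    using det_0_iff_vec_prod_zero[of "transpose_mat N" "n * ?d"] N by auto
  define \<rho>' where "\<rho>' = inv_into {..<n} \<rho>"
  have \<rho>': "\<rho>' (\<rho> i) = i" if "i < n" for i
    unfolding \<rho>'_def using \<rho> that by (intro inv_into_f_f) (auto simp: bij_betw_def)
  define Z where "Z r q = z $ (\<rho>' r * ?d + q)" for r q
  have kernel: "(\<Sum>r\<in>pencil_rows k p. \<Sum>q\<le>k. Z r q * (\<Sum>l<m. \<Phi> r c l * test_entry k \<nu> l q s)) = 0"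
    if c: "c \<in> pencil_cols k p" and s: "s \<le> k" for c s
  proof -
    obtain j where j: "j < n" "c = \<gamma> j" using \<gamma> c by (auto simp: bij_betw_def)
    define b where "b = j * ?d + s"
    have b: "b div ?d = j" "b mod ?d = s" using s by (simp_all add: b_def del: mult_Suc mult_Suc_right)
    have "b < j * ?d + ?d" using s by (simp add: b_def)
    also have "\<dots> = Suc j * ?d" by simp
    also have "\<dots> \<le> n * ?d" using j by (intro mult_le_mono1) simp
    finally have b_less: "b < n * ?d" .
    have "0 = (transpose_mat N *\<^sub>v z) $ b" using z(3) b_less by simp
    also have "\<dots> = (\<Sum>a<n * ?d. N $$ (a, b) * z $ a)"
      using N z(1) b_less by (simp add: scalar_prod_def atLeast0LessThan del: mult_Suc_right)
    also have "\<dots> = (\<Sum>a<n * ?d. (\<lambda>i q. Z (\<rho> i) q * (\<Sum>l<m. \<Phi> (\<rho> i) c l * test_entry k \<nu> l q s)) (a div ?d) (a mod ?d))"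
    proof (rule sum.cong[OF refl])
      fix a assume "a \<in> {..<n * ?d}"
      hence a: "a < n * ?d" by simp
      hence "a div ?d < n" by (rule less_mult_imp_div_less)
      hence "Z (\<rho> (a div ?d)) (a mod ?d) = z $ a" by (simp add: Z_def \<rho>' del: mult_Suc_right)
      thus "N $$ (a, b) * z $ a =
          (\<lambda>i q. Z (\<rho> i) q * (\<Sum>l<m. \<Phi> (\<rho> i) c l * test_entry k \<nu> l q s)) (a div ?d) (a mod ?d)"
        by (simp only: N_index[OF a b_less] b j(2) mult.commute)
    qed
    also have "\<dots> = (\<Sum>i<n. \<Sum>q<?d. Z (\<rho> i) q * (\<Sum>l<m. \<Phi> (\<rho> i) c l * test_entry k \<nu> l q s))"
      by (rule sum_div_mod)
    also have "\<dots> = (\<Sum>r\<in>pencil_rows k p. \<Sum>q<?d. Z r q * (\<Sum>l<m. \<Phi> r c l * test_entry k \<nu> l q s))"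
      by (rule sum.reindex_bij_betw[OF \<rho>])
    finally show ?thesis by (simp only: lessThan_Suc_atMost)
  qed
  have "z = 0\<^sub>v (n * ?d)"
  proof (rule eq_vecI)
    fix a assume "a < dim_vec (0\<^sub>v (n * ?d) :: 'a vec)"
    hence a: "a < n * ?d" by simp
    hence "a div ?d < n" by (rule less_mult_imp_div_less)
    moreover have "Z (\<rho> (a div ?d)) (a mod ?d) = 0"
    proof (rule pencil_left_kernel_trivial[OF \<mu> \<nu> ne m, where Z = Z and p = p])
      show "\<rho> (a div ?d) \<in> pencil_rows k p" using \<rho> calculation by (auto simp: bij_betw_def)
      show "a mod ?d \<le> k" by (simp add: less_Suc_eq_le[symmetric])
    qed (use kernel in \<open>simp_all add: \<Phi>_def\<close>)
    ultimately have "z $ a = 0" by (simp add: Z_def \<rho>' del: mult_Suc_right)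
    thus "z $ a = 0\<^sub>v (n * ?d) $ a" using a by simp
  qed (use z in simp)
  thus False using z(2) by contradiction
qed

section \<open>Lower bounds\<close>

lemma nonconstant_invariantE:
  assumes "f \<in> nonconstant_invariants n m D" "infinite (UNIV :: 'a::field set)" "0 < n"
  obtains c where "homogeneous_invariant n m D (f :: 'a mat list \<Rightarrow> 'a) c" "0 < D"
proof -
  obtain c where "\<forall>X\<in>mat_tuples n m. f X = (\<Sum>e\<in>exponents n m D. c e * monomial_fun n m e X)"
    using assms(1) unfolding nonconstant_invariants_def homogeneous_poly_fun_def by blast
  hence hom: "homogeneous_invariant n m D f c"
    using assms by unfold_locales (auto simp: nonconstant_invariants_def)
  have "D \<noteq> 0"
  proof
    assume "D = 0"
    hence "monomial_fun n m e X = 1" if "e \<in> exponents n m D" for e and X :: "'a mat list"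
      using that unfolding monomial_fun_def exponents_def by (intro prod.neutral) auto
    hence "\<forall>X\<in>mat_tuples n m. f X = (\<Sum>e\<in>exponents n m D. c e)"
      using homogeneous_invariant.expansion[OF hom] by simp
    thus False using assms(1) unfolding nonconstant_invariants_def by blast
  qed
  thus thesis using that[OF hom] by simp
qed

lemma homogeneous_invariant_det_invariant:
  assumes "T \<in> mat_tuples d m" "infinite (UNIV :: 'a::field set)" "0 < n" "0 < d"
  obtains c where "homogeneous_invariant n m (n * d) (det_invariant n d (T :: 'a mat list)) c"
proof -
  obtain c where "\<forall>X\<in>mat_tuples n m. det_invariant n d T X =
      (\<Sum>e\<in>exponents n m (n * d). c e * monomial_fun n m e X)"
    using homogeneous_poly_fun_det_invariant[OF assms(1), of n] unfolding homogeneous_poly_fun_def by blast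
  thus thesis
    using assms SL_invariant_det_invariant[OF assms(1,3,4)] by (intro that, unfold_locales) auto
qed

text \<open>A single tuple serves both bounds: the determinantal invariants of size d \<le> k have
  degree n d < n (k + 1), so their vanishing is a special case of the vanishing in low
  degree.\<close>

lemma exists_low_degree_zero:
  assumes inf: "infinite (UNIV :: 'a::field set)" and n: "0 < n" and kn: "k * k + 2 * k \<le> n"
    and m: "yvar k < m"
  obtains X :: "'a::field mat list" where "X \<in> mat_tuples n m" "X \<notin> null_cone n m"
    "\<And>D f. D < n * Suc k \<Longrightarrow> f \<in> nonconstant_invariants n m D \<Longrightarrow> f X = 0"
    "\<And>d T. 1 \<le> d \<Longrightarrow> d \<le> k \<Longrightarrow> T \<in> mat_tuples d m \<Longrightarrow> det_invariant n d T X = 0"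
proof -
  obtain g :: "nat \<Rightarrow> 'a" where g: "inj g" using infinite_countable_subset[OF inf] by blast
  \<comment> \<open>The Cauchy system needs 2 k + 1 distinct scalars: \<open>g\<close> on
    \<open>{..<k}\<close> supplies the nodes, and the next k + 1 values the diagonal of x.\<close>
  define \<nu> where "\<nu> q = g (k + q)" for q
  have \<mu>: "inj_on g {..<k}" using g by (rule inj_on_subset) simp
  have \<nu>: "inj_on \<nu> {..k}" using g by (intro inj_onI) (simp add: \<nu>_def inj_eq)
  have ne: "g i \<noteq> \<nu> q" if "i < k" "q \<le> k" for i q using g that by (auto simp: \<nu>_def inj_on_def)
  define p where "p = n - (k * k + 2 * k)"
  have fin: "finite (pencil_rows k p)" "finite (pencil_cols k p)"
    by (simp_all add: pencil_rows_def pencil_cols_def)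
  have card: "card (pencil_rows k p) = n" "card (pencil_cols k p) = n"
    using kn by (simp_all add: card_pencil_rows card_pencil_cols p_def)
  obtain \<rho> where \<rho>: "bij_betw \<rho> {..<n} (pencil_rows k p)"
    using ex_bij_betw_nat_finite[OF fin(1)] card(1) by (auto simp: atLeast0LessThan)
  obtain \<gamma> where \<gamma>: "bij_betw \<gamma> {..<n} (pencil_cols k p)"
    using ex_bij_betw_nat_finite[OF fin(2)] card(2) by (auto simp: atLeast0LessThan)
  define X where "X = pencil_tuple n m k g \<rho> \<gamma>"
  define T where "T = tensor_tuple (Suc k) m (\<lambda>q s l. test_entry k \<nu> l q s)"
  have X: "X \<in> mat_tuples n m" by (simp add: X_def pencil_tuple_def tensor_tuple_in_mat_tuples)
  have T: "T \<in> mat_tuples (Suc k) m" by (simp add: T_def tensor_tuple_in_mat_tuples)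
  have nz: "det_invariant n (Suc k) T X \<noteq> 0"
    unfolding X_def T_def by (rule det_invariant_pencil_tuple_nonzero[OF \<mu> \<nu> ne m \<rho> \<gamma>])
  obtain c where hom: "homogeneous_invariant n m (n * Suc k) (det_invariant n (Suc k) T) c"
    using homogeneous_invariant_det_invariant[OF T inf n] by blast
  interpret homogeneous_invariant n m "n * Suc k" "det_invariant n (Suc k) T" c by (rule hom)
  \<comment> \<open>The zero tuple witnesses that this invariant is not constant, as membership in
    \<open>nonconstant_invariants\<close> demands.\<close>
  have "det_invariant n (Suc k) T (tensor_tuple n m (\<lambda>_ _ _. 0)) = 0"
    using ev_scale[of 0 "\<lambda>_ _ _. 0"] n by (simp add: f_eq_ev power_0_left)
  hence "\<not> (\<exists>a. \<forall>X\<in>mat_tuples n m. det_invariant n (Suc k) T X = a)"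
    using nz X tensor_tuple_in_mat_tuples[of n m "\<lambda>_ _ _. 0 :: 'a"] by metis
  hence "det_invariant n (Suc k) T \<in> nonconstant_invariants n m (n * Suc k)"
    using homogeneous_poly_fun_det_invariant[OF T] invariant by (simp add: nonconstant_invariants_def)
  hence "X \<notin> null_cone n m" using nz by (auto simp: null_cone_def zero_set_def)
  moreover have "f X = 0" if D: "D < n * Suc k" and f: "f \<in> nonconstant_invariants n m D" for D f
  proof -
    obtain c where "homogeneous_invariant n m D f c" "0 < D"
      using nonconstant_invariantE[OF f inf n] by blast
    thus ?thesis unfolding X_def
      by (rule invariant_vanishes_at_pencil_tuple[OF _ _ D \<mu> \<rho> \<gamma>])
  qed
  moreover have "det_invariant n d T X = 0" if d: "1 \<le> d" "d \<le> k" and T: "T \<in> mat_tuples d m" for d T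
  proof -
    obtain c where "homogeneous_invariant n m (n * d) (det_invariant n d T) c"
      using homogeneous_invariant_det_invariant[OF T inf n] d by auto
    thus ?thesis unfolding X_def
      by (rule invariant_vanishes_at_pencil_tuple[OF _ _ _ \<mu> \<rho> \<gamma>]) (use d n in \<open>simp_all del: mult_Suc_right\<close>)
  qed
  ultimately show thesis using X by (intro that)
qed

theorem theorem1p10:
  fixes n :: nat
  assumes "infinite (UNIV :: 'a::field set)"
    and "n \<ge> 1"
  shows "delta TYPE('a) n \<ge> enat (nat \<lfloor>sqrt (real (n + 1))\<rfloor>)
       \<and> gamma TYPE('a) n \<ge> enat (n * nat \<lfloor>sqrt (real (n + 1))\<rfloor>)"
proof -
  define s where "s = nat \<lfloor>sqrt (real (n + 1))\<rfloor>"
  have "real s \<le> sqrt (real (n + 1))" by (simp add: s_def)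
  hence "real s ^ 2 \<le> sqrt (real (n + 1)) ^ 2" by (rule power_mono) simp
  hence "real s ^ 2 \<le> real (n + 1)" by simp
  hence s_sq: "s * s \<le> n + 1" by (simp add: power2_eq_square flip: of_nat_mult)
  have "1 \<le> s" by (simp add: s_def le_nat_iff)
  then obtain k where k: "s = Suc k" by (cases s) auto
  \<comment> \<open>With s = k + 1, the inequality s^2 \<le> n + 1 is exactly the size condition of
    the pencil.\<close>
  have kn: "k * k + 2 * k \<le> n" using s_sq by (simp add: k)
  have "n \<le> n\<^sup>2" by (simp add: power2_eq_square)
  \<comment> \<open>The pencil has k + 2 variables, or just variable 0 when k = 0; a tuple of length
    \<open>n\<^sup>2\<close> has room for them.\<close>
  hence m: "yvar k < n\<^sup>2" using kn assms(2) by (cases k) (auto simp: yvar_def)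
  obtain X :: "'a mat list" where X: "X \<in> mat_tuples n (n\<^sup>2)" "X \<notin> null_cone n (n\<^sup>2)"
    and low_degree: "\<And>D f. D < n * s \<Longrightarrow> f \<in> nonconstant_invariants n (n\<^sup>2) D \<Longrightarrow> f X = 0"
    and low_size: "\<And>d T. 1 \<le> d \<Longrightarrow> d \<le> k \<Longrightarrow> T \<in> mat_tuples d (n\<^sup>2) \<Longrightarrow> det_invariant n d T X = 0"
    using exists_low_degree_zero[OF assms(1) _ kn m] assms(2) k by auto
  have "enat s \<le> delta_tuple TYPE('a) n (n\<^sup>2)"
    unfolding delta_tuple_def
  proof (rule Inf_greatest)
    fix x assume "x \<in> {enat l | l. 1 \<le> l \<and> (\<forall>X \<in> mat_tuples n (n\<^sup>2) - (null_cone n (n\<^sup>2) :: 'a mat list set).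
        \<exists>d. 1 \<le> d \<and> d \<le> l \<and> (\<exists>T\<in>mat_tuples d (n\<^sup>2). det_invariant n d T X \<noteq> 0))}"
    then obtain l d T where l: "x = enat l" "1 \<le> d" "d \<le> l" "T \<in> mat_tuples d (n\<^sup>2)"
      "det_invariant n d T X \<noteq> 0" using X by blast
    hence "\<not> d \<le> k" using low_size by blast
    thus "enat s \<le> x" using l k by simp
  qed
  also have "\<dots> \<le> delta TYPE('a) n"
    unfolding delta_def using assms(2) by (intro SUP_upper) simp
  finally have "enat s \<le> delta TYPE('a) n" .
  moreover have "enat (n * s) \<le> gamma TYPE('a) n"
    unfolding gamma_def gamma_tuple_def
  proof (rule Inf_greatest)
    fix x assume "x \<in> {enat d | d. 1 \<le> d \<and> zero_set n (n\<^sup>2) (\<Union>e\<in>{..d}. nonconstant_invariants n (n\<^sup>2) e) =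
        (null_cone n (n\<^sup>2) :: 'a mat list set)}"
    then obtain d where d: "x = enat d"
      "zero_set n (n\<^sup>2) (\<Union>e\<in>{..d}. nonconstant_invariants n (n\<^sup>2) e) = (null_cone n (n\<^sup>2) :: 'a mat list set)"
      by blast
    have "\<not> d < n * s"
    proof
      assume "d < n * s"
      hence "X \<in> zero_set n (n\<^sup>2) (\<Union>e\<in>{..d}. nonconstant_invariants n (n\<^sup>2) e)"
        using X(1) by (auto simp: zero_set_def intro: low_degree[OF le_less_trans])
      thus False using X(2) d(2) by simp
    qed
    thus "enat (n * s) \<le> x" using d(1) by simp
  qed
  ultimately show ?thesis by (simp add: s_def)
qed

end
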